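(* Each nearly cosymplectic (non-coKähler) $5$-dimensional manifold carries a Sasaki-Einstein structure. Conversely, each Sasaki-Einstein $5$-manifold carries a $1$-parameter family of nearly cosymplectic (non-coKähler) structures.
   Context: All manifolds are smooth and connected; $\nabla$ is the Levi-Civita connection of $g$; $d\eta(X,Y)=X(\eta(Y))-Y(\eta(X))-\eta([X,Y])$ and $u\wedge v=u\otimes v-v\otimes u$ for $1$-forms. An almost contact metric structure $(\phi,\xi,\eta,g)$ on $M^{2n+1}$ consists of a $(1,1)$-tensor field $\phi$, a vector field $\xi$, a $1$-form $\eta$ and a Riemannian metric $g$ with $\phi^2=-I+\eta\otimes\xi$, $\eta(\xi)=1$, $g(\phi X,\phi Y)=g(X,Y)-\eta(X)\eta(Y)$. It is coKähler if $\nabla\phi=0$, and nearly cosymplectic if $(\nabla_X\phi)Y+(\nabla_Y\phi)X=0$ for all vector fields $X,Y$. An $SU(2)$-structure on a $5$-manifold is given equivalently by (i) three almost contact metric structures $(\phi_i,\xi,\eta,g)$, $i\in\{1,2,3\}$, with the same $\xi,\eta,g$ and $\phi_i\phi_j=\phi_k=-\phi_j\phi_i$ for every even permutation $(i,j,k)$ of $(1,2,3)$; or (ii) a quadruplet $(\eta,\omega_1,\omega_2,\omega_3)$ of a $1$-form and three $2$-forms with $\omega_i\wedge\omega_j=\delta_{ij}v$ for some $4$-form $v$ with $v\wedge\eta\neq0$, and such that $X\lrcorner\,\omega_1=Y\lrcorner\,\omega_2$ implies $\omega_3(X,Y)\ge0$. The two descriptions are related by $\omega_i(X,Y)=g(\phi_iX,Y)$.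 A Sasaki-Einstein structure on a $5$-manifold is an $SU(2)$-structure with $d\eta=-2\omega_3$, $d\omega_1=3\eta\wedge\omega_2$, $d\omega_2=-3\eta\wedge\omega_1$. *)

theory Defs
  imports "HOL-Analysis.Analysis"
begin

section \<open>Smooth manifolds\<close>

text \<open>
  \<open>k\<close>-times continuously differentiable maps on an open subset of a finite-dimensional space;
  quantifying over a fixed direction \<open>v\<close> suffices because the domain is finite-dimensional.
\<close>

primrec Ck_on :: "nat \<Rightarrow> 'e::euclidean_space set \<Rightarrow> ('e \<Rightarrow> 'f::real_normed_vector) \<Rightarrow> bool" where
  "Ck_on 0 S f \<longleftrightarrow> continuous_on S f"
| "Ck_on (Suc k) S f \<longleftrightarrow>
     (\<forall>x\<in>S. f differentiable (at x)) \<and> (\<forall>v. Ck_on k S (\<lambda>x. frechet_derivative f (at x) v))"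

definition smooth_on :: "'e::euclidean_space set \<Rightarrow> ('e \<Rightarrow> 'f::real_normed_vector) \<Rightarrow> bool" where
  "smooth_on S f \<longleftrightarrow> (\<forall>k. Ck_on k S f)"

type_synonym ('a, 'e) chart = "'a set \<times> ('a \<Rightarrow> 'e)"

abbreviation chart_dom :: "('a, 'e) chart \<Rightarrow> 'a set" where "chart_dom c \<equiv> fst c"
abbreviation chart_map :: "('a, 'e) chart \<Rightarrow> 'a \<Rightarrow> 'e" where "chart_map c \<equiv> snd c"
abbreviation chart_inv :: "('a, 'e) chart \<Rightarrow> 'e \<Rightarrow> 'a" where
  "chart_inv c \<equiv> the_inv_into (chart_dom c) (chart_map c)"

definition smooth_manifold :: "'a topology \<Rightarrow> ('a, 'e::euclidean_space) chart set \<Rightarrow> bool" where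
  "smooth_manifold M A \<longleftrightarrow>
     topspace M \<noteq> {} \<and> connected_space M \<and> Hausdorff_space M \<and>
     (\<exists>\<B>. countable \<B> \<and> (\<forall>U. openin M U \<longleftrightarrow> (\<exists>\<C>\<subseteq>\<B>. U = \<Union>\<C>))) \<and>
     topspace M = (\<Union>c\<in>A. chart_dom c) \<and>
     (\<forall>c\<in>A. openin M (chart_dom c) \<and> open (chart_map c ` chart_dom c) \<and>
        homeomorphic_map (subtopology M (chart_dom c))
          (top_of_set (chart_map c ` chart_dom c)) (chart_map c)) \<and>
     (\<forall>c\<in>A. \<forall>d\<in>A. smooth_on (chart_map c ` (chart_dom c \<inter> chart_dom d)) (chart_map d \<circ> chart_inv c))"

definition smooth_fun_on ::
  "('a, 'e::euclidean_space) chart set \<Rightarrow> 'a set \<Rightarrow> ('a \<Rightarrow> 'f::real_normed_vector) \<Rightarrow> bool" where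
  "smooth_fun_on A U f \<longleftrightarrow> (\<forall>c\<in>A. smooth_on (chart_map c ` (U \<inter> chart_dom c)) (f \<circ> chart_inv c))"


section \<open>Tangent vectors and tensor fields\<close>

text \<open>
  A preferred chart is chosen around every point \<open>p\<close>, and the tangent space at \<open>p\<close> is identified with
  the model space \<open>'e\<close> by means of it: \<open>v :: 'e\<close> stands for the tangent vector at \<open>p\<close> whose
  components in the chart \<open>chart_at A p\<close> are those of \<open>v\<close>.  A vector field is thus a
  function \<open>'a \<Rightarrow> 'e\<close> (the preferred chart may jump from point to point, so such a function need not
  be continuous), a \<open>1\<close>-form is a function \<open>'a \<Rightarrow> 'e \<Rightarrow> real\<close>, and so on.

  \<open>differential A f p v\<close> is the derivative \<open>df(v) = v(f)\<close> of a vector-valued function \<open>f\<close> in the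
  direction of the tangent vector \<open>v\<close> at \<open>p\<close>.  In particular \<open>differential A (chart_map c) p v\<close>
  gives the components of \<open>v\<close> in an arbitrary chart \<open>c\<close> around \<open>p\<close>.
\<close>

definition chart_at :: "('a, 'e) chart set \<Rightarrow> 'a \<Rightarrow> ('a, 'e) chart" where
  "chart_at A p = (SOME c. c \<in> A \<and> p \<in> chart_dom c)"

definition differential ::
  "('a, 'e::euclidean_space) chart set \<Rightarrow> ('a \<Rightarrow> 'f::real_normed_vector) \<Rightarrow> 'a \<Rightarrow> 'e \<Rightarrow> 'f" where
  "differential A f p v =
     frechet_derivative (f \<circ> chart_inv (chart_at A p)) (at (chart_map (chart_at A p) p)) v"

definition vector_field_on ::
  "'a topology \<Rightarrow> ('a, 'e::euclidean_space) chart set \<Rightarrow> 'a set \<Rightarrow> ('a \<Rightarrow> 'e) \<Rightarrow> bool" where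
  "vector_field_on M A U X \<longleftrightarrow> openin M U \<and>
     (\<forall>c\<in>A. smooth_fun_on A (U \<inter> chart_dom c) (\<lambda>p. differential A (chart_map c) p (X p)))"

text \<open>
  Tensor fields are smooth if they produce smooth functions or vector fields from all vector fields
  defined on open subsets of the manifold.
\<close>

definition one_form ::
  "'a topology \<Rightarrow> ('a, 'e::euclidean_space) chart set \<Rightarrow> ('a \<Rightarrow> 'e \<Rightarrow> real) \<Rightarrow> bool" where
  "one_form M A \<eta> \<longleftrightarrow> (\<forall>p\<in>topspace M. linear (\<eta> p)) \<and>
     (\<forall>U X. vector_field_on M A U X \<longrightarrow> smooth_fun_on A U (\<lambda>p. \<eta> p (X p)))"

definition endomorphism_field ::
  "'a topology \<Rightarrow> ('a, 'e::euclidean_space) chart set \<Rightarrow> ('a \<Rightarrow> 'e \<Rightarrow> 'e) \<Rightarrow> bool" where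
  "endomorphism_field M A \<phi> \<longleftrightarrow> (\<forall>p\<in>topspace M. linear (\<phi> p)) \<and>
     (\<forall>U X. vector_field_on M A U X \<longrightarrow> vector_field_on M A U (\<lambda>p. \<phi> p (X p)))"

definition riemannian_metric ::
  "'a topology \<Rightarrow> ('a, 'e::euclidean_space) chart set \<Rightarrow> ('a \<Rightarrow> 'e \<Rightarrow> 'e \<Rightarrow> real) \<Rightarrow> bool" where
  "riemannian_metric M A g \<longleftrightarrow>
     (\<forall>p\<in>topspace M. bilinear (g p) \<and> (\<forall>u v. g p u v = g p v u) \<and> (\<forall>v. v \<noteq> 0 \<longrightarrow> g p v v > 0)) \<and>
     (\<forall>U X Y. vector_field_on M A U X \<and> vector_field_on M A U Y \<longrightarrow>
        smooth_fun_on A U (\<lambda>p. g p (X p) (Y p)))"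

text \<open>\<open>[X, Y]\<^sup>i = X(Y\<^sup>i) - Y(X\<^sup>i)\<close>, evaluated at \<open>p\<close> in the preferred chart at \<open>p\<close>.\<close>

definition lie_bracket ::
  "('a, 'e::euclidean_space) chart set \<Rightarrow> ('a \<Rightarrow> 'e) \<Rightarrow> ('a \<Rightarrow> 'e) \<Rightarrow> 'a \<Rightarrow> 'e" where
  "lie_bracket A X Y p =
     (let c = chart_at A p
      in differential A (\<lambda>q. differential A (chart_map c) q (Y q)) p (X p)
       - differential A (\<lambda>q. differential A (chart_map c) q (X q)) p (Y p))"

text \<open>
  Exterior derivatives evaluated on vector fields, without numerical factors, and the wedge product
  of a \<open>1\<close>-form and a \<open>2\<close>-form in the matching normalization
  \<open>u \<and> v = u \<otimes> v - v \<otimes> u\<close> for \<open>1\<close>-forms.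
\<close>

definition d1 ::
  "('a, 'e::euclidean_space) chart set \<Rightarrow> ('a \<Rightarrow> 'e \<Rightarrow> real) \<Rightarrow>
   ('a \<Rightarrow> 'e) \<Rightarrow> ('a \<Rightarrow> 'e) \<Rightarrow> 'a \<Rightarrow> real" where
  "d1 A \<eta> X Y p =
     differential A (\<lambda>q. \<eta> q (Y q)) p (X p) - differential A (\<lambda>q. \<eta> q (X q)) p (Y p)
     - \<eta> p (lie_bracket A X Y p)"

definition d2 ::
  "('a, 'e::euclidean_space) chart set \<Rightarrow> ('a \<Rightarrow> 'e \<Rightarrow> 'e \<Rightarrow> real) \<Rightarrow>
   ('a \<Rightarrow> 'e) \<Rightarrow> ('a \<Rightarrow> 'e) \<Rightarrow> ('a \<Rightarrow> 'e) \<Rightarrow> 'a \<Rightarrow> real" where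
  "d2 A \<omega> X Y Z p =
     differential A (\<lambda>q. \<omega> q (Y q) (Z q)) p (X p)
     - differential A (\<lambda>q. \<omega> q (X q) (Z q)) p (Y p)
     + differential A (\<lambda>q. \<omega> q (X q) (Y q)) p (Z p)
     - \<omega> p (lie_bracket A X Y p) (Z p)
     + \<omega> p (lie_bracket A X Z p) (Y p)
     - \<omega> p (lie_bracket A Y Z p) (X p)"

definition wedge12 ::
  "('e \<Rightarrow> real) \<Rightarrow> ('e \<Rightarrow> 'e \<Rightarrow> real) \<Rightarrow> 'e \<Rightarrow> 'e \<Rightarrow> 'e \<Rightarrow> real" where
  "wedge12 \<alpha> \<omega> u v w = \<alpha> u * \<omega> v w + \<alpha> v * \<omega> w u + \<alpha> w * \<omega> u v"


section \<open>The Levi-Civita connection\<close>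

text \<open>
  Connections act on vector fields defined on arbitrary open subsets; the second conjunct says that
  \<open>\<nabla>\<^sub>X Y\<close> on an open set only depends on \<open>X\<close> and \<open>Y\<close> on that set.
\<close>

definition affine_connection ::
  "'a topology \<Rightarrow> ('a, 'e::euclidean_space) chart set \<Rightarrow>
   (('a \<Rightarrow> 'e) \<Rightarrow> ('a \<Rightarrow> 'e) \<Rightarrow> 'a \<Rightarrow> 'e) \<Rightarrow> bool" where
  "affine_connection M A nabla \<longleftrightarrow>
     (\<forall>U X Y. vector_field_on M A U X \<and> vector_field_on M A U Y \<longrightarrow>
        vector_field_on M A U (nabla X Y)) \<and>
     (\<forall>U X Y X' Y'. vector_field_on M A U X \<and> vector_field_on M A U Y \<and>
        (\<forall>p\<in>U. X' p = X p \<and> Y' p = Y p) \<longrightarrow> (\<forall>p\<in>U. nabla X' Y' p = nabla X Y p)) \<and>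
     (\<forall>U X Y Z. vector_field_on M A U X \<and> vector_field_on M A U Y \<and> vector_field_on M A U Z \<longrightarrow>
        (\<forall>p\<in>U. nabla (\<lambda>q. X q + Y q) Z p = nabla X Z p + nabla Y Z p \<and>
               nabla X (\<lambda>q. Y q + Z q) p = nabla X Y p + nabla X Z p)) \<and>
     (\<forall>U f X Y. smooth_fun_on A U f \<and> vector_field_on M A U X \<and> vector_field_on M A U Y \<longrightarrow>
        (\<forall>p\<in>U. nabla (\<lambda>q. f q *\<^sub>R X q) Y p = f p *\<^sub>R nabla X Y p \<and>
               nabla X (\<lambda>q. f q *\<^sub>R Y q) p = differential A f p (X p) *\<^sub>R Y p + f p *\<^sub>R nabla X Y p))"

definition is_levi_civita ::
  "'a topology \<Rightarrow> ('a, 'e::euclidean_space) chart set \<Rightarrow> ('a \<Rightarrow> 'e \<Rightarrow> 'e \<Rightarrow> real) \<Rightarrow>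
   (('a \<Rightarrow> 'e) \<Rightarrow> ('a \<Rightarrow> 'e) \<Rightarrow> 'a \<Rightarrow> 'e) \<Rightarrow> bool" where
  "is_levi_civita M A g nabla \<longleftrightarrow> affine_connection M A nabla \<and>
     (\<forall>U X Y. vector_field_on M A U X \<and> vector_field_on M A U Y \<longrightarrow>
        (\<forall>p\<in>U. nabla X Y p - nabla Y X p = lie_bracket A X Y p)) \<and>
     (\<forall>U X Y Z. vector_field_on M A U X \<and> vector_field_on M A U Y \<and> vector_field_on M A U Z \<longrightarrow>
        (\<forall>p\<in>U. differential A (\<lambda>q. g q (Y q) (Z q)) p (X p) =
               g p (nabla X Y p) (Z p) + g p (Y p) (nabla X Z p)))"

text \<open>
  The Levi-Civita connection is unique on vector fields over open sets; \<open>SOME\<close> only leaves open the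
  irrelevant values on functions \<open>'a \<Rightarrow> 'e\<close> that are not smooth, and outside the manifold.
\<close>

definition levi_civita ::
  "'a topology \<Rightarrow> ('a, 'e::euclidean_space) chart set \<Rightarrow> ('a \<Rightarrow> 'e \<Rightarrow> 'e \<Rightarrow> real) \<Rightarrow>
   ('a \<Rightarrow> 'e) \<Rightarrow> ('a \<Rightarrow> 'e) \<Rightarrow> 'a \<Rightarrow> 'e" where
  "levi_civita M A g = (SOME nabla. is_levi_civita M A g nabla)"

text \<open>\<open>(\<nabla>\<^sub>X \<phi>) Y = \<nabla>\<^sub>X (\<phi> Y) - \<phi> (\<nabla>\<^sub>X Y)\<close>\<close>

definition cov_deriv_endo ::
  "'a topology \<Rightarrow> ('a, 'e::euclidean_space) chart set \<Rightarrow> ('a \<Rightarrow> 'e \<Rightarrow> 'e \<Rightarrow> real) \<Rightarrow>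
   ('a \<Rightarrow> 'e \<Rightarrow> 'e) \<Rightarrow> ('a \<Rightarrow> 'e) \<Rightarrow> ('a \<Rightarrow> 'e) \<Rightarrow> 'a \<Rightarrow> 'e" where
  "cov_deriv_endo M A g \<phi> X Y p =
     levi_civita M A g X (\<lambda>q. \<phi> q (Y q)) p - \<phi> p (levi_civita M A g X Y p)"


section \<open>Almost contact metric structures and \<open>SU(2)\<close>-structures\<close>

definition almost_contact_metric ::
  "'a topology \<Rightarrow> ('a, 'e::euclidean_space) chart set \<Rightarrow> ('a \<Rightarrow> 'e \<Rightarrow> 'e) \<Rightarrow> ('a \<Rightarrow> 'e) \<Rightarrow>
   ('a \<Rightarrow> 'e \<Rightarrow> real) \<Rightarrow> ('a \<Rightarrow> 'e \<Rightarrow> 'e \<Rightarrow> real) \<Rightarrow> bool" where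
  "almost_contact_metric M A \<phi> \<xi> \<eta> g \<longleftrightarrow>
     endomorphism_field M A \<phi> \<and> vector_field_on M A (topspace M) \<xi> \<and> one_form M A \<eta> \<and>
     riemannian_metric M A g \<and>
     (\<forall>p\<in>topspace M.
        (\<forall>v. \<phi> p (\<phi> p v) = - v + \<eta> p v *\<^sub>R \<xi> p) \<and>
        \<eta> p (\<xi> p) = 1 \<and>
        (\<forall>u v. g p (\<phi> p u) (\<phi> p v) = g p u v - \<eta> p u * \<eta> p v))"

definition cokaehler ::
  "'a topology \<Rightarrow> ('a, 'e::euclidean_space) chart set \<Rightarrow> ('a \<Rightarrow> 'e \<Rightarrow> 'e) \<Rightarrow> ('a \<Rightarrow> 'e) \<Rightarrow>
   ('a \<Rightarrow> 'e \<Rightarrow> real) \<Rightarrow> ('a \<Rightarrow> 'e \<Rightarrow> 'e \<Rightarrow> real) \<Rightarrow> bool" where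
  "cokaehler M A \<phi> \<xi> \<eta> g \<longleftrightarrow> almost_contact_metric M A \<phi> \<xi> \<eta> g \<and>
     (\<forall>U X Y. vector_field_on M A U X \<and> vector_field_on M A U Y \<longrightarrow>
        (\<forall>p\<in>U. cov_deriv_endo M A g \<phi> X Y p = 0))"

definition nearly_cosymplectic ::
  "'a topology \<Rightarrow> ('a, 'e::euclidean_space) chart set \<Rightarrow> ('a \<Rightarrow> 'e \<Rightarrow> 'e) \<Rightarrow> ('a \<Rightarrow> 'e) \<Rightarrow>
   ('a \<Rightarrow> 'e \<Rightarrow> real) \<Rightarrow> ('a \<Rightarrow> 'e \<Rightarrow> 'e \<Rightarrow> real) \<Rightarrow> bool" where
  "nearly_cosymplectic M A \<phi> \<xi> \<eta> g \<longleftrightarrow> almost_contact_metric M A \<phi> \<xi> \<eta> g \<and>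
     (\<forall>U X Y. vector_field_on M A U X \<and> vector_field_on M A U Y \<longrightarrow>
        (\<forall>p\<in>U. cov_deriv_endo M A g \<phi> X Y p + cov_deriv_endo M A g \<phi> Y X p = 0))"

text \<open>Only the values \<open>\<phi> 1\<close>, \<open>\<phi> 2\<close>, \<open>\<phi> 3\<close> matter.\<close>

definition SU2_structure ::
  "'a topology \<Rightarrow> ('a, 'e::euclidean_space) chart set \<Rightarrow> (nat \<Rightarrow> 'a \<Rightarrow> 'e \<Rightarrow> 'e) \<Rightarrow> ('a \<Rightarrow> 'e) \<Rightarrow>
   ('a \<Rightarrow> 'e \<Rightarrow> real) \<Rightarrow> ('a \<Rightarrow> 'e \<Rightarrow> 'e \<Rightarrow> real) \<Rightarrow> bool" where
  "SU2_structure M A \<phi> \<xi> \<eta> g \<longleftrightarrow>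
     (\<forall>i\<in>{1, 2, 3}. almost_contact_metric M A (\<phi> i) \<xi> \<eta> g) \<and>
     (\<forall>(i, j, k)\<in>{(1, 2, 3), (2, 3, 1), (3, 1, 2)}. \<forall>p\<in>topspace M. \<forall>v.
        \<phi> i p (\<phi> j p v) = \<phi> k p v \<and> \<phi> k p v = - \<phi> j p (\<phi> i p v))"

definition fundamental_form ::
  "('a \<Rightarrow> 'e \<Rightarrow> 'e \<Rightarrow> real) \<Rightarrow> ('a \<Rightarrow> 'e \<Rightarrow> 'e) \<Rightarrow> 'a \<Rightarrow> 'e \<Rightarrow> 'e \<Rightarrow> real" where
  "fundamental_form g \<phi> p u v = g p (\<phi> p u) v"

definition sasaki_einstein ::
  "'a topology \<Rightarrow> ('a, 'e::euclidean_space) chart set \<Rightarrow> (nat \<Rightarrow> 'a \<Rightarrow> 'e \<Rightarrow> 'e) \<Rightarrow> ('a \<Rightarrow> 'e) \<Rightarrow>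
   ('a \<Rightarrow> 'e \<Rightarrow> real) \<Rightarrow> ('a \<Rightarrow> 'e \<Rightarrow> 'e \<Rightarrow> real) \<Rightarrow> bool" where
  "sasaki_einstein M A \<phi> \<xi> \<eta> g \<longleftrightarrow> SU2_structure M A \<phi> \<xi> \<eta> g \<and>
     (let \<omega> = (\<lambda>i. fundamental_form g (\<phi> i)) in
      (\<forall>U X Y. vector_field_on M A U X \<and> vector_field_on M A U Y \<longrightarrow>
         (\<forall>p\<in>U. d1 A \<eta> X Y p = - 2 * \<omega> 3 p (X p) (Y p))) \<and>
      (\<forall>U X Y Z. vector_field_on M A U X \<and> vector_field_on M A U Y \<and> vector_field_on M A U Z \<longrightarrow>
         (\<forall>p\<in>U. d2 A (\<omega> 1) X Y Z p = 3 * wedge12 (\<eta> p) (\<omega> 2 p) (X p) (Y p) (Z p) \<and>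
                d2 A (\<omega> 2) X Y Z p = - 3 * wedge12 (\<eta> p) (\<omega> 1 p) (X p) (Y p) (Z p))))"


section \<open>One-parameter families\<close>

definition smooth_param_fun_on ::
  "('a, 'e::euclidean_space) chart set \<Rightarrow> 'a set \<Rightarrow>
   (real \<Rightarrow> 'a \<Rightarrow> 'f::real_normed_vector) \<Rightarrow> bool" where
  "smooth_param_fun_on A U F \<longleftrightarrow>
     (\<forall>c\<in>A. smooth_on (UNIV \<times> chart_map c ` (U \<inter> chart_dom c)) (\<lambda>(t, y). F t (chart_inv c y)))"

text \<open>
  A family, indexed by the real line, of pairwise distinct quadruples of tensor fields that depends
  smoothly, jointly in the parameter and the point, on the parameter.
\<close>

definition one_parameter_family ::
  "'a topology \<Rightarrow> ('a, 'e::euclidean_space) chart set \<Rightarrow> (real \<Rightarrow> 'a \<Rightarrow> 'e \<Rightarrow> 'e) \<Rightarrow>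
   (real \<Rightarrow> 'a \<Rightarrow> 'e) \<Rightarrow> (real \<Rightarrow> 'a \<Rightarrow> 'e \<Rightarrow> real) \<Rightarrow> (real \<Rightarrow> 'a \<Rightarrow> 'e \<Rightarrow> 'e \<Rightarrow> real) \<Rightarrow> bool" where
  "one_parameter_family M A \<phi> \<xi> \<eta> g \<longleftrightarrow>
     (\<forall>U X. vector_field_on M A U X \<longrightarrow> (\<forall>c\<in>A. smooth_param_fun_on A (U \<inter> chart_dom c)
        (\<lambda>t p. differential A (chart_map c) p (\<phi> t p (X p))))) \<and>
     (\<forall>c\<in>A. smooth_param_fun_on A (chart_dom c) (\<lambda>t p. differential A (chart_map c) p (\<xi> t p))) \<and>
     (\<forall>U X. vector_field_on M A U X \<longrightarrow> smooth_param_fun_on A U (\<lambda>t p. \<eta> t p (X p))) \<and>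
     (\<forall>U X Y. vector_field_on M A U X \<and> vector_field_on M A U Y \<longrightarrow>
        smooth_param_fun_on A U (\<lambda>t p. g t p (X p) (Y p))) \<and>
     (\<forall>s t. s \<noteq> t \<longrightarrow>
        (\<exists>p\<in>topspace M. (\<phi> s p, \<xi> s p, \<eta> s p, g s p) \<noteq> (\<phi> t p, \<xi> t p, \<eta> t p, g t p)))"

end

theory Submission
  imports Defs
begin

text \<open>
  Let \<open>(\<phi>, \<xi>, \<eta>, g)\<close> be nearly cosymplectic and \<open>h = \<nabla>\<xi>\<close>.  Then \<open>h\<close> is skew, anticommutes with \<open>\<phi>\<close> and
  kills \<open>\<xi>\<close>, and on the 4-dimensional horizontal space this forces \<open>h\<^sup>2 = -\<mu>\<close> and determines \<open>\<nabla>\<phi>\<close>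
  by \<open>h\<close> and \<open>\<phi>\<close>.  With \<open>\<Phi> = g(\<phi>\<cdot>, \<cdot>)\<close> and \<open>\<Omega> = g(\<phi>h\<cdot>, \<cdot>)\<close> one gets \<open>d\<eta> = 2 g(h\<cdot>, \<cdot>)\<close> and
  \<open>d\<Phi> = 3 \<eta> \<and> \<Omega>\<close>; then \<open>d(d\<eta>) = 0\<close> gives \<open>d\<Omega> = -3 \<mu> \<eta> \<and> \<Phi>\<close>, and \<open>d(d\<Omega>) = 0\<close> gives \<open>d\<mu> = 0\<close>.
  If the structure is not coKaehler, then \<open>\<mu> = l\<^sup>2 > 0\<close>, and \<open>\<phi>\<^sub>1 = -\<phi>h/l\<close>, \<open>\<phi>\<^sub>2 = \<phi>\<close>, \<open>\<phi>\<^sub>3 = -h/l\<close>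
  with \<open>\<xi>/l\<close>, \<open>l\<eta>\<close>, \<open>l\<^sup>2 g\<close> is Sasaki-Einstein.

  Conversely, for a Sasaki-Einstein structure the forms \<open>d\<eta>\<close>, \<open>d\<omega>\<^sub>1\<close>, \<open>d\<omega>\<^sub>2\<close> and \<open>d\<omega>\<^sub>3 = 0\<close> determine
  the intrinsic torsion, so that \<open>\<nabla>\<xi> = -\<phi>\<^sub>3\<close> and
  \<open>(\<nabla>\<^sub>X \<phi>\<^sub>2) Y = \<eta>(Y) \<phi>\<^sub>1 X - \<eta>(X) \<phi>\<^sub>1 Y - g(\<phi>\<^sub>1 X, Y) \<xi>\<close>, which is skew in \<open>X\<close>, \<open>Y\<close> and nonzero.
  Rescaling the metric by constants does not change the Levi-Civita connection, and yields the family.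
\<close>

section \<open>Smooth maps on open sets\<close>

text \<open>No curvature enters: the information comes from differentiating algebraic identities
  once and from d d = 0. Dimension five enters because a 3-form on the horizontal 4-space that
  vanishes on all triples u, \<phi> u, w is zero. This kills the horizontal part of \<nabla>\<phi>
  and also the part of \<nabla>h that would spoil the formula for d\<Omega>; all of it is linear
  algebra at a point, kept apart from the calculus. The main obstacle is the constancy of \<mu>,
  whose two halves have different sources: along \<xi> it is \<nabla>h = 0 in the direction \<xi>, a
  consequence of d(d\<eta>) = 0, and only the horizontal half comes from d(d\<Omega>) = 0. The scale
  l is forced, since h/l has to square to -1 on horizontal vectors. In the converse direction the
  parameter arises because the nearly cosymplectic condition is invariant under homothety, whereas
  the Sasaki-Einstein equations fix the scale.\<close>

lemma Ck_on_SucI: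
  fixes f :: "'e::euclidean_space \<Rightarrow> 'f::real_normed_vector"
  assumes "\<And>x. x \<in> S \<Longrightarrow> (f has_derivative f' x) (at x)"
    and "\<And>v g. (\<And>x. x \<in> S \<Longrightarrow> g x = f' x v) \<Longrightarrow> Ck_on k S g"
  shows "Ck_on (Suc k) S f"
proof -
  have "frechet_derivative f (at x) v = f' x v" if "x \<in> S" for x v
    using frechet_derivative_at[OF assms(1)[OF that]] by simp
  then show ?thesis
    using assms by (auto simp: differentiable_def)
qed

text \<open>The derivative at a point of \<open>S\<close> sees a full neighbourhood; openness makes
  the two functions agree on one.\<close>

lemma Ck_on_cong:
  assumes "open S" "\<And>x. x \<in> S \<Longrightarrow> f x = g x" "Ck_on k S f"
  shows "Ck_on k S g"
  using assms
proof (induction k arbitrary: f g)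
  case 0
  then show ?case by (simp cong: continuous_on_cong)
next
  case (Suc k)
  have 1: "(g has_derivative frechet_derivative f (at x)) (at x)" if "x \<in> S" for x
    using Suc.prems that
    by (auto simp: frechet_derivative_works intro: has_derivative_transform_within_open)
  show ?case
  proof (rule Ck_on_SucI[OF 1])
    fix v h assume "\<And>x. x \<in> S \<Longrightarrow> h x = frechet_derivative f (at x) v"
    then show "Ck_on k S h"
      using Suc.prems by (auto intro: Suc.IH[of "\<lambda>x. frechet_derivative f (at x) v" h])
  qed
qed

lemma Ck_on_SucI':
  fixes f :: "'e::euclidean_space \<Rightarrow> 'f::real_normed_vector"
  assumes "open S" "\<And>x. x \<in> S \<Longrightarrow> (f has_derivative f' x) (at x)"
    and "\<And>v. Ck_on k S (\<lambda>x. f' x v)"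
  shows "Ck_on (Suc k) S f"
proof (rule Ck_on_SucI[OF assms(2)])
  fix v g assume "\<And>x. x \<in> S \<Longrightarrow> g x = f' x v"
  then show "Ck_on k S g"
    using Ck_on_cong[OF assms(1) _ assms(3)[of v], of g] by simp
qed

lemma Ck_on_SucD: "Ck_on (Suc k) S f \<Longrightarrow> Ck_on k S f"
proof (induction k arbitrary: f)
  case 0
  then show ?case
    by (auto intro!: continuous_at_imp_continuous_on dest: differentiable_imp_continuous_within)
qed simp

lemma Ck_on_subset: "Ck_on k S f \<Longrightarrow> T \<subseteq> S \<Longrightarrow> Ck_on k T f"
  by (induction k arbitrary: f) (auto elim: continuous_on_subset)

lemma Ck_on_local:
  assumes "\<And>x. x \<in> S \<Longrightarrow> \<exists>T. open T \<and> x \<in> T \<and> Ck_on k T f"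
  shows "Ck_on k S f"
  using assms
proof (induction k arbitrary: f)
  case 0
  then show ?case
    by (auto simp: continuous_on_eq_continuous_at intro!: continuous_at_imp_continuous_on)
      (metis continuous_on_eq_continuous_at)
next
  case (Suc k)
  have "f differentiable at x" if "x \<in> S" for x
    using Suc.prems[OF that] by auto
  moreover have "Ck_on k S (\<lambda>x. frechet_derivative f (at x) v)" for v
    using Suc.prems by (intro Suc.IH) (metis Ck_on.simps(2))
  ultimately show ?case by simp
qed

lemma Ck_on_const: "Ck_on k S (\<lambda>x. c)"
  by (induction k arbitrary: c) auto

lemma Ck_on_linear:
  fixes f :: "'e::euclidean_space \<Rightarrow> 'f::real_normed_vector"
  assumes "linear f"
  shows "Ck_on k S f"
proof -
  have 1: "(f has_derivative f) (at x)" for x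
    using assms by (simp add: linear_conv_bounded_linear bounded_linear_imp_has_derivative)
  show ?thesis
  proof (cases k)
    case 0
    then show ?thesis
      using 1 by (auto intro!: continuous_at_imp_continuous_on has_derivative_continuous)
  next
    case (Suc n)
    have "frechet_derivative f (at x) = f" for x
      using 1 frechet_derivative_at by metis
    then show ?thesis
      using 1 by (auto simp: Suc Ck_on_const differentiable_def)
  qed
qed

lemma Ck_on_add:
  assumes "open S" "Ck_on k S f" "Ck_on k S g"
  shows "Ck_on k S (\<lambda>x. f x + g x)"
  using assms
proof (induction k arbitrary: f g)
  case 0
  then show ?case by (auto intro: continuous_intros)
next
  case (Suc k)
  show ?case
    by (rule Ck_on_SucI'[where f' = "\<lambda>x v. frechet_derivative f (at x) v + frechet_derivative g (at x) v"])
      (use Suc in \<open>auto intro!: derivative_eq_intros simp: frechet_derivative_works\<close>)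
qed

lemma Ck_on_bilinear:
  assumes p: "bounded_bilinear p" and "open S" "Ck_on k S f" "Ck_on k S g"
  shows "Ck_on k S (\<lambda>x. p (f x) (g x))"
  using assms(2-)
proof (induction k arbitrary: f g)
  case 0
  then show ?case by (auto intro: bounded_bilinear.continuous_on[OF p])
next
  case (Suc k)
  show ?case
  proof (rule Ck_on_SucI'[where f' = "\<lambda>x v. p (f x) (frechet_derivative g (at x) v) + p (frechet_derivative f (at x) v) (g x)"])
    show "Ck_on k S (\<lambda>x. p (f x) (frechet_derivative g (at x) v) + p (frechet_derivative f (at x) v) (g x))" for v
      using Suc.prems Ck_on_SucD[of k S f] Ck_on_SucD[of k S g]
      by (intro Ck_on_add Suc.IH) auto
  qed (use Suc.prems in \<open>auto intro!: bounded_bilinear.FDERIV[OF p] simp: frechet_derivative_works\<close>)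
qed

lemma Ck_on_sum:
  assumes "open S" "\<And>i. i \<in> I \<Longrightarrow> Ck_on k S (f i)"
  shows "Ck_on k S (\<lambda>x. \<Sum>i\<in>I. f i x)"
  using assms by (induction I rule: infinite_finite_induct) (simp_all add: Ck_on_const Ck_on_add)

lemma linear_sum_Basis:
  fixes L :: "'e::euclidean_space \<Rightarrow> 'f::real_vector"
  assumes "linear L"
  shows "L w = (\<Sum>b\<in>Basis. (w \<bullet> b) *\<^sub>R L b)"
proof -
  have "L w = L (\<Sum>b\<in>Basis. (w \<bullet> b) *\<^sub>R b)"
    by (simp only: euclidean_representation)
  also have "\<dots> = (\<Sum>b\<in>Basis. (w \<bullet> b) *\<^sub>R L b)"
    by (simp only: linear_sum[OF assms] linear_scale[OF assms])
  finally show ?thesis .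
qed

text \<open>Iterated derivatives are taken direction by direction, so an operator-valued map is only
  known through its values on fixed vectors. Expanding the moving argument in a basis reduces to
  these values, which is what the chain rule needs.\<close>

lemma Ck_on_apply:
  fixes L :: "'e::euclidean_space \<Rightarrow> 'h::euclidean_space \<Rightarrow> 'f::real_normed_vector"
  assumes "open S" "\<And>x. x \<in> S \<Longrightarrow> linear (L x)" "\<And>v. Ck_on k S (\<lambda>x. L x v)" "Ck_on k S w"
  shows "Ck_on k S (\<lambda>x. L x (w x))"
proof -
  have "Ck_on k S (\<lambda>x. w x \<bullet> b)" for b
    by (rule Ck_on_bilinear[OF bounded_bilinear_inner]) (use assms in \<open>auto intro: Ck_on_const\<close>)
  then have "Ck_on k S (\<lambda>x. \<Sum>b\<in>Basis. (w x \<bullet> b) *\<^sub>R L x b)"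
    using assms by (intro Ck_on_sum Ck_on_bilinear[OF bounded_bilinear_scaleR]) auto
  then show ?thesis
    by (rule Ck_on_cong[OF assms(1), rotated]) (rule linear_sum_Basis[OF assms(2), symmetric])
qed

lemma Ck_on_compose:
  fixes f :: "'e::euclidean_space \<Rightarrow> 'h::euclidean_space" and g :: "'h \<Rightarrow> 'f::real_normed_vector"
  assumes "open S" "open T" "f ` S \<subseteq> T" "Ck_on k S f" "Ck_on k T g"
  shows "Ck_on k S (\<lambda>x. g (f x))"
  using assms(3-)
proof (induction k arbitrary: f g)
  case 0
  then show ?case by (auto intro: continuous_on_compose2)
next
  case (Suc k)
  have 1: "((\<lambda>x. g (f x)) has_derivative (\<lambda>v. frechet_derivative g (at (f x)) (frechet_derivative f (at x) v))) (at x)"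
    if "x \<in> S" for x
    using Suc.prems that by (intro has_derivative_compose[of f _ _ _ g]) (auto simp: frechet_derivative_works)
  show ?case
  proof (rule Ck_on_SucI'[OF assms(1) 1])
    fix v show "Ck_on k S (\<lambda>x. frechet_derivative g (at (f x)) (frechet_derivative f (at x) v))"
    proof (rule Ck_on_apply[OF assms(1)])
      show "linear (frechet_derivative g (at (f x)))" if "x \<in> S" for x
        using Suc.prems that by (intro linear_frechet_derivative) auto
      show "Ck_on k S (\<lambda>x. frechet_derivative g (at (f x)) w)" for w
        using Suc.prems Ck_on_SucD[of k S f]
        by (auto intro: Suc.IH[of f "\<lambda>y. frechet_derivative g (at y) w"])
      show "Ck_on k S (\<lambda>x. frechet_derivative f (at x) v)"
        using Suc.prems by simp
    qed
  qed
qed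

lemma Ck_on_inverse:
  fixes f :: "'e::euclidean_space \<Rightarrow> real"
  assumes "open S" "Ck_on k S f" "\<And>x. x \<in> S \<Longrightarrow> f x \<noteq> 0"
  shows "Ck_on k S (\<lambda>x. inverse (f x))"
  using assms
proof (induction k arbitrary: f)
  case 0
  then show ?case by (simp add: continuous_on_inverse)
next
  case (Suc k)
  show ?case
  proof (rule Ck_on_SucI'[where f' = "\<lambda>x v. - 1 * ((inverse (f x) * frechet_derivative f (at x) v) * inverse (f x))"])
    show "Ck_on k S (\<lambda>x. - 1 * ((inverse (f x) * frechet_derivative f (at x) v) * inverse (f x)))" for v
      using Suc.prems Ck_on_SucD[of k S f]
      by (intro Ck_on_bilinear[OF bounded_bilinear_mult] Ck_on_const Suc.IH) auto
  next
    fix x assume "x \<in> S"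
    then have "(f has_derivative frechet_derivative f (at x)) (at x)" "f x \<noteq> 0"
      using Suc.prems by (auto simp flip: frechet_derivative_works)
    from Deriv.has_derivative_inverse[OF this(2,1)]
    show "((\<lambda>x. inverse (f x)) has_derivative (\<lambda>v. - 1 * ((inverse (f x) * frechet_derivative f (at x) v) * inverse (f x)))) (at x)"
      by (simp only: mult_minus1)
  qed (use Suc.prems in simp)
qed

lemma Ck_on_exp:
  fixes f :: "'e::euclidean_space \<Rightarrow> real"
  assumes "open S" "Ck_on k S f"
  shows "Ck_on k S (\<lambda>x. exp (f x))"
  using assms
proof (induction k arbitrary: f)
  case 0
  then show ?case by (simp add: continuous_on_exp)
next
  case (Suc k)
  show ?case
  proof (rule Ck_on_SucI'[where f' = "\<lambda>x v. exp (f x) * frechet_derivative f (at x) v"])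
    show "Ck_on k S (\<lambda>x. exp (f x) * frechet_derivative f (at x) v)" for v
      using Suc.prems Ck_on_SucD[of k S f]
      by (intro Ck_on_bilinear[OF bounded_bilinear_mult] Suc.IH) auto
  next
    fix x assume "x \<in> S"
    then have "(f has_derivative frechet_derivative f (at x)) (at x)"
      using Suc.prems by (auto simp flip: frechet_derivative_works)
    from has_derivative_compose[OF this DERIV_exp[unfolded has_field_derivative_def]]
    show "((\<lambda>x. exp (f x)) has_derivative (\<lambda>v. exp (f x) * frechet_derivative f (at x) v)) (at x)" .
  qed (use Suc.prems in simp)
qed

lemma smooth_on_cong:
  "open S \<Longrightarrow> (\<And>x. x \<in> S \<Longrightarrow> f x = g x) \<Longrightarrow> smooth_on S f \<Longrightarrow> smooth_on S g"
  using Ck_on_cong[of S f g] by (simp add: smooth_on_def)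

lemma smooth_on_subset: "smooth_on S f \<Longrightarrow> T \<subseteq> S \<Longrightarrow> smooth_on T f"
  using Ck_on_subset[of _ S f T] by (simp add: smooth_on_def)

lemma smooth_on_local:
  assumes "\<And>x. x \<in> S \<Longrightarrow> \<exists>T. open T \<and> x \<in> T \<and> smooth_on T f"
  shows "smooth_on S f"
  unfolding smooth_on_def
proof
  fix k show "Ck_on k S f"
    by (rule Ck_on_local) (use assms in \<open>auto simp: smooth_on_def\<close>)
qed

lemma smooth_on_const: "smooth_on S (\<lambda>x. c)"
  by (simp add: smooth_on_def Ck_on_const)

lemma smooth_on_linear: "linear f \<Longrightarrow> smooth_on S f"
  by (simp add: smooth_on_def Ck_on_linear)

lemma smooth_on_add: "open S \<Longrightarrow> smooth_on S f \<Longrightarrow> smooth_on S g \<Longrightarrow> smooth_on S (\<lambda>x. f x + g x)"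
  by (simp add: smooth_on_def Ck_on_add)

lemma smooth_on_bilinear:
  "bounded_bilinear p \<Longrightarrow> open S \<Longrightarrow> smooth_on S f \<Longrightarrow> smooth_on S g \<Longrightarrow> smooth_on S (\<lambda>x. p (f x) (g x))"
  by (simp add: smooth_on_def Ck_on_bilinear)

lemmas smooth_on_scaleR = smooth_on_bilinear[OF bounded_bilinear_scaleR]
lemmas smooth_on_inner = smooth_on_bilinear[OF bounded_bilinear_inner]

lemma smooth_on_apply:
  fixes L :: "'e::euclidean_space \<Rightarrow> 'h::euclidean_space \<Rightarrow> 'f::real_normed_vector"
  shows "open S \<Longrightarrow> (\<And>x. x \<in> S \<Longrightarrow> linear (L x)) \<Longrightarrow> (\<And>v. smooth_on S (\<lambda>x. L x v)) \<Longrightarrow>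
    smooth_on S w \<Longrightarrow> smooth_on S (\<lambda>x. L x (w x))"
  by (simp add: smooth_on_def Ck_on_apply)

lemma smooth_on_compose:
  fixes f :: "'e::euclidean_space \<Rightarrow> 'h::euclidean_space" and g :: "'h \<Rightarrow> 'f::real_normed_vector"
  shows "open S \<Longrightarrow> open T \<Longrightarrow> f ` S \<subseteq> T \<Longrightarrow> smooth_on S f \<Longrightarrow> smooth_on T g \<Longrightarrow> smooth_on S (\<lambda>x. g (f x))"
  using Ck_on_compose[of S T f _ g] by (simp add: smooth_on_def)

lemma smooth_on_inverse:
  fixes f :: "'e::euclidean_space \<Rightarrow> real"
  shows "open S \<Longrightarrow> smooth_on S f \<Longrightarrow> (\<And>x. x \<in> S \<Longrightarrow> f x \<noteq> 0) \<Longrightarrow> smooth_on S (\<lambda>x. inverse (f x))"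
  by (simp add: smooth_on_def Ck_on_inverse)

lemma smooth_on_exp:
  fixes f :: "'e::euclidean_space \<Rightarrow> real"
  shows "open S \<Longrightarrow> smooth_on S f \<Longrightarrow> smooth_on S (\<lambda>x. exp (f x))"
  by (simp add: smooth_on_def Ck_on_exp)

lemma smooth_on_differentiable: "smooth_on S f \<Longrightarrow> x \<in> S \<Longrightarrow> f differentiable (at x)"
  using Ck_on.simps(2)[of 0 S f] by (simp add: smooth_on_def del: Ck_on.simps)

lemma smooth_on_has_derivative:
  "smooth_on S f \<Longrightarrow> x \<in> S \<Longrightarrow> (f has_derivative frechet_derivative f (at x)) (at x)"
  using smooth_on_differentiable frechet_derivative_works by blast

lemma smooth_on_deriv: "smooth_on S f \<Longrightarrow> smooth_on S (\<lambda>x. frechet_derivative f (at x) v)"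
  using Ck_on.simps(2)[of _ S f] by (simp add: smooth_on_def del: Ck_on.simps)

lemma smooth_on_linear_frechet: "smooth_on S f \<Longrightarrow> x \<in> S \<Longrightarrow> linear (frechet_derivative f (at x))"
  using smooth_on_differentiable linear_frechet_derivative by blast

section \<open>Symmetry of second derivatives\<close>

lemma second_difference_mvt:
  fixes f :: "'e::euclidean_space \<Rightarrow> real"
  assumes "smooth_on S f" "0 < s"
    and in_S: "\<And>a b. 0 \<le> a \<Longrightarrow> a \<le> s \<Longrightarrow> 0 \<le> b \<Longrightarrow> b \<le> s \<Longrightarrow> x + a *\<^sub>R u + b *\<^sub>R v \<in> S"
  shows "\<exists>a b. 0 < a \<and> a < s \<and> 0 < b \<and> b < s \<and>
    f (x + s *\<^sub>R u + s *\<^sub>R v) - f (x + s *\<^sub>R u) - f (x + s *\<^sub>R v) + f x =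
    s * s * frechet_derivative (\<lambda>y. frechet_derivative f (at y) u) (at (x + a *\<^sub>R u + b *\<^sub>R v)) v"
proof -
  let ?D = "\<lambda>y. frechet_derivative f (at y) u"
  \<comment> \<open>The second difference is the increment of \<open>\<psi>\<close> over
    \<open>[0, s]\<close>. The mean value theorem yields first the derivative along
    \<open>u\<close>, then, applied once more along \<open>v\<close>, the mixed derivative.\<close>
  define \<psi> where "\<psi> a = f (x + a *\<^sub>R u + s *\<^sub>R v) - f (x + a *\<^sub>R u)" for a
  have line: "((\<lambda>a. f (x + a *\<^sub>R u + b *\<^sub>R v)) has_real_derivative ?D (x + a *\<^sub>R u + b *\<^sub>R v)) (at a)"
    if "0 \<le> a" "a \<le> s" "0 \<le> b" "b \<le> s" for a b
  proof -
    have "((\<lambda>a. f (x + a *\<^sub>R u + b *\<^sub>R v)) has_derivative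
        (\<lambda>h. frechet_derivative f (at (x + a *\<^sub>R u + b *\<^sub>R v)) (h *\<^sub>R u))) (at a)"
      by (rule has_derivative_compose[of "\<lambda>a. x + a *\<^sub>R u + b *\<^sub>R v" _ a UNIV f, OF _ smooth_on_has_derivative[OF assms(1) in_S[OF that]]])
        (auto intro!: derivative_eq_intros)
    moreover have "frechet_derivative f (at (x + a *\<^sub>R u + b *\<^sub>R v)) (h *\<^sub>R u) = h * ?D (x + a *\<^sub>R u + b *\<^sub>R v)" for h
      using linear_scale[OF smooth_on_linear_frechet[OF assms(1) in_S[OF that]]] by simp
    ultimately show ?thesis by (simp add: has_field_derivative_def mult_commute_abs)
  qed
  have "DERIV \<psi> a :> ?D (x + a *\<^sub>R u + s *\<^sub>R v) - ?D (x + a *\<^sub>R u)" if "0 \<le> a" "a \<le> s" for a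
    unfolding \<psi>_def using line[OF that, of s] line[OF that, of 0] assms(2)
    by (auto intro!: derivative_eq_intros)
  from MVT2[OF assms(2) this] obtain a where a: "0 < a" "a < s"
    "\<psi> s - \<psi> 0 = s * (?D (x + a *\<^sub>R u + s *\<^sub>R v) - ?D (x + a *\<^sub>R u))"
    by auto
  define \<theta> where "\<theta> b = ?D (x + a *\<^sub>R u + b *\<^sub>R v)" for b
  have "DERIV \<theta> b :> frechet_derivative ?D (at (x + a *\<^sub>R u + b *\<^sub>R v)) v" if "0 \<le> b" "b \<le> s" for b
  proof -
    have S: "x + a *\<^sub>R u + b *\<^sub>R v \<in> S" using in_S a that by simp
    have "(\<theta> has_derivative (\<lambda>h. frechet_derivative ?D (at (x + a *\<^sub>R u + b *\<^sub>R v)) (h *\<^sub>R v))) (at b)"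
      unfolding \<theta>_def
      by (rule has_derivative_compose[of "\<lambda>b. x + a *\<^sub>R u + b *\<^sub>R v" _ b UNIV ?D, OF _ smooth_on_has_derivative[OF smooth_on_deriv[OF assms(1)] S]])
        (auto intro!: derivative_eq_intros)
    moreover have "frechet_derivative ?D (at (x + a *\<^sub>R u + b *\<^sub>R v)) (h *\<^sub>R v)
        = h * frechet_derivative ?D (at (x + a *\<^sub>R u + b *\<^sub>R v)) v" for h
      using linear_scale[OF smooth_on_linear_frechet[OF smooth_on_deriv[OF assms(1)] S]] by simp
    ultimately show ?thesis by (simp add: has_field_derivative_def mult_commute_abs)
  qed
  from MVT2[OF assms(2) this] obtain b where b: "0 < b" "b < s"
    "\<theta> s - \<theta> 0 = s * frechet_derivative ?D (at (x + a *\<^sub>R u + b *\<^sub>R v)) v"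
    by auto
  show ?thesis
    using a b by (intro exI[of _ a] exI[of _ b]) (auto simp: \<psi>_def \<theta>_def algebra_simps)
qed

text \<open>The second difference over a parallelogram does not see the order of \<open>u\<close>
  and \<open>v\<close>, so the two mixed derivatives share a value, attained at two points close to
  \<open>x\<close>; continuity does the rest.\<close>

lemma symmetric_second_derivative_real:
  fixes f :: "'e::euclidean_space \<Rightarrow> real"
  assumes "open S" "smooth_on S f" "x \<in> S"
  shows "frechet_derivative (\<lambda>y. frechet_derivative f (at y) u) (at x) v =
    frechet_derivative (\<lambda>y. frechet_derivative f (at y) v) (at x) u" (is "?F u v x = ?F v u x")
proof (rule ccontr)
  assume ne: "?F u v x \<noteq> ?F v u x"
  define e where "e = \<bar>?F u v x - ?F v u x\<bar> / 2"
  have "e > 0" using ne by (simp add: e_def)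
  have cont: "continuous (at x) (\<lambda>y. ?F u v y)" for u v
    using assms smooth_on_deriv[OF smooth_on_deriv[OF assms(2)]] smooth_on_differentiable
      differentiable_imp_continuous_within by blast
  obtain d1 where d1: "d1 > 0" "\<And>y. dist y x < d1 \<Longrightarrow> dist (?F u v y) (?F u v x) < e"
    using cont[of u v] \<open>e > 0\<close> by (auto simp: continuous_at_eps_delta dist_norm)
  obtain d2 where d2: "d2 > 0" "\<And>y. dist y x < d2 \<Longrightarrow> dist (?F v u y) (?F v u x) < e"
    using cont[of v u] \<open>e > 0\<close> by (auto simp: continuous_at_eps_delta dist_norm)
  obtain d3 where d3: "d3 > 0" "ball x d3 \<subseteq> S"
    using assms openE by blast
  define d where "d = min d1 (min d2 d3)"
  \<comment> \<open>This keeps the whole parallelogram within distance \<open>d\<close> of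
    \<open>x\<close>; the summand 1 covers \<open>u = v = 0\<close>.\<close>
  define s where "s = d / (2 * (norm u + norm v + 1))"
  have "d > 0" "s > 0" using d1 d2 d3 by (auto simp: d_def s_def intro!: divide_pos_pos add_nonneg_pos)
  have near: "dist (x + a *\<^sub>R u + b *\<^sub>R v) x < d" if "0 \<le> a" "a \<le> s" "0 \<le> b" "b \<le> s" for a b
  proof -
    have "dist (x + a *\<^sub>R u + b *\<^sub>R v) x = norm (a *\<^sub>R u + b *\<^sub>R v)"
      by (simp add: dist_norm algebra_simps)
    also have "\<dots> \<le> a * norm u + b * norm v"
      using norm_triangle_ineq[of "a *\<^sub>R u" "b *\<^sub>R v"] that by simp
    also have "\<dots> \<le> s * norm u + s * norm v"
      using that by (intro add_mono mult_right_mono) auto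
    also have "\<dots> < s * (2 * (norm u + norm v + 1))"
      using \<open>s > 0\<close> by (simp add: algebra_simps add_nonneg_pos)
    also have "\<dots> = d"
    proof -
      have "norm u + norm v + 1 > 0" by (intro add_nonneg_pos) auto
      then show ?thesis by (simp add: s_def)
    qed
    finally show ?thesis .
  qed
  have in_S: "x + a *\<^sub>R u + b *\<^sub>R v \<in> S" if "0 \<le> a" "a \<le> s" "0 \<le> b" "b \<le> s" for a b
    using near[OF that] d3 by (auto simp: d_def dist_commute)
  have in_S': "x + a *\<^sub>R v + b *\<^sub>R u \<in> S" if "0 \<le> a" "a \<le> s" "0 \<le> b" "b \<le> s" for a b
    using in_S[of b a] that by (simp add: add_ac)
  obtain a b where ab: "0 < a" "a < s" "0 < b" "b < s"
    "f (x + s *\<^sub>R u + s *\<^sub>R v) - f (x + s *\<^sub>R u) - f (x + s *\<^sub>R v) + f x = s * s * ?F u v (x + a *\<^sub>R u + b *\<^sub>R v)"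
    using second_difference_mvt[OF assms(2) \<open>s > 0\<close> in_S] by blast
  obtain a' b' where ab': "0 < a'" "a' < s" "0 < b'" "b' < s"
    "f (x + s *\<^sub>R v + s *\<^sub>R u) - f (x + s *\<^sub>R v) - f (x + s *\<^sub>R u) + f x = s * s * ?F v u (x + a' *\<^sub>R v + b' *\<^sub>R u)"
    using second_difference_mvt[OF assms(2) \<open>s > 0\<close> in_S'] by blast
  have "s * s * ?F u v (x + a *\<^sub>R u + b *\<^sub>R v) = s * s * ?F v u (x + a' *\<^sub>R v + b' *\<^sub>R u)"
    using ab(5) ab'(5) by (simp add: algebra_simps)
  then have "?F u v (x + a *\<^sub>R u + b *\<^sub>R v) = ?F v u (x + a' *\<^sub>R v + b' *\<^sub>R u)"
    using \<open>s > 0\<close> by simp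
  moreover have "dist (x + a *\<^sub>R u + b *\<^sub>R v) x < d" "dist (x + a' *\<^sub>R v + b' *\<^sub>R u) x < d"
    using near[of a b] near[of b' a'] ab ab' by (auto simp: add_ac)
  then have "dist (?F u v (x + a *\<^sub>R u + b *\<^sub>R v)) (?F u v x) < e"
    "dist (?F v u (x + a' *\<^sub>R v + b' *\<^sub>R u)) (?F v u x) < e"
    using d1 d2 by (auto simp: d_def)
  ultimately show False
    using dist_triangle_half_r[of "?F u v (x + a *\<^sub>R u + b *\<^sub>R v)" "?F u v x" "2 * e" "?F v u x"]
    by (simp add: e_def dist_real_def)
qed

lemma frechet_derivative_inner_left:
  fixes f :: "'e::real_normed_vector \<Rightarrow> 'f::real_inner"
  assumes "f differentiable (at x)"
  shows "frechet_derivative (\<lambda>y. f y \<bullet> b) (at x) v = frechet_derivative f (at x) v \<bullet> b"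
proof -
  have "((\<lambda>y. f y \<bullet> b) has_derivative (\<lambda>v. frechet_derivative f (at x) v \<bullet> b)) (at x)"
    using assms by (intro has_derivative_inner_left) (simp add: frechet_derivative_works)
  then show ?thesis using frechet_derivative_at by metis
qed

lemma symmetric_second_derivative:
  fixes f :: "'e::euclidean_space \<Rightarrow> 'f::euclidean_space"
  assumes "open S" "smooth_on S f" "x \<in> S"
  shows "frechet_derivative (\<lambda>y. frechet_derivative f (at y) u) (at x) v =
    frechet_derivative (\<lambda>y. frechet_derivative f (at y) v) (at x) u"
proof (rule euclidean_eqI)
  fix b :: 'f assume "b \<in> Basis"
  have "smooth_on S (\<lambda>y. f y \<bullet> b)"
    using assms by (intro smooth_on_inner smooth_on_const)
  note sym = symmetric_second_derivative_real[OF assms(1) this assms(3)]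
  have "frechet_derivative (\<lambda>y. frechet_derivative f (at y) u) (at x) v \<bullet> b
      = frechet_derivative (\<lambda>y. frechet_derivative (\<lambda>y. f y \<bullet> b) (at y) u) (at x) v" for u v
  proof -
    have "frechet_derivative (\<lambda>y. frechet_derivative f (at y) u) (at x) v \<bullet> b
        = frechet_derivative (\<lambda>y. frechet_derivative f (at y) u \<bullet> b) (at x) v"
      using frechet_derivative_inner_left smooth_on_differentiable smooth_on_deriv assms by metis
    also have "\<dots> = frechet_derivative (\<lambda>y. frechet_derivative (\<lambda>y. f y \<bullet> b) (at y) u) (at x) v"
      using frechet_derivative_inner_left[OF smooth_on_differentiable[OF assms(2)]]
      by (intro fun_cong[OF frechet_derivative_transform_within_open[OF _ assms(1,3)]])
        (use assms in \<open>auto intro!: smooth_on_differentiable[OF smooth_on_inner[OF _ smooth_on_deriv smooth_on_const]]\<close>)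
    finally show ?thesis .
  qed
  then show "frechet_derivative (\<lambda>y. frechet_derivative f (at y) u) (at x) v \<bullet> b =
      frechet_derivative (\<lambda>y. frechet_derivative f (at y) v) (at x) u \<bullet> b"
    using sym by simp
qed

section \<open>Calculus in charts\<close>

text \<open>Product rule for a derivative applied to a moving vector. For a transition map
  \<open>F\<close>, the first summand is the second derivative that has to cancel in Lie
  brackets.\<close>

lemma has_derivative_frechet_apply:
  fixes F :: "'e::euclidean_space \<Rightarrow> 'f::real_normed_vector"
  assumes "smooth_on S F" "smooth_on S w" "x \<in> S" "open S"
  shows "((\<lambda>y. frechet_derivative F (at y) (w y)) has_derivative
    (\<lambda>u. frechet_derivative (\<lambda>y. frechet_derivative F (at y) (w x)) (at x) u
       + frechet_derivative F (at x) (frechet_derivative w (at x) u))) (at x)"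
proof -
  let ?D = "frechet_derivative"
  have D2: "((\<lambda>y. ?D F (at y) b) has_derivative ?D (\<lambda>y. ?D F (at y) b) (at x)) (at x)" for b
    using smooth_on_has_derivative[OF smooth_on_deriv[OF assms(1)] assms(3)] .
  have expand: "?D F (at y) v = (\<Sum>b\<in>Basis. (v \<bullet> b) *\<^sub>R ?D F (at y) b)" if "y \<in> S" for y v
    by (rule linear_sum_Basis[OF smooth_on_linear_frechet[OF assms(1) that]])
  have "((\<lambda>y. \<Sum>b\<in>Basis. (w x \<bullet> b) *\<^sub>R ?D F (at y) b) has_derivative
      (\<lambda>u. \<Sum>b\<in>Basis. (w x \<bullet> b) *\<^sub>R ?D (\<lambda>y. ?D F (at y) b) (at x) u)) (at x)"
    by (intro has_derivative_sum has_derivative_scaleR_right D2)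
  then have "((\<lambda>y. ?D F (at y) (w x)) has_derivative
      (\<lambda>u. \<Sum>b\<in>Basis. (w x \<bullet> b) *\<^sub>R ?D (\<lambda>y. ?D F (at y) b) (at x) u)) (at x)"
    by (rule has_derivative_transform_within_open[OF _ assms(4,3)]) (rule expand[symmetric])
  then have 1: "?D (\<lambda>y. ?D F (at y) (w x)) (at x) = (\<lambda>u. \<Sum>b\<in>Basis. (w x \<bullet> b) *\<^sub>R ?D (\<lambda>y. ?D F (at y) b) (at x) u)"
    by (rule frechet_derivative_at[symmetric])
  have "((\<lambda>y. w y \<bullet> b) has_derivative (\<lambda>u. ?D w (at x) u \<bullet> b)) (at x)" for b
    by (rule has_derivative_inner_left[OF smooth_on_has_derivative[OF assms(2,3)]])
  then have "((\<lambda>y. \<Sum>b\<in>Basis. (w y \<bullet> b) *\<^sub>R ?D F (at y) b) has_derivative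
      (\<lambda>u. \<Sum>b\<in>Basis. (w x \<bullet> b) *\<^sub>R ?D (\<lambda>y. ?D F (at y) b) (at x) u + (?D w (at x) u \<bullet> b) *\<^sub>R ?D F (at x) b)) (at x)"
    by (intro has_derivative_sum has_derivative_scaleR D2)
  then have "((\<lambda>y. ?D F (at y) (w y)) has_derivative
      (\<lambda>u. \<Sum>b\<in>Basis. (w x \<bullet> b) *\<^sub>R ?D (\<lambda>y. ?D F (at y) b) (at x) u + (?D w (at x) u \<bullet> b) *\<^sub>R ?D F (at x) b)) (at x)"
    by (rule has_derivative_transform_within_open[OF _ assms(4,3)]) (rule expand[symmetric])
  then show ?thesis
    unfolding 1 sum.distrib expand[OF assms(3), of "?D w (at x) _"] .
qed

definition jac ::
  "('a, 'e::euclidean_space) chart \<Rightarrow> ('a, 'e) chart \<Rightarrow> 'a \<Rightarrow> 'e \<Rightarrow> 'e" where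
  "jac c d p = frechet_derivative (chart_map d \<circ> chart_inv c) (at (chart_map c p))"

text \<open>The vector field with constant components \<open>v\<close> in the chart \<open>c\<close>; its value at \<open>p\<close> has to be
  converted to the preferred chart at \<open>p\<close>.\<close>

definition frame :: "('a, 'e::euclidean_space) chart set \<Rightarrow> ('a, 'e) chart \<Rightarrow> 'e \<Rightarrow> 'a \<Rightarrow> 'e" where
  "frame A c v p = jac c (chart_at A p) p v"

locale smooth_mfd =
  fixes M :: "'a topology" and A :: "('a, 'e::euclidean_space) chart set"
  assumes mfd: "smooth_manifold M A"
begin

abbreviation "vf \<equiv> vector_field_on M A"
abbreviation "sf \<equiv> smooth_fun_on A"
abbreviation "D \<equiv> differential A"
abbreviation "LB \<equiv> lie_bracket A"
abbreviation "E \<equiv> frame A"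

abbreviation comps :: "('a, 'e) chart \<Rightarrow> ('a \<Rightarrow> 'e) \<Rightarrow> 'a \<Rightarrow> 'e" where
  "comps c X q \<equiv> D (chart_map c) q (X q)"

lemma chart_open: "c \<in> A \<Longrightarrow> openin M (chart_dom c)"
  using mfd by (auto simp: smooth_manifold_def)

lemma chart_subset: "c \<in> A \<Longrightarrow> chart_dom c \<subseteq> topspace M"
  using chart_open openin_subset by blast

lemma chart_homeo:
  "c \<in> A \<Longrightarrow> homeomorphic_map (subtopology M (chart_dom c)) (top_of_set (chart_map c ` chart_dom c)) (chart_map c)"
  using mfd by (auto simp: smooth_manifold_def)

lemma chart_range_open: "c \<in> A \<Longrightarrow> open (chart_map c ` chart_dom c)"
  using mfd by (auto simp: smooth_manifold_def)

lemma open_chart_image_iff: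
  assumes "c \<in> A" "U \<subseteq> chart_dom c"
  shows "open (chart_map c ` U) \<longleftrightarrow> openin M U"
proof -
  have "openin (top_of_set (chart_map c ` chart_dom c)) (chart_map c ` U) \<longleftrightarrow>
      openin (subtopology M (chart_dom c)) U"
    using homeomorphic_map_openness[OF chart_homeo[OF assms(1)]] chart_subset[OF assms(1)] assms(2)
    by auto
  then show ?thesis
    using assms chart_range_open[OF assms(1)] chart_open[OF assms(1)]
    by (simp add: openin_open_eq openin_open_subtopology image_mono)
qed

lemma openin_Int_chart: "c \<in> A \<Longrightarrow> openin M U \<Longrightarrow> openin M (U \<inter> chart_dom c)"
  using chart_open by (simp add: openin_Int)

lemma chart_image_open: "c \<in> A \<Longrightarrow> openin M U \<Longrightarrow> open (chart_map c ` (U \<inter> chart_dom c))"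
  using open_chart_image_iff[of c "U \<inter> chart_dom c"] openin_Int_chart by simp

lemma chart_inj: "c \<in> A \<Longrightarrow> inj_on (chart_map c) (chart_dom c)"
  using homeomorphic_imp_injective_map[OF chart_homeo] chart_subset by (simp add: Int_absorb1)

lemma chart_inv_map [simp]: "c \<in> A \<Longrightarrow> p \<in> chart_dom c \<Longrightarrow> chart_inv c (chart_map c p) = p"
  by (simp add: the_inv_into_f_f[OF chart_inj])

lemma chart_at_in:
  assumes "p \<in> topspace M"
  shows "chart_at A p \<in> A" "p \<in> chart_dom (chart_at A p)"
proof -
  have "\<exists>c. c \<in> A \<and> p \<in> chart_dom c"
    using assms mfd by (auto simp: smooth_manifold_def)
  from someI_ex[OF this] show "chart_at A p \<in> A" "p \<in> chart_dom (chart_at A p)"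
    by (auto simp: chart_at_def)
qed

lemma chart_at_chart: "c \<in> A \<Longrightarrow> p \<in> chart_dom c \<Longrightarrow> chart_at A p \<in> A \<and> p \<in> chart_dom (chart_at A p)"
  using chart_at_in chart_subset by blast

lemma transition_smooth:
  "c \<in> A \<Longrightarrow> d \<in> A \<Longrightarrow> smooth_on (chart_map c ` (chart_dom c \<inter> chart_dom d)) (chart_map d \<circ> chart_inv c)"
  using mfd by (auto simp: smooth_manifold_def)

lemma overlap_open: "c \<in> A \<Longrightarrow> d \<in> A \<Longrightarrow> open (chart_map c ` (chart_dom c \<inter> chart_dom d))"
  using chart_image_open[of c "chart_dom d"] chart_open by (simp add: Int_commute)

lemma transition_has_derivative:
  assumes "c \<in> A" "d \<in> A" "p \<in> chart_dom c" "p \<in> chart_dom d"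
  shows "((chart_map d \<circ> chart_inv c) has_derivative jac c d p) (at (chart_map c p))"
  unfolding jac_def using assms
  by (intro smooth_on_has_derivative[OF transition_smooth]) auto

lemma linear_jac: "c \<in> A \<Longrightarrow> d \<in> A \<Longrightarrow> p \<in> chart_dom c \<Longrightarrow> p \<in> chart_dom d \<Longrightarrow> linear (jac c d p)"
  using transition_has_derivative has_derivative_linear by blast

lemma frechet_chart_change:
  assumes c: "c \<in> A" "p \<in> chart_dom c" and d: "d \<in> A" "p \<in> chart_dom d"
    and f: "(f \<circ> chart_inv c) differentiable (at (chart_map c p))"
  shows "((f \<circ> chart_inv d) has_derivative
    (\<lambda>v. frechet_derivative (f \<circ> chart_inv c) (at (chart_map c p)) (jac d c p v))) (at (chart_map d p))"
proof -
  have f': "((f \<circ> chart_inv c) has_derivative frechet_derivative (f \<circ> chart_inv c) (at (chart_map c p)))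
      (at ((chart_map c \<circ> chart_inv d) (chart_map d p)))"
    using f c d by (simp add: frechet_derivative_works)
  have "((\<lambda>y. (f \<circ> chart_inv c) ((chart_map c \<circ> chart_inv d) y)) has_derivative
      (\<lambda>v. frechet_derivative (f \<circ> chart_inv c) (at (chart_map c p)) (jac d c p v))) (at (chart_map d p))"
    by (rule has_derivative_compose[OF transition_has_derivative[OF d(1) c(1) d(2) c(2)] f'])
  then show ?thesis
    by (rule has_derivative_transform_within_open[OF _ overlap_open[OF d(1) c(1)]])
      (use c d in auto)
qed

lemma jac_comp:
  assumes "c \<in> A" "p \<in> chart_dom c" "d \<in> A" "p \<in> chart_dom d" "e \<in> A" "p \<in> chart_dom e"
  shows "jac d e p (jac c d p v) = jac c e p v"
  using frechet_chart_change[of d p c "chart_map e"] transition_has_derivative[of d e p]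
    transition_has_derivative[of c e p] assms
  by (metis differentiableI frechet_derivative_at jac_def)

lemma jac_self [simp]:
  assumes "c \<in> A" "p \<in> chart_dom c"
  shows "jac c c p v = v"
proof -
  have "((chart_map c \<circ> chart_inv c) has_derivative (\<lambda>v. v)) (at (chart_map c p))"
    by (rule has_derivative_transform_within_open[OF has_derivative_ident chart_range_open[OF assms(1)]])
      (use assms in auto)
  then show ?thesis
    unfolding jac_def using frechet_derivative_at by metis
qed

lemma D_chart_map: "D (chart_map c) p = jac (chart_at A p) c p"
  by (simp add: differential_def jac_def fun_eq_iff)

lemma D_chart:
  assumes "c \<in> A" "p \<in> chart_dom c" "(f \<circ> chart_inv c) differentiable (at (chart_map c p))"
  shows "D f p v = frechet_derivative (f \<circ> chart_inv c) (at (chart_map c p)) (D (chart_map c) p v)"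
  unfolding D_chart_map
  using frechet_chart_change[OF assms(1,2) _ _ assms(3), of "chart_at A p"] chart_at_chart[OF assms(1,2)]
  unfolding differential_def by (metis frechet_derivative_at)

lemma D_chart_at [simp]: "p \<in> topspace M \<Longrightarrow> D (chart_map (chart_at A p)) p v = v"
  using chart_at_in by (simp add: D_chart_map)

lemma E_chart_at [simp]: "p \<in> topspace M \<Longrightarrow> E (chart_at A p) v p = v"
  using chart_at_in by (simp add: frame_def)

lemma D_chart_E:
  assumes "c \<in> A" "p \<in> chart_dom c" "d \<in> A" "p \<in> chart_dom d"
  shows "D (chart_map d) p (E c v p) = jac c d p v"
  using assms chart_at_chart[OF assms(1,2)] by (simp add: D_chart_map frame_def jac_comp)

lemma E_D_chart:
  assumes "c \<in> A" "p \<in> chart_dom c"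
  shows "E c (D (chart_map c) p v) p = v"
  using assms chart_at_chart[OF assms] by (simp add: D_chart_map frame_def jac_comp)

lemma linear_D_chart: "c \<in> A \<Longrightarrow> p \<in> chart_dom c \<Longrightarrow> linear (D (chart_map c) p)"
  by (simp add: D_chart_map linear_jac chart_at_chart)

lemma D_chart_add: "c \<in> A \<Longrightarrow> p \<in> chart_dom c \<Longrightarrow>
    D (chart_map c) p (u + v) = D (chart_map c) p u + D (chart_map c) p v"
  using linear_D_chart linear_add by blast

lemma D_chart_scale: "c \<in> A \<Longrightarrow> p \<in> chart_dom c \<Longrightarrow>
    D (chart_map c) p (r *\<^sub>R v) = r *\<^sub>R D (chart_map c) p v"
  using linear_D_chart linear_scale by blast

lemma D_chart_zero: "c \<in> A \<Longrightarrow> p \<in> chart_dom c \<Longrightarrow> D (chart_map c) p 0 = 0"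
  using linear_D_chart linear_0 by blast

lemma linear_E: "c \<in> A \<Longrightarrow> p \<in> chart_dom c \<Longrightarrow> linear (\<lambda>v. E c v p)"
  unfolding frame_def using chart_at_chart linear_jac by (auto simp: frame_def)

lemma E_expand:
  assumes "c \<in> A" "p \<in> chart_dom c"
  shows "v = (\<Sum>b\<in>Basis. (D (chart_map c) p v \<bullet> b) *\<^sub>R E c b p)"
  using linear_sum_Basis[OF linear_E[OF assms], of "D (chart_map c) p v"] E_D_chart[OF assms] by simp

subsection \<open>Smooth functions\<close>

lemma sf_chart: "sf U f \<Longrightarrow> c \<in> A \<Longrightarrow> smooth_on (chart_map c ` (U \<inter> chart_dom c)) (f \<circ> chart_inv c)"
  by (simp add: smooth_fun_on_def)

lemma sf_subset: "sf U f \<Longrightarrow> V \<subseteq> U \<Longrightarrow> sf V f"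
  unfolding smooth_fun_on_def by (auto elim!: ballE smooth_on_subset)

text \<open>Transition maps are smooth, so one chart that covers \<open>U\<close> decides smoothness
  in all charts.\<close>

lemma sf_chartI:
  assumes "openin M U" "c \<in> A" "U \<subseteq> chart_dom c" "smooth_on (chart_map c ` U) (f \<circ> chart_inv c)"
  shows "sf U f"
  unfolding smooth_fun_on_def
proof
  fix d assume d: "d \<in> A"
  let ?S = "chart_map d ` (U \<inter> chart_dom d)"
  have S: "open ?S" using chart_image_open[OF d assms(1)] .
  have "smooth_on ?S (\<lambda>y. (f \<circ> chart_inv c) ((chart_map c \<circ> chart_inv d) y))"
  proof (rule smooth_on_compose[OF S])
    show "open (chart_map c ` U)"
      using chart_image_open[OF assms(2,1)] assms(3) by (simp add: Int_absorb2)
    show "(chart_map c \<circ> chart_inv d) ` ?S \<subseteq> chart_map c ` U"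
      using d by auto
    show "smooth_on ?S (chart_map c \<circ> chart_inv d)"
      by (rule smooth_on_subset[OF transition_smooth[OF d assms(2)]]) (use assms(3) in auto)
  qed (rule assms(4))
  then show "smooth_on ?S (f \<circ> chart_inv d)"
    by (rule smooth_on_cong[OF S, rotated]) (use d assms in auto)
qed

lemma sf_local:
  assumes "\<And>p. p \<in> U \<Longrightarrow> \<exists>V. openin M V \<and> p \<in> V \<and> sf V f"
  shows "sf U f"
  unfolding smooth_fun_on_def
proof
  fix c assume c: "c \<in> A"
  show "smooth_on (chart_map c ` (U \<inter> chart_dom c)) (f \<circ> chart_inv c)"
  proof (rule smooth_on_local)
    fix y assume "y \<in> chart_map c ` (U \<inter> chart_dom c)"
    then obtain p where p: "p \<in> U" "p \<in> chart_dom c" "y = chart_map c p" by auto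
    with assms obtain V where V: "openin M V" "p \<in> V" "sf V f" by blast
    then show "\<exists>T. open T \<and> y \<in> T \<and> smooth_on T (f \<circ> chart_inv c)"
      using p c by (intro exI[of _ "chart_map c ` (V \<inter> chart_dom c)"]) (auto intro: chart_image_open sf_chart)
  qed
qed

lemma sf_cong:
  assumes "openin M U" "\<And>p. p \<in> U \<Longrightarrow> f p = g p" "sf U f"
  shows "sf U g"
  unfolding smooth_fun_on_def
proof
  fix c assume c: "c \<in> A"
  show "smooth_on (chart_map c ` (U \<inter> chart_dom c)) (g \<circ> chart_inv c)"
    by (rule smooth_on_cong[OF chart_image_open[OF c assms(1)] _ sf_chart[OF assms(3) c]])
      (use assms c in auto)
qed

lemma sf_const: "sf U (\<lambda>p. k)"
  by (simp add: smooth_fun_on_def o_def smooth_on_const)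

lemma sf_bilinear:
  assumes "bounded_bilinear b" "openin M U" "sf U f" "sf U g"
  shows "sf U (\<lambda>p. b (f p) (g p))"
  unfolding smooth_fun_on_def o_def
proof
  fix c assume c: "c \<in> A"
  show "smooth_on (chart_map c ` (U \<inter> chart_dom c)) (\<lambda>y. b (f (chart_inv c y)) (g (chart_inv c y)))"
    using sf_chart[OF assms(3) c] sf_chart[OF assms(4) c]
    by (intro smooth_on_bilinear[OF assms(1) chart_image_open[OF c assms(2)]]) (simp_all add: o_def)
qed

lemmas sf_mult = sf_bilinear[OF bounded_bilinear_mult]
lemmas sf_scaleR = sf_bilinear[OF bounded_bilinear_scaleR]
lemmas sf_inner = sf_bilinear[OF bounded_bilinear_inner]

lemma sf_add: "openin M U \<Longrightarrow> sf U f \<Longrightarrow> sf U g \<Longrightarrow> sf U (\<lambda>p. f p + g p)"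
  unfolding smooth_fun_on_def o_def by (intro ballI smooth_on_add chart_image_open) auto

lemma sf_minus: "openin M U \<Longrightarrow> sf U f \<Longrightarrow> sf U (\<lambda>p. - f p)"
  using sf_scaleR[of U "\<lambda>_. -1" f] by (simp add: sf_const)

lemma sf_diff: "openin M U \<Longrightarrow> sf U f \<Longrightarrow> sf U g \<Longrightarrow> sf U (\<lambda>p. f p - g p)"
  using sf_add[of U f "\<lambda>p. - g p"] by (simp add: sf_minus)

lemma sf_sum: "openin M U \<Longrightarrow> (\<And>i. i \<in> I \<Longrightarrow> sf U (f i)) \<Longrightarrow> sf U (\<lambda>p. \<Sum>i\<in>I. f i p)"
  by (induction I rule: infinite_finite_induct) (simp_all add: sf_const sf_add)

lemma sf_prod:
  fixes f :: "'i \<Rightarrow> 'a \<Rightarrow> real"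
  shows "openin M U \<Longrightarrow> (\<And>i. i \<in> I \<Longrightarrow> sf U (f i)) \<Longrightarrow> sf U (\<lambda>p. \<Prod>i\<in>I. f i p)"
  by (induction I rule: infinite_finite_induct) (simp_all add: sf_const sf_mult)

lemma sf_divide:
  fixes f g :: "'a \<Rightarrow> real"
  assumes "openin M U" "sf U f" "sf U g" "\<And>p. p \<in> U \<Longrightarrow> g p \<noteq> 0"
  shows "sf U (\<lambda>p. f p / g p)"
proof -
  have "sf U (\<lambda>p. inverse (g p))"
    unfolding smooth_fun_on_def o_def
  proof
    fix c assume c: "c \<in> A"
    show "smooth_on (chart_map c ` (U \<inter> chart_dom c)) (\<lambda>y. inverse (g (chart_inv c y)))"
      using sf_chart[OF assms(3) c] assms(4) c
      by (intro smooth_on_inverse[OF chart_image_open[OF c assms(1)]]) (auto simp: o_def)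
  qed
  then show ?thesis
    using assms by (simp add: divide_inverse sf_mult)
qed

lemma sf_differentiable:
  assumes "sf U f" "p \<in> U" "c \<in> A" "p \<in> chart_dom c"
  shows "(f \<circ> chart_inv c) differentiable (at (chart_map c p))"
  using assms by (intro smooth_on_differentiable[OF sf_chart]) auto

lemma sf_has_derivative:
  assumes "openin M U" "sf U f" "p \<in> U"
  shows "((f \<circ> chart_inv (chart_at A p)) has_derivative D f p) (at (chart_map (chart_at A p) p))"
proof -
  have "p \<in> topspace M" using assms openin_subset by blast
  then have "(f \<circ> chart_inv (chart_at A p)) differentiable (at (chart_map (chart_at A p) p))"
    using sf_differentiable[OF assms(2,3)] chart_at_in by blast
  then show ?thesis
    by (simp add: frechet_derivative_works differential_def[abs_def])
qed

lemma linear_D: "openin M U \<Longrightarrow> sf U f \<Longrightarrow> p \<in> U \<Longrightarrow> linear (D f p)"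
  using sf_has_derivative has_derivative_linear by blast

lemma D_eqI: "((f \<circ> chart_inv (chart_at A p)) has_derivative f') (at (chart_map (chart_at A p) p)) \<Longrightarrow> D f p v = f' v"
  unfolding differential_def using frechet_derivative_at by metis

lemma D_const [simp]: "D (\<lambda>p. k) p v = 0"
  by (rule D_eqI) (simp add: o_def)

lemma D_add:
  assumes "openin M U" "sf U f" "sf U g" "p \<in> U"
  shows "D (\<lambda>q. f q + g q) p v = D f p v + D g p v"
  using has_derivative_add[OF sf_has_derivative[OF assms(1,2,4)] sf_has_derivative[OF assms(1,3,4)]]
  by (intro D_eqI) (simp add: o_def)

lemma D_minus:
  assumes "openin M U" "sf U f" "p \<in> U"
  shows "D (\<lambda>q. - f q) p v = - D f p v"
  using has_derivative_minus[OF sf_has_derivative[OF assms(1,2,3)]]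
  by (intro D_eqI) (simp add: o_def)

lemma D_diff:
  assumes "openin M U" "sf U f" "sf U g" "p \<in> U"
  shows "D (\<lambda>q. f q - g q) p v = D f p v - D g p v"
  using has_derivative_diff[OF sf_has_derivative[OF assms(1,2,4)] sf_has_derivative[OF assms(1,3,4)]]
  by (intro D_eqI) (simp add: o_def)

lemma D_bilinear:
  assumes "bounded_bilinear b" "openin M U" "sf U f" "sf U g" "p \<in> U"
  shows "D (\<lambda>q. b (f q) (g q)) p v = b (f p) (D g p v) + b (D f p v) (g p)"
proof -
  have "p \<in> topspace M" using assms openin_subset by blast
  then have "chart_inv (chart_at A p) (chart_map (chart_at A p) p) = p"
    using chart_at_in by simp
  then show ?thesis
    using bounded_bilinear.FDERIV[OF assms(1) sf_has_derivative[OF assms(2,3,5)] sf_has_derivative[OF assms(2,4,5)]]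
    by (intro D_eqI) (simp add: o_def)
qed

lemmas D_mult = D_bilinear[OF bounded_bilinear_mult]
lemmas D_scaleR = D_bilinear[OF bounded_bilinear_scaleR]

lemma D_cmult:
  fixes f :: "'a \<Rightarrow> real"
  shows "openin M U \<Longrightarrow> sf U f \<Longrightarrow> p \<in> U \<Longrightarrow> D (\<lambda>q. k * f q) p v = k * D f p v"
  using D_mult[OF _ sf_const, of U f p k v] by simp

lemma D_cong:
  assumes "openin M U" "sf U f" "p \<in> U" "\<And>q. q \<in> U \<Longrightarrow> f q = g q"
  shows "D g p v = D f p v"
proof (rule D_eqI)
  have "p \<in> topspace M" using assms openin_subset by blast
  note c = chart_at_in[OF this]
  show "((g \<circ> chart_inv (chart_at A p)) has_derivative D f p) (at (chart_map (chart_at A p) p))"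
    by (rule has_derivative_transform_within_open[OF sf_has_derivative[OF assms(1-3)]
          chart_image_open[OF c(1) assms(1)]]) (use c assms in auto)
qed

subsection \<open>Vector fields\<close>

lemma vf_open: "vf U X \<Longrightarrow> openin M U"
  by (simp add: vector_field_on_def)

lemma sf_comps: "vf U X \<Longrightarrow> c \<in> A \<Longrightarrow> sf (U \<inter> chart_dom c) (comps c X)"
  by (simp add: vector_field_on_def)

text \<open>In another chart, the components of a coordinate field are a directional derivative of
  the transition map.\<close>

lemma vf_E: "c \<in> A \<Longrightarrow> vf (chart_dom c) (E c v)"
  unfolding vector_field_on_def
proof (intro conjI ballI chart_open)
  fix d assume d: "d \<in> A" and c: "c \<in> A"
  let ?U = "chart_dom c \<inter> chart_dom d"
  have U: "openin M ?U" using c d chart_open by blast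
  show "sf ?U (comps d (E c v))"
  proof (rule sf_chartI[OF U c])
    show "smooth_on (chart_map c ` ?U) (comps d (E c v) \<circ> chart_inv c)"
      by (rule smooth_on_cong[OF overlap_open[OF c d] _ smooth_on_deriv[OF transition_smooth[OF c d], of v]])
        (use c d in \<open>auto simp: D_chart_E jac_def\<close>)
  qed auto
qed

lemma vf_subset: "vf U X \<Longrightarrow> openin M V \<Longrightarrow> V \<subseteq> U \<Longrightarrow> vf V X"
  unfolding vector_field_on_def by (auto elim!: ballE intro: sf_subset)

lemma vf_cong:
  assumes "vf U X" "\<And>p. p \<in> U \<Longrightarrow> Y p = X p"
  shows "vf U Y"
  unfolding vector_field_on_def
proof (intro conjI ballI)
  show U: "openin M U" using assms vf_open by blast
  fix c assume c: "c \<in> A"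
  then show "sf (U \<inter> chart_dom c) (comps c Y)"
    using assms by (intro sf_cong[OF openin_Int_chart[OF c U] _ sf_comps[OF assms(1)]]) auto
qed

lemma vf_add:
  assumes "vf U X" "vf U Y"
  shows "vf U (\<lambda>p. X p + Y p)"
  unfolding vector_field_on_def
proof (intro conjI ballI)
  show U: "openin M U" using assms vf_open by blast
  fix c assume c: "c \<in> A"
  have V: "openin M (U \<inter> chart_dom c)" using U chart_open[OF c] by blast
  show "sf (U \<inter> chart_dom c) (comps c (\<lambda>p. X p + Y p))"
    by (rule sf_cong[OF V _ sf_add[OF V sf_comps[OF assms(1) c] sf_comps[OF assms(2) c]]])
      (use c in \<open>auto simp: D_chart_add\<close>)
qed

lemma vf_scale:
  assumes "sf U f" "vf U X"
  shows "vf U (\<lambda>p. f p *\<^sub>R X p)"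
  unfolding vector_field_on_def
proof (intro conjI ballI)
  show U: "openin M U" using assms vf_open by blast
  fix c assume c: "c \<in> A"
  have V: "openin M (U \<inter> chart_dom c)" using U chart_open[OF c] by blast
  show "sf (U \<inter> chart_dom c) (comps c (\<lambda>p. f p *\<^sub>R X p))"
    by (rule sf_cong[OF V _ sf_scaleR[OF V sf_subset[OF assms(1)] sf_comps[OF assms(2) c]]])
      (use c in \<open>auto simp: D_chart_scale\<close>)
qed

lemma vf_cscale: "vf U X \<Longrightarrow> vf U (\<lambda>p. k *\<^sub>R X p)"
  by (rule vf_scale[OF sf_const])

lemma vf_minus: "vf U X \<Longrightarrow> vf U (\<lambda>p. - X p)"
  using vf_cscale[of U X "-1"] by simp

lemma vf_zero: 
  assumes "openin M U"
  shows "vf U (\<lambda>p. 0)"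
  unfolding vector_field_on_def
proof (intro conjI ballI assms)
  fix c assume c: "c \<in> A"
  have V: "openin M (U \<inter> chart_dom c)" using assms chart_open[OF c] by blast
  show "sf (U \<inter> chart_dom c) (comps c (\<lambda>p. 0))"
    by (rule sf_cong[OF V _ sf_const[of _ 0]]) (use c in \<open>auto simp: D_chart_zero\<close>)
qed

lemma vf_sum: "openin M U \<Longrightarrow> (\<And>i. i \<in> I \<Longrightarrow> vf U (X i)) \<Longrightarrow> vf U (\<lambda>p. \<Sum>i\<in>I. X i p)"
  by (induction I rule: infinite_finite_induct) (simp_all add: vf_zero vf_add)

lemma sf_D:
  assumes "vf U X" "sf U f"
  shows "sf U (\<lambda>p. D f p (X p))"
proof (rule sf_local)
  fix p assume p: "p \<in> U"
  then have "p \<in> topspace M" using assms(1) vf_open openin_subset by blast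
  then obtain c where c: "c \<in> A" "p \<in> chart_dom c" using chart_at_in by blast
  let ?V = "U \<inter> chart_dom c"
  have V: "openin M ?V" using vf_open[OF assms(1)] chart_open[OF c(1)] by blast
  have img: "open (chart_map c ` ?V)" using open_chart_image_iff[OF c(1)] V by auto
  have f: "smooth_on (chart_map c ` ?V) (f \<circ> chart_inv c)"
    using sf_chart[OF assms(2) c(1)] .
  have "smooth_on (chart_map c ` ?V)
      (\<lambda>y. frechet_derivative (f \<circ> chart_inv c) (at y) (D (chart_map c) (chart_inv c y) (X (chart_inv c y))))"
  proof (rule smooth_on_apply[OF img])
    show "linear (frechet_derivative (f \<circ> chart_inv c) (at y))" if "y \<in> chart_map c ` ?V" for y
      using smooth_on_linear_frechet[OF f that] .
    show "smooth_on (chart_map c ` ?V) (\<lambda>y. frechet_derivative (f \<circ> chart_inv c) (at y) v)" for v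
      using smooth_on_deriv[OF f] .
    show "smooth_on (chart_map c ` ?V) (\<lambda>y. D (chart_map c) (chart_inv c y) (X (chart_inv c y)))"
      using sf_chart[OF sf_comps[OF assms(1) c(1)] c(1)] by (simp add: o_def)
  qed
  then have "smooth_on (chart_map c ` ?V) ((\<lambda>p. D f p (X p)) \<circ> chart_inv c)"
    by (rule smooth_on_cong[OF img, rotated])
      (use c sf_differentiable[OF assms(2)] in \<open>auto simp: D_chart\<close>)
  then show "\<exists>V. openin M V \<and> p \<in> V \<and> sf V (\<lambda>p. D f p (X p))"
    using V c p by (intro exI[of _ ?V]) (auto intro: sf_chartI[OF V c(1)])
qed

lemma D_E:
  assumes "c \<in> A" "p \<in> chart_dom c" "sf U f" "p \<in> U"
  shows "D f p (E c v p) = frechet_derivative (f \<circ> chart_inv c) (at (chart_map c p)) v"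
  using D_chart[OF assms(1,2) sf_differentiable[OF assms(3,4,1,2)]] D_chart_E[OF assms(1,2,1,2)] assms
  by simp

lemma D_E_sym:
  fixes f :: "'a \<Rightarrow> 'f::euclidean_space"
  assumes c: "c \<in> A" "U \<subseteq> chart_dom c" and U: "openin M U" and f: "sf U f" and p: "p \<in> U"
  shows "D (\<lambda>q. D f q (E c u q)) p (E c v p) = D (\<lambda>q. D f q (E c v q)) p (E c u p)"
proof -
  let ?f = "f \<circ> chart_inv c"
  have img: "open (chart_map c ` U)" using open_chart_image_iff[OF c] U by simp
  have fs: "smooth_on (chart_map c ` U) ?f" using sf_chart[OF f c(1)] c(2) by (simp add: Int_absorb2)
  have vfE: "vf U (E c w)" for w using vf_subset[OF vf_E[OF c(1)] U c(2)] .
  have "D (\<lambda>q. D f q (E c u q)) p (E c v p) = frechet_derivative (\<lambda>y. frechet_derivative ?f (at y) u) (at (chart_map c p)) v"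
    for u v
  proof -
    have "D (\<lambda>q. D f q (E c u q)) p (E c v p)
        = frechet_derivative ((\<lambda>q. D f q (E c u q)) \<circ> chart_inv c) (at (chart_map c p)) v"
      using D_E[OF c(1) _ sf_D[OF vfE f] p] c p by blast
    also have "\<dots> = frechet_derivative (\<lambda>y. frechet_derivative ?f (at y) u) (at (chart_map c p)) v"
    proof (rule fun_cong[OF frechet_derivative_transform_within_open[OF _ img]])
      show "(\<lambda>q. D f q (E c u q)) \<circ> chart_inv c differentiable at (chart_map c p)"
        using sf_differentiable[OF sf_D[OF vfE f] p c(1)] c p by blast
      show "((\<lambda>q. D f q (E c u q)) \<circ> chart_inv c) y = frechet_derivative ?f (at y) u"
        if "y \<in> chart_map c ` U" for y
        using that c D_E[OF c(1) _ f] by auto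
    qed (use p in auto)
    finally show ?thesis .
  qed
  then show ?thesis
    using symmetric_second_derivative[OF img fs] p by simp
qed

subsection \<open>The Lie bracket\<close>

lemma LB_eq:
  "LB X Y p = D (comps (chart_at A p) Y) p (X p) - D (comps (chart_at A p) X) p (Y p)"
  by (simp add: lie_bracket_def Let_def)

text \<open>The bracket at \<open>p\<close> is defined in the preferred chart at \<open>p\<close>,
  which jumps with \<open>p\<close>; smoothness of the bracket needs one chart for all points.
  Passing to \<open>c\<close> adds to each component derivative a second derivative of the
  transition map, and its symmetry makes the two additions cancel.\<close>

lemma LB_chart:
  assumes X: "vf U X" and Y: "vf U Y" and p: "p \<in> U" and c: "c \<in> A" "p \<in> chart_dom c"
  shows "D (chart_map c) p (LB X Y p) = D (comps c Y) p (X p) - D (comps c X) p (Y p)"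
proof -
  define d where "d = chart_at A p"
  have d: "d \<in> A" "p \<in> chart_dom d" using chart_at_chart[OF c] by (auto simp: d_def)
  let ?V = "U \<inter> chart_dom c \<inter> chart_dom d" and ?x = "chart_map d p"
  let ?S = "chart_map d ` ?V" and ?F = "chart_map c \<circ> chart_inv d"
  have V: "openin M ?V" using vf_open[OF X] chart_open c d by blast
  have S: "open ?S" using open_chart_image_iff[OF d(1)] V by auto
  have x: "?x \<in> ?S" using p c d by auto
  have F: "smooth_on ?S ?F"
    by (rule smooth_on_subset[OF transition_smooth[OF d(1) c(1)]]) auto
  have *: "D (comps c Z) p v = frechet_derivative (\<lambda>y. frechet_derivative ?F (at y) (Z p)) (at ?x) v
      + frechet_derivative ?F (at ?x) (D (comps d Z) p v)" if Z: "vf U Z" for Z v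
  proof -
    let ?w = "comps d Z \<circ> chart_inv d"
    have w: "smooth_on ?S ?w"
      by (rule smooth_on_subset[OF sf_chart[OF sf_comps[OF Z d(1)] d(1)]]) auto
    have wx: "?w ?x = Z p" using d p c chart_subset[OF c(1)] by (auto simp: d_def)
    have "((\<lambda>y. frechet_derivative ?F (at y) (?w y)) has_derivative
      (\<lambda>u. frechet_derivative (\<lambda>y. frechet_derivative ?F (at y) (Z p)) (at ?x) u
       + frechet_derivative ?F (at ?x) (frechet_derivative ?w (at ?x) u))) (at ?x)"
      using has_derivative_frechet_apply[OF F w x S] unfolding wx .
    then have "((comps c Z \<circ> chart_inv d) has_derivative
      (\<lambda>u. frechet_derivative (\<lambda>y. frechet_derivative ?F (at y) (Z p)) (at ?x) u
       + frechet_derivative ?F (at ?x) (frechet_derivative ?w (at ?x) u))) (at ?x)"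
    proof (rule has_derivative_transform_within_open[OF _ S x])
      fix y assume "y \<in> ?S"
      then obtain q where q: "q \<in> ?V" "y = chart_map d q" by auto
      then have "(chart_map c \<circ> chart_inv d) differentiable at (chart_map d q)"
        using transition_has_derivative[OF d(1) c(1)] differentiableI by blast
      then show "frechet_derivative ?F (at y) (?w y) = (comps c Z \<circ> chart_inv d) y"
        using q d D_chart[OF d(1), of q "chart_map c"] by simp
    qed
    then have "D (comps c Z) p v = frechet_derivative (\<lambda>y. frechet_derivative ?F (at y) (Z p)) (at ?x) v
       + frechet_derivative ?F (at ?x) (frechet_derivative ?w (at ?x) v)"
      using D_eqI[of "comps c Z" p, folded d_def] by blast
    moreover have "D (comps d Z) p v = frechet_derivative ?w (at ?x) v"
      by (subst differential_def) (simp only: d_def)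
    ultimately show ?thesis by simp
  qed
  have lin: "linear (frechet_derivative ?F (at ?x))" by (rule smooth_on_linear_frechet[OF F x])
  have "D (chart_map c) p v = frechet_derivative ?F (at ?x) v" for v
    by (simp add: D_chart_map d_def jac_def)
  then show ?thesis
    unfolding LB_eq *[OF X] *[OF Y] linear_diff[OF lin] d_def[symmetric]
    using symmetric_second_derivative[OF S F x, of "X p" "Y p"] linear_diff[OF lin] by simp
qed

lemma vf_LB:
  assumes "vf U X" "vf U Y"
  shows "vf U (LB X Y)"
  unfolding vector_field_on_def
proof (intro conjI ballI)
  show U: "openin M U" using assms vf_open by blast
  fix c assume c: "c \<in> A"
  let ?V = "U \<inter> chart_dom c"
  have V: "openin M ?V" using U chart_open[OF c] by blast
  have "vf ?V X" "vf ?V Y" using assms V vf_subset by auto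
  then have "sf ?V (\<lambda>p. D (comps c Y) p (X p) - D (comps c X) p (Y p))"
    by (intro sf_diff V sf_D sf_comps assms c)
  then show "sf ?V (comps c (LB X Y))"
    by (rule sf_cong[OF V, rotated]) (use LB_chart[OF assms _ c] in auto)
qed

lemma LB_anti: "LB X Y p = - LB Y X p"
  by (simp add: LB_eq)

lemma LB_cong:
  assumes "vf U X" "vf U Y" "p \<in> U" "\<And>q. q \<in> U \<Longrightarrow> X' q = X q" "\<And>q. q \<in> U \<Longrightarrow> Y' q = Y q"
  shows "LB X' Y' p = LB X Y p"
proof -
  have pM: "p \<in> topspace M" using assms vf_open openin_subset by blast
  define c where "c = chart_at A p"
  have c: "c \<in> A" "p \<in> chart_dom c" using chart_at_in[OF pM] by (auto simp: c_def)
  have V: "openin M (U \<inter> chart_dom c)" using vf_open[OF assms(1)] chart_open[OF c(1)] by blast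
  have "D (comps c X') p v = D (comps c X) p v" "D (comps c Y') p v = D (comps c Y) p v" for v
    by (rule D_cong[OF V sf_comps[OF _ c(1)]]; use assms c in auto)+
  then show ?thesis using assms by (simp add: LB_eq c_def)
qed

lemma LB_add_right:
  assumes "vf U X" "vf U Y" "vf U Z" "p \<in> U"
  shows "LB X (\<lambda>q. Y q + Z q) p = LB X Y p + LB X Z p"
proof -
  have pM: "p \<in> topspace M" using assms vf_open openin_subset by blast
  define c where "c = chart_at A p"
  have c: "c \<in> A" "p \<in> chart_dom c" using chart_at_in[OF pM] by (auto simp: c_def)
  let ?V = "U \<inter> chart_dom c"
  have V: "openin M ?V" "p \<in> ?V" using vf_open[OF assms(1)] chart_open[OF c(1)] assms c by auto
  have "D (comps c (\<lambda>q. Y q + Z q)) p (X p) = D (\<lambda>q. comps c Y q + comps c Z q) p (X p)"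
    by (rule D_cong[OF V(1) sf_add[OF V(1) sf_comps[OF assms(2) c(1)] sf_comps[OF assms(3) c(1)]] V(2)])
      (use c in \<open>auto simp: D_chart_add\<close>)
  also have "\<dots> = D (comps c Y) p (X p) + D (comps c Z) p (X p)"
    by (rule D_add[OF V(1) sf_comps[OF assms(2) c(1)] sf_comps[OF assms(3) c(1)] V(2)])
  finally show ?thesis
    using linear_add[OF linear_D[OF V(1) sf_comps[OF assms(1) c(1)] V(2)], of "Y p" "Z p"]
    by (simp add: LB_eq c_def[symmetric])
qed

lemma LB_scale_right:
  assumes "sf U f" "vf U X" "vf U Y" "p \<in> U"
  shows "LB X (\<lambda>q. f q *\<^sub>R Y q) p = f p *\<^sub>R LB X Y p + D f p (X p) *\<^sub>R Y p"
proof -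
  have pM: "p \<in> topspace M" using assms vf_open openin_subset by blast
  define c where "c = chart_at A p"
  have c: "c \<in> A" "p \<in> chart_dom c" using chart_at_in[OF pM] by (auto simp: c_def)
  let ?V = "U \<inter> chart_dom c"
  have V: "openin M ?V" "p \<in> ?V" using vf_open[OF assms(2)] chart_open[OF c(1)] assms c by auto
  have f: "sf ?V f" using assms(1) sf_subset by blast
  have "D (comps c (\<lambda>q. f q *\<^sub>R Y q)) p (X p) = D (\<lambda>q. f q *\<^sub>R comps c Y q) p (X p)"
    by (rule D_cong[OF V(1) sf_scaleR[OF V(1) f sf_comps[OF assms(3) c(1)]] V(2)])
      (use c in \<open>auto simp: D_chart_scale\<close>)
  also have "\<dots> = f p *\<^sub>R D (comps c Y) p (X p) + D f p (X p) *\<^sub>R comps c Y p"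
    by (rule D_scaleR[OF V(1) f sf_comps[OF assms(3) c(1)] V(2)])
  finally show ?thesis
    using linear_scale[OF linear_D[OF V(1) sf_comps[OF assms(2) c(1)] V(2)], of "f p" "Y p"] pM
    by (simp add: LB_eq c_def[symmetric] scaleR_diff_right) (simp add: c_def)
qed

lemma LB_E:
  assumes c: "c \<in> A" "p \<in> chart_dom c"
  shows "LB (E c u) (E c v) p = 0"
proof -
  have "D (comps c (E c w)) p z = D (\<lambda>q. w) p z" for w z
    by (rule D_cong[OF chart_open[OF c(1)] sf_const c(2)]) (use c D_chart_E in auto)
  then have "D (chart_map c) p (LB (E c u) (E c v) p) = 0"
    using LB_chart[OF vf_E[OF c(1)] vf_E[OF c(1)] c(2) c] by simp
  then show ?thesis
    using E_D_chart[OF c, of "LB (E c u) (E c v) p"] linear_0[OF linear_E[OF c]] by simp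
qed

subsection \<open>Tensoriality\<close>

lemma tensorial:
  fixes F :: "('a \<Rightarrow> 'e) \<Rightarrow> 'f::real_vector"
  assumes local: "\<And>U X Y. vf U X \<Longrightarrow> p \<in> U \<Longrightarrow> U \<subseteq> W \<Longrightarrow> (\<And>q. q \<in> U \<Longrightarrow> Y q = X q) \<Longrightarrow> F Y = F X"
    and add: "\<And>U X Y. vf U X \<Longrightarrow> vf U Y \<Longrightarrow> p \<in> U \<Longrightarrow> U \<subseteq> W \<Longrightarrow> F (\<lambda>q. X q + Y q) = F X + F Y"
    and scale: "\<And>U X f. vf U X \<Longrightarrow> sf U f \<Longrightarrow> p \<in> U \<Longrightarrow> U \<subseteq> W \<Longrightarrow> F (\<lambda>q. f q *\<^sub>R X q) = f p *\<^sub>R F X"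
    and X: "vf W X" "p \<in> W" and c: "c \<in> A" "p \<in> chart_dom c"
  shows "F X = (\<Sum>b\<in>Basis. (D (chart_map c) p (X p) \<bullet> b) *\<^sub>R F (E c b))"
proof -
  let ?V = "W \<inter> chart_dom c"
  have V: "openin M ?V" "p \<in> ?V" "?V \<subseteq> W"
    using vf_open[OF X(1)] chart_open[OF c(1)] X c by auto
  have E: "vf ?V (E c b)" for b using vf_subset[OF vf_E[OF c(1)] V(1)] by blast
  have s: "sf ?V (\<lambda>q. comps c X q \<bullet> b)" for b
    by (rule sf_inner[OF V(1) sf_comps[OF X(1) c(1)] sf_const])
  have T: "vf ?V (\<lambda>q. (comps c X q \<bullet> b) *\<^sub>R E c b q)" for b
    by (rule vf_scale[OF s E])
  have zero: "F (\<lambda>q. 0) = 0"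
    using scale[OF vf_zero[OF V(1)] sf_const[of _ 0] V(2,3)] by simp
  have sum: "F (\<lambda>q. \<Sum>b\<in>B. (comps c X q \<bullet> b) *\<^sub>R E c b q) = (\<Sum>b\<in>B. F (\<lambda>q. (comps c X q \<bullet> b) *\<^sub>R E c b q))"
    if "finite B" for B
    using that
  proof induction
    case (insert b B)
    then show ?case
      using add[OF T[of b] vf_sum[OF V(1), of B "\<lambda>b q. (comps c X q \<bullet> b) *\<^sub>R E c b q", OF T] V(2,3)] by simp
  qed (simp add: zero)
  have "F X = F (\<lambda>q. \<Sum>b\<in>Basis. (comps c X q \<bullet> b) *\<^sub>R E c b q)"
    using local[OF vf_sum[OF V(1), of Basis "\<lambda>b q. (comps c X q \<bullet> b) *\<^sub>R E c b q", OF T] V(2,3), of X] E_expand[OF c(1)] by auto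
  also have "\<dots> = (\<Sum>b\<in>Basis. (comps c X p \<bullet> b) *\<^sub>R F (E c b))"
    unfolding sum[OF finite_Basis] using scale[OF E s V(2,3)] by simp
  finally show ?thesis .
qed

end

section \<open>The Levi-Civita connection\<close>

text \<open>Positivity makes \<open>w \<mapsto> b w\<close> injective, hence surjective onto the
  linear functionals by finite dimension.\<close>

lemma bilinear_represent:
  fixes b :: "'e::euclidean_space \<Rightarrow> 'e \<Rightarrow> real"
  assumes b: "bilinear b" and pos: "\<And>v. v \<noteq> 0 \<Longrightarrow> b v v > 0" and l: "linear l"
  shows "\<exists>w. \<forall>z. b w z = l z"
proof -
  define G where "G w = (\<Sum>i\<in>Basis. b w i *\<^sub>R i)" for w
  have lin: "linear (\<lambda>w. b w z)" "linear (b w)" for w z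
    using b by (auto simp: bilinear_def)
  have G: "linear G"
    unfolding G_def
    by (intro linear_compose_sum ballI linearI)
      (simp_all add: linear_add[OF lin(1)] linear_scale[OF lin(1)] scaleR_add_left)
  have G_inner: "G w \<bullet> z = b w z" for w z
    unfolding G_def inner_sum_left
    using linear_sum_Basis[OF lin(2), of w z] by (simp add: inner_commute mult.commute)
  have "inj G"
    unfolding linear_injective_0[OF G]
  proof safe
    fix w assume "G w = 0"
    then have "b w w = 0" using G_inner[of w w] by simp
    then show "w = 0" using pos[of w] by force
  qed
  then have "surj G" by (rule linear_inj_imp_surj[OF G])
  then obtain w where "(\<Sum>i\<in>Basis. l i *\<^sub>R i) = G w" by (metis surjD)
  then have "b w z = (\<Sum>i\<in>Basis. l i *\<^sub>R i) \<bullet> z" for z using G_inner by metis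
  then have "b w z = l z" for z
    using linear_sum_Basis[OF l, of z] by (simp add: inner_sum_left inner_sum_right inner_commute mult.commute)
  then show ?thesis by blast
qed

locale riem = smooth_mfd M A
  for M :: "'a topology" and A :: "('a, 'e::euclidean_space) chart set" +
  fixes g :: "'a \<Rightarrow> 'e \<Rightarrow> 'e \<Rightarrow> real"
  assumes metric: "riemannian_metric M A g"
begin

lemma g_bilinear: "p \<in> topspace M \<Longrightarrow> bilinear (g p)"
  using metric by (simp add: riemannian_metric_def)

lemma g_sym: "p \<in> topspace M \<Longrightarrow> g p u v = g p v u"
  using metric by (simp add: riemannian_metric_def)

lemma g_pos: "p \<in> topspace M \<Longrightarrow> v \<noteq> 0 \<Longrightarrow> g p v v > 0"
  using metric by (simp add: riemannian_metric_def)

lemma g_add [simp]: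
  assumes "p \<in> topspace M"
  shows "g p (u + v) w = g p u w + g p v w" "g p u (v + w) = g p u v + g p u w"
  using g_bilinear[OF assms] by (auto simp: bilinear_ladd bilinear_radd)

lemma g_diff [simp]:
  assumes "p \<in> topspace M"
  shows "g p (u - v) w = g p u w - g p v w" "g p u (v - w) = g p u v - g p u w"
  using g_bilinear[OF assms] by (auto simp: bilinear_lsub bilinear_rsub)

lemma g_scale [simp]:
  assumes "p \<in> topspace M"
  shows "g p (r *\<^sub>R v) w = r * g p v w" "g p u (r *\<^sub>R w) = r * g p u w"
  using g_bilinear[OF assms] by (auto simp: bilinear_lmul bilinear_rmul)

lemma g_minus [simp]:
  assumes "p \<in> topspace M"
  shows "g p (- v) w = - g p v w" "g p u (- w) = - g p u w"
  using g_bilinear[OF assms] by (auto simp: bilinear_lneg bilinear_rneg)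

lemma g_zero [simp]:
  assumes "p \<in> topspace M"
  shows "g p 0 w = 0" "g p u 0 = 0"
  using g_bilinear[OF assms] by (auto simp: bilinear_lzero bilinear_rzero)

lemma g_eqI:
  assumes "p \<in> topspace M" "\<And>z. g p u z = g p v z"
  shows "u = v"
  using g_pos[OF assms(1), of "u - v"] assms by force

lemma sf_g: "vf U X \<Longrightarrow> vf U Y \<Longrightarrow> sf U (\<lambda>p. g p (X p) (Y p))"
  using metric by (simp add: riemannian_metric_def)

lemma vf_in: "vf U X \<Longrightarrow> p \<in> U \<Longrightarrow> p \<in> topspace M"
  using vf_open openin_subset by blast

lemma D_g_add:
  assumes "vf U X" "vf U Y" "vf U Z" "p \<in> U"
  shows "D (\<lambda>q. g q (X q + Y q) (Z q)) p v = D (\<lambda>q. g q (X q) (Z q)) p v + D (\<lambda>q. g q (Y q) (Z q)) p v"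
proof -
  have U: "openin M U" using assms vf_open by blast
  have "D (\<lambda>q. g q (X q + Y q) (Z q)) p v = D (\<lambda>q. g q (X q) (Z q) + g q (Y q) (Z q)) p v"
    by (rule D_cong[OF U sf_add[OF U sf_g sf_g]]) (use assms vf_in[OF assms(1)] in auto)
  then show ?thesis
    using D_add[OF U sf_g[OF assms(1,3)] sf_g[OF assms(2,3)] assms(4)] by simp
qed

lemma D_g_scale:
  assumes "sf U f" "vf U X" "vf U Y" "p \<in> U"
  shows "D (\<lambda>q. g q (f q *\<^sub>R X q) (Y q)) p v = f p * D (\<lambda>q. g q (X q) (Y q)) p v + D f p v * g p (X p) (Y p)"
proof -
  have U: "openin M U" using assms vf_open by blast
  have "D (\<lambda>q. g q (f q *\<^sub>R X q) (Y q)) p v = D (\<lambda>q. f q * g q (X q) (Y q)) p v"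
    by (rule D_cong[OF U sf_mult[OF U _ sf_g]]) (use assms vf_in[OF assms(2)] in auto)
  then show ?thesis
    using D_mult[OF U assms(1) sf_g[OF assms(2,3)] assms(4)] by simp
qed

lemma D_g_sym:
  assumes "vf U X" "vf U Y" "p \<in> U"
  shows "D (\<lambda>q. g q (X q) (Y q)) p v = D (\<lambda>q. g q (Y q) (X q)) p v"
  by (rule D_cong[OF vf_open[OF assms(1)] sf_g[OF assms(2,1)] assms(3)])
    (use g_sym vf_in[OF assms(1)] in blast)

lemma LB_add_left:
  assumes "vf U X" "vf U Y" "vf U Z" "p \<in> U"
  shows "LB (\<lambda>q. X q + Y q) Z p = LB X Z p + LB Y Z p"
  using LB_add_right[OF assms(3,1,2,4)]
  by (simp add: LB_anti[of "\<lambda>q. X q + Y q" Z p] LB_anti[of X Z p] LB_anti[of Y Z p])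

lemma LB_scale_left:
  assumes "sf U f" "vf U X" "vf U Y" "p \<in> U"
  shows "LB (\<lambda>q. f q *\<^sub>R X q) Y p = f p *\<^sub>R LB X Y p - D f p (Y p) *\<^sub>R X p"
  using LB_scale_right[OF assms(1,3,2,4)]
  by (simp add: LB_anti[of "\<lambda>q. f q *\<^sub>R X q" Y p] LB_anti[of X Y p])

lemma D_add_vec:
  "openin M U \<Longrightarrow> sf U f \<Longrightarrow> p \<in> U \<Longrightarrow> D f p (u + v) = D f p u + D f p v"
  using linear_D linear_add by blast

lemma D_scale_vec:
  "openin M U \<Longrightarrow> sf U f \<Longrightarrow> p \<in> U \<Longrightarrow> D f p (r *\<^sub>R v) = r *\<^sub>R D f p v"
  using linear_D linear_scale by blast

text \<open>The right-hand side of the Koszul formula, which prescribes twice the inner product of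
  \<nabla>_X Y with Z.\<close>

definition koszul :: "('a \<Rightarrow> 'e) \<Rightarrow> ('a \<Rightarrow> 'e) \<Rightarrow> ('a \<Rightarrow> 'e) \<Rightarrow> 'a \<Rightarrow> real" where
  "koszul X Y Z p = D (\<lambda>q. g q (Y q) (Z q)) p (X p) + D (\<lambda>q. g q (X q) (Z q)) p (Y p)
     - D (\<lambda>q. g q (X q) (Y q)) p (Z p)
     + g p (LB X Y p) (Z p) - g p (LB X Z p) (Y p) - g p (LB Y Z p) (X p)"

lemma koszul_cong:
  assumes "vf U X" "vf U Y" "vf U Z" "p \<in> U" and eq: "\<And>q. q \<in> U \<Longrightarrow> X' q = X q" "\<And>q. q \<in> U \<Longrightarrow> Y' q = Y q" "\<And>q. q \<in> U \<Longrightarrow> Z' q = Z q"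
  shows "koszul X' Y' Z' p = koszul X Y Z p"
proof -
  note U = vf_open[OF assms(1)]
  have "D (\<lambda>q. g q (Y' q) (Z' q)) p v = D (\<lambda>q. g q (Y q) (Z q)) p v"
    "D (\<lambda>q. g q (X' q) (Z' q)) p v = D (\<lambda>q. g q (X q) (Z q)) p v"
    "D (\<lambda>q. g q (X' q) (Y' q)) p v = D (\<lambda>q. g q (X q) (Y q)) p v" for v
    using assms by (auto intro!: D_cong[OF U] sf_g)
  moreover have "LB X' Y' p = LB X Y p" "LB X' Z' p = LB X Z p" "LB Y' Z' p = LB Y Z p"
    using assms by (auto intro!: LB_cong[of U])
  ultimately show ?thesis using assms by (simp add: koszul_def)
qed

lemma koszul_add:
  assumes "vf U X" "vf U Y" "vf U Z" "vf U W" "p \<in> U"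
  shows "koszul (\<lambda>q. X q + W q) Y Z p = koszul X Y Z p + koszul W Y Z p"
    "koszul X (\<lambda>q. Y q + W q) Z p = koszul X Y Z p + koszul X W Z p"
    "koszul X Y (\<lambda>q. Z q + W q) p = koszul X Y Z p + koszul X Y W p"
proof -
  note U = vf_open[OF assms(1)] and p = vf_in[OF assms(1,5)]
  have right: "D (\<lambda>q. g q (P q) (Q q + R q)) p v = D (\<lambda>q. g q (P q) (Q q)) p v + D (\<lambda>q. g q (P q) (R q)) p v"
    if "vf U P" "vf U Q" "vf U R" for P Q R v
    using D_g_add[OF that(2,3,1) assms(5)] D_g_sym[OF that(1) vf_add[OF that(2,3)] assms(5)]
      D_g_sym[OF that(1,2) assms(5)] D_g_sym[OF that(1,3) assms(5)] by simp
  show "koszul (\<lambda>q. X q + W q) Y Z p = koszul X Y Z p + koszul W Y Z p"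
    by (simp add: koszul_def assms p right[OF assms(3)] D_g_add[OF assms(1,4,3,5)] D_g_add[OF assms(1,4,2,5)]
        LB_add_left[OF assms(1,4,2,5)] LB_add_left[OF assms(1,4,3,5)] D_add_vec[OF U sf_g[OF assms(2,3)] assms(5)])
  show "koszul X (\<lambda>q. Y q + W q) Z p = koszul X Y Z p + koszul X W Z p"
    by (simp add: koszul_def assms p right[OF assms(1,2,4)] D_g_add[OF assms(2,4,3,5)]
        LB_add_right[OF assms(1,2,4,5)] LB_add_left[OF assms(2,4,3,5)] D_add_vec[OF U sf_g[OF assms(1,3)] assms(5)])
  show "koszul X Y (\<lambda>q. Z q + W q) p = koszul X Y Z p + koszul X Y W p"
    by (simp add: koszul_def assms p right[OF assms(1,3,4)] right[OF assms(2,3,4)]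
        LB_add_right[OF assms(1,3,4,5)] LB_add_right[OF assms(2,3,4,5)] D_add_vec[OF U sf_g[OF assms(1,2)] assms(5)])
qed

text \<open>In the outer two slots, the derivatives of \<open>f\<close> from the metric terms cancel
  those from the brackets. In the middle slot they add up along \<open>X\<close>: this is the
  Leibniz rule, doubled.\<close>

lemma koszul_scale:
  assumes "sf U f" "vf U X" "vf U Y" "vf U Z" "p \<in> U"
  shows "koszul (\<lambda>q. f q *\<^sub>R X q) Y Z p = f p * koszul X Y Z p"
    "koszul X (\<lambda>q. f q *\<^sub>R Y q) Z p = f p * koszul X Y Z p + 2 * D f p (X p) * g p (Y p) (Z p)"
    "koszul X Y (\<lambda>q. f q *\<^sub>R Z q) p = f p * koszul X Y Z p"
proof -
  note U = vf_open[OF assms(2)] and p = vf_in[OF assms(2,5)]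
  have right: "D (\<lambda>q. g q (P q) (f q *\<^sub>R Q q)) p v = f p * D (\<lambda>q. g q (P q) (Q q)) p v + D f p v * g p (P p) (Q p)"
    if "vf U P" "vf U Q" for P Q v
    using D_g_scale[OF assms(1) that(2,1) assms(5)] D_g_sym[OF that(1) vf_scale[OF assms(1) that(2)] assms(5)]
      D_g_sym[OF that assms(5)] g_sym[OF p, of "P p" "Q p"] by simp
  show "koszul (\<lambda>q. f q *\<^sub>R X q) Y Z p = f p * koszul X Y Z p"
    unfolding koszul_def D_g_scale[OF assms(1,2,3,5)] D_g_scale[OF assms(1,2,4,5)]
        LB_scale_left[OF assms(1,2,3,5)] LB_scale_left[OF assms(1,2,4,5)] D_scale_vec[OF U sf_g[OF assms(3,4)] assms(5)]
    by (simp add: p algebra_simps)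
  show "koszul X (\<lambda>q. f q *\<^sub>R Y q) Z p = f p * koszul X Y Z p + 2 * D f p (X p) * g p (Y p) (Z p)"
    unfolding koszul_def D_g_scale[OF assms(1,3,4,5)] right[OF assms(2,3)]
        LB_scale_right[OF assms(1,2,3,5)] LB_scale_left[OF assms(1,3,4,5)] D_scale_vec[OF U sf_g[OF assms(2,4)] assms(5)]
    using g_sym[OF p, of "X p" "Y p"] by (simp add: p algebra_simps)
  show "koszul X Y (\<lambda>q. f q *\<^sub>R Z q) p = f p * koszul X Y Z p"
    unfolding koszul_def right[OF assms(2,4)] right[OF assms(3,4)]
        LB_scale_right[OF assms(1,2,4,5)] LB_scale_right[OF assms(1,3,4,5)] D_scale_vec[OF U sf_g[OF assms(2,3)] assms(5)]
    using g_sym[OF p, of "X p" "Z p"] g_sym[OF p, of "Y p" "Z p"] by (simp add: p algebra_simps)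
qed

text \<open>\<open>koszul\<close> is tensorial in its last slot, so at \<open>p\<close> it is a
  linear functional of the test vector; fields with constant components in the preferred chart are
  enough to define the vector that represents it.\<close>

definition lc :: "('a \<Rightarrow> 'e) \<Rightarrow> ('a \<Rightarrow> 'e) \<Rightarrow> 'a \<Rightarrow> 'e" where
  "lc X Y p = (SOME w. \<forall>z. 2 * g p w z = koszul X Y (E (chart_at A p) z) p)"

lemma lc_koszul:
  assumes X: "vf U X" and Y: "vf U Y" and Z: "vf U Z" and p: "p \<in> U"
  shows "2 * g p (lc X Y p) (Z p) = koszul X Y Z p"
proof -
  note pM = vf_in[OF X p]
  define c where "c = chart_at A p"
  have c: "c \<in> A" "p \<in> chart_dom c" using chart_at_in[OF pM] by (auto simp: c_def)
  \<comment> \<open>Stated for fields on a smaller \<open>W\<close>, because it is also applied to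
    coordinate fields, which live on the chart domain only.\<close>
  have tens: "koszul X Y Z p = (\<Sum>b\<in>Basis. (D (chart_map c) p (Z p) \<bullet> b) *\<^sub>R koszul X Y (E c b) p)"
    if "vf W Z" "p \<in> W" "W \<subseteq> U" for Z W
  proof (rule tensorial[OF _ _ _ that(1,2) c, of "\<lambda>Z. koszul X Y Z p"])
    fix V P Q and f :: "'a \<Rightarrow> real" assume *: "vf V P" "p \<in> V" "V \<subseteq> W"
    then have XY: "vf V X" "vf V Y"
      using X Y that vf_open vf_subset by (meson order.trans)+
    show "koszul X Y Q p = koszul X Y P p" if "\<And>q. q \<in> V \<Longrightarrow> Q q = P q"
      by (rule koszul_cong[OF XY *(1,2)]) (simp_all add: that)
    show "koszul X Y (\<lambda>q. P q + Q q) p = koszul X Y P p + koszul X Y Q p" if "vf V Q"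
      using koszul_add(3)[OF XY *(1) that *(2)] .
    show "koszul X Y (\<lambda>q. f q *\<^sub>R P q) p = f p *\<^sub>R koszul X Y P p" if "sf V f"
      using koszul_scale(3)[OF that XY *(1,2)] by simp
  qed
  have V: "openin M (U \<inter> chart_dom c)" using vf_open[OF X] openin_Int_chart c by blast
  have E: "vf (U \<inter> chart_dom c) (E c z)" for z using vf_subset[OF vf_E[OF c(1)] V] by blast
  have expand: "koszul X Y (E c z) p = (\<Sum>b\<in>Basis. (z \<bullet> b) *\<^sub>R koszul X Y (E c b) p)" for z
    using tens[OF E, of z] p c pM D_chart_E[OF c c] by simp
  have eq: "(\<lambda>z. \<Sum>b\<in>Basis. (z \<bullet> b) *\<^sub>R koszul X Y (E c b) p) = (\<lambda>z. koszul X Y (E c z) p)"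
    by (rule ext) (rule expand[symmetric])
  have "linear (\<lambda>z. \<Sum>b\<in>Basis. (z \<bullet> b) *\<^sub>R koszul X Y (E c b) p)"
    by (intro linear_compose_sum ballI linearI) (simp_all add: inner_add_left algebra_simps)
  then have "linear (\<lambda>z. koszul X Y (E c z) p)" unfolding eq .
  moreover have "linear (\<lambda>x::real. x / 2)"
    by (intro linearI) (simp_all add: add_divide_distrib)
  ultimately have l: "linear (\<lambda>z. koszul X Y (E c z) p / 2)"
    using linear_compose[of "\<lambda>z. koszul X Y (E c z) p" "\<lambda>x. x / 2"] unfolding o_def by blast
  obtain w where "\<forall>z. g p w z = koszul X Y (E c z) p / 2"
    using bilinear_represent[OF g_bilinear[OF pM] g_pos[OF pM] l] by blast
  then have "\<forall>z. 2 * g p w z = koszul X Y (E c z) p" by (simp add: field_simps)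
  then have "\<forall>z. 2 * g p (lc X Y p) z = koszul X Y (E c z) p"
    unfolding lc_def c_def[symmetric] by (rule someI)
  then have "2 * g p (lc X Y p) (Z p) = koszul X Y (E c (Z p)) p" by blast
  also have "\<dots> = koszul X Y Z p"
    using tens[OF E, of "Z p"] tens[OF Z p] p c D_chart_E[OF c c] pM by (simp add: c_def)
  finally show ?thesis .
qed

lemma koszul_eqI:
  assumes "p \<in> topspace M" "\<And>U Z. vf U Z \<Longrightarrow> p \<in> U \<Longrightarrow> g p u (Z p) = g p v (Z p)"
  shows "u = v"
proof (rule g_eqI[OF assms(1)])
  fix z
  note c = chart_at_in[OF assms(1)]
  show "g p u z = g p v z"
    using assms(2)[OF vf_E[OF c(1)] c(2), of z] assms(1) by simp
qed

end

section \<open>Existence of the Levi-Civita connection\<close>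

locale riem_cart = riem M A g
  for M :: "'a topology" and A :: "('a, real ^ 'n) chart set" and g
begin

text \<open>In a chart the components of \<open>lc X Y\<close> solve a linear system whose matrix is
  the Gram matrix of the coordinate fields. By Cramer's rule they are quotients of determinants with
  smooth entries.\<close>

lemma vf_lc:
  assumes X: "vf U X" and Y: "vf U Y"
  shows "vf U (lc X Y)"
  unfolding vector_field_on_def
proof (intro conjI ballI)
  show U: "openin M U" using X vf_open by blast
  fix c assume c: "c \<in> A"
  let ?V = "U \<inter> chart_dom c"
  have V: "openin M ?V" using openin_Int_chart[OF c U] .
  have E: "vf ?V (E c z)" for z using vf_subset[OF vf_E[OF c] V] by blast
  have XY: "vf ?V X" "vf ?V Y" using X Y vf_subset[OF _ V] by auto
  let ?e = "\<lambda>i. E c (axis i 1)"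
  define G where "G q = (\<chi> i j. g q (?e j q) (?e i q))" for q
  define k where "k q = (\<chi> i. koszul X Y (?e i) q / 2)" for q
  have k: "G q *v comps c (lc X Y) q = k q" if q: "q \<in> ?V" for q
  proof -
    have qM: "q \<in> topspace M" using q U openin_subset by blast
    let ?w = "comps c (lc X Y) q"
    have "lc X Y q = (\<Sum>j\<in>UNIV. ?w $ j *\<^sub>R ?e j q)"
      using E_expand[OF c, of q "lc X Y q"] q
      by (simp add: Basis_vec_def sum.UNION_disjoint UNION_singleton_eq_range sum.reindex inj_on_def axis_eq_axis inner_axis)
    then have "g q (lc X Y q) (?e i q) = (\<Sum>j\<in>UNIV. ?w $ j * g q (?e j q) (?e i q))" for i
      using linear_sum[of "\<lambda>w. g q w (?e i q)" "\<lambda>j. ?w $ j *\<^sub>R ?e j q" UNIV] g_bilinear[OF qM] qM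
      by (simp add: bilinear_def)
    moreover have "g q (lc X Y q) (?e i q) = k q $ i" for i
      using lc_koszul[OF XY E[of "axis i 1"] q] by (simp add: k_def)
    ultimately show ?thesis
      by (simp add: vec_eq_iff G_def matrix_vector_mult_def mult.commute)
  qed
  \<comment> \<open>A kernel vector of the Gram matrix, read as a tangent vector, would have length
    zero.\<close>
  have det: "det (G q) \<noteq> 0" if q: "q \<in> ?V" for q
  proof -
    have qM: "q \<in> topspace M" using q U openin_subset by blast
    have "w = 0" if "G q *v w = 0" for w
    proof -
      let ?v = "\<Sum>j\<in>UNIV. w $ j *\<^sub>R ?e j q"
      have lin: "linear (\<lambda>v. g q v u)" "linear (g q u)" for u
        using g_bilinear[OF qM] by (auto simp: bilinear_def)
      have "g q ?v (?e i q) = (G q *v w) $ i" for i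
        using linear_sum[OF lin(1)[of "?e i q"], of "\<lambda>j. w $ j *\<^sub>R ?e j q" UNIV] qM
        by (simp add: G_def matrix_vector_mult_def mult.commute)
      then have "g q ?v ?v = 0"
        using linear_sum[OF lin(2)[of ?v], of "\<lambda>j. w $ j *\<^sub>R ?e j q" UNIV] qM that by simp
      then have "?v = 0" using g_pos[OF qM, of ?v] by force
      moreover have "?v = E c w q"
        using linear_sum_Basis[OF linear_E[OF c], of q w] q
        by (simp add: Basis_vec_def sum.UNION_disjoint UNION_singleton_eq_range sum.reindex inj_on_def axis_eq_axis inner_axis)
      ultimately have "D (chart_map c) q (E c w q) = 0"
        using D_chart_zero[OF c] q by simp
      then show "w = 0"
        using D_chart_E[OF c _ c, of q w] q c by simp
    qed
    then show ?thesis
      by (metis invertible_det_nz invertible_left_inverse matrix_left_invertible_ker)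
  qed
  have sk: "sf ?V (\<lambda>q. k q $ i)" for i
    unfolding k_def koszul_def
    using E XY V by (auto intro!: sf_divide sf_add sf_diff sf_D sf_g vf_LB sf_const)
  have sG: "sf ?V (\<lambda>q. G q $ i $ j)" for i j
    unfolding G_def using sf_g[OF E E] by simp
  have sdet: "sf ?V (\<lambda>q. det (H q))" if "\<And>i j. sf ?V (\<lambda>q. H q $ i $ j)" for H :: "'a \<Rightarrow> real^'n^'n"
    unfolding det_def using that V by (intro sf_sum sf_mult sf_prod sf_const)
  have s: "sf ?V (\<lambda>q. det (\<chi> i j. if j = l then k q $ i else G q $ i $ j) / det (G q))" for l
  proof (intro sf_divide V sdet)
    show "sf ?V (\<lambda>q. (\<chi> i j. if j = l then k q $ i else G q $ i $ j) $ i $ j)" for i j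
      using sk sG by (cases "j = l") simp_all
  qed (use sG det in auto)
  have "sf ?V (\<lambda>q. \<Sum>l\<in>UNIV. (det (\<chi> i j. if j = l then k q $ i else G q $ i $ j) / det (G q)) *\<^sub>R (axis l 1 :: real^'n))"
    by (intro sf_sum V sf_scaleR s sf_const)
  then show "sf ?V (comps c (lc X Y))"
  proof (rule sf_cong[OF V, rotated])
    fix q assume q: "q \<in> ?V"
    have "comps c (lc X Y) q = (\<chi> l. det (\<chi> i j. if j = l then k q $ i else G q $ i $ j) / det (G q))"
      using cramer[OF det[OF q], of "comps c (lc X Y) q" "k q"] k[OF q] by simp
    then show "(\<Sum>l\<in>UNIV. (det (\<chi> i j. if j = l then k q $ i else G q $ i $ j) / det (G q)) *\<^sub>R axis l 1) = comps c (lc X Y) q"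
      by (simp add: vec_eq_iff axis_def if_distrib cong: if_cong)
  qed
qed

lemma is_levi_civita_lc: "is_levi_civita M A g lc"
  unfolding is_levi_civita_def affine_connection_def
proof (intro conjI allI impI ballI; elim conjE)
  fix U X Y assume X: "vf U X" and Y: "vf U Y"
  show "vf U (lc X Y)" using vf_lc[OF X Y] .
  fix X' Y' p assume eq: "\<forall>p\<in>U. X' p = X p \<and> Y' p = Y p" and p: "p \<in> U"
  show "lc X' Y' p = lc X Y p"
  proof (rule koszul_eqI[OF vf_in[OF X p]])
    fix V Z assume Z: "vf V Z" "p \<in> V"
    let ?W = "U \<inter> V"
    have W: "openin M ?W" "p \<in> ?W" using vf_open[OF X] vf_open[OF Z(1)] Z p by auto
    have v: "vf ?W X" "vf ?W Y" "vf ?W Z" using vf_subset[OF _ W(1)] X Y Z by auto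
    have v': "vf ?W X'" "vf ?W Y'" using v(1,2) vf_cong eq by (metis IntD1)+
    show "g p (lc X' Y' p) (Z p) = g p (lc X Y p) (Z p)"
      using lc_koszul[OF v W(2)] lc_koszul[OF v' v(3) W(2)] koszul_cong[OF v W(2), of X' Y' Z] eq by simp
  qed
next
  fix U X Y Z p assume v: "vf U X" "vf U Y" "vf U Z" and p: "p \<in> U"
  note pM = vf_in[OF v(1) p]
  \<comment> \<open>Test fields with prescribed value at \<open>p\<close> live on a chart domain, so
    all fields are restricted to its intersection with \<open>U\<close>.\<close>
  have eqI: "u = w" if "\<And>W. vf (U \<inter> chart_dom (chart_at A p)) W \<Longrightarrow> g p u (W p) = g p w (W p)" for u w
  proof (rule g_eqI[OF pM])
    fix z
    note c = chart_at_in[OF pM]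
    have "vf (U \<inter> chart_dom (chart_at A p)) (E (chart_at A p) z)"
      using vf_subset[OF vf_E[OF c(1)] openin_Int_chart[OF c(1) vf_open[OF v(1)]]] by blast
    from that[OF this] show "g p u z = g p w z" using pM by simp
  qed
  note c = chart_at_in[OF pM]
  let ?W = "U \<inter> chart_dom (chart_at A p)"
  have W: "openin M ?W" "p \<in> ?W" using openin_Int_chart[OF c(1) vf_open[OF v(1)]] c p by auto
  have w: "vf ?W X" "vf ?W Y" "vf ?W Z" using vf_subset[OF _ W(1)] v by auto
  show "lc (\<lambda>q. X q + Y q) Z p = lc X Z p + lc Y Z p"
  proof (rule eqI)
    fix T assume T: "vf ?W T"
    show "g p (lc (\<lambda>q. X q + Y q) Z p) (T p) = g p (lc X Z p + lc Y Z p) (T p)"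
      using koszul_add(1)[OF w(1,3) T w(2) W(2)] lc_koszul[OF w(1,3) T W(2)] lc_koszul[OF w(2,3) T W(2)]
        lc_koszul[OF vf_add[OF w(1,2)] w(3) T W(2)] pM by simp
  qed
  show "lc X (\<lambda>q. Y q + Z q) p = lc X Y p + lc X Z p"
  proof (rule eqI)
    fix T assume T: "vf ?W T"
    show "g p (lc X (\<lambda>q. Y q + Z q) p) (T p) = g p (lc X Y p + lc X Z p) (T p)"
      using koszul_add(2)[OF w(1,2) T w(3) W(2)] lc_koszul[OF w(1,2) T W(2)] lc_koszul[OF w(1,3) T W(2)]
        lc_koszul[OF w(1) vf_add[OF w(2,3)] T W(2)] pM by simp
  qed
  show "lc X Y p - lc Y X p = LB X Y p"
  proof (rule eqI)
    fix T assume T: "vf ?W T"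
    have "koszul X Y T p - koszul Y X T p = 2 * g p (LB X Y p) (T p)"
      using D_g_sym[OF w(1,2) W(2)] LB_anti[of Y X p] pM by (simp add: koszul_def)
    then show "g p (lc X Y p - lc Y X p) (T p) = g p (LB X Y p) (T p)"
      using lc_koszul[OF w(1,2) T W(2)] lc_koszul[OF w(2,1) T W(2)] pM by simp
  qed
  \<comment> \<open>Exchanging \<open>Y\<close> and \<open>Z\<close> changes the sign of all terms
    but the derivative along \<open>X\<close>.\<close>
  have "koszul X Y Z p + koszul X Z Y p = 2 * D (\<lambda>q. g q (Y q) (Z q)) p (X p)"
    using D_g_sym[OF w(3,2) W(2)] LB_anti[of Z Y p] g_sym[OF pM] pM
    by (simp add: koszul_def)
  then show "D (\<lambda>q. g q (Y q) (Z q)) p (X p) = g p (lc X Y p) (Z p) + g p (Y p) (lc X Z p)"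
    using lc_koszul[OF w W(2)] lc_koszul[OF w(1,3,2) W(2)] g_sym[OF pM, of "Y p" "lc X Z p"] by simp
next
  fix U X Y p and f :: "'a \<Rightarrow> real" assume f: "sf U f" and v: "vf U X" "vf U Y" and p: "p \<in> U"
  note pM = vf_in[OF v(1) p]
  note c = chart_at_in[OF pM]
  let ?W = "U \<inter> chart_dom (chart_at A p)"
  have W: "openin M ?W" "p \<in> ?W" using openin_Int_chart[OF c(1) vf_open[OF v(1)]] c p by auto
  have w: "vf ?W X" "vf ?W Y" using vf_subset[OF _ W(1)] v by auto
  have fw: "sf ?W f" using f sf_subset by blast
  have E: "vf ?W (E (chart_at A p) z)" for z
    using vf_subset[OF vf_E[OF c(1)] W(1)] by blast
  show "lc (\<lambda>q. f q *\<^sub>R X q) Y p = f p *\<^sub>R lc X Y p"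
  proof (rule g_eqI[OF pM])
    fix z show "g p (lc (\<lambda>q. f q *\<^sub>R X q) Y p) z = g p (f p *\<^sub>R lc X Y p) z"
      using koszul_scale(1)[OF fw w E[of z] W(2)] lc_koszul[OF w E[of z] W(2), symmetric]
        lc_koszul[OF vf_scale[OF fw w(1)] w(2) E[of z] W(2)] pM by simp
  qed
  show "lc X (\<lambda>q. f q *\<^sub>R Y q) p = D f p (X p) *\<^sub>R Y p + f p *\<^sub>R lc X Y p"
  proof (rule g_eqI[OF pM])
    fix z show "g p (lc X (\<lambda>q. f q *\<^sub>R Y q) p) z = g p (D f p (X p) *\<^sub>R Y p + f p *\<^sub>R lc X Y p) z"
      using koszul_scale(2)[OF fw w E[of z] W(2)] lc_koszul[OF w E[of z] W(2), symmetric]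
        lc_koszul[OF w(1) vf_scale[OF fw w(2)] E[of z] W(2)] pM by simp
  qed
qed

end

section \<open>Tensor calculus with the Levi-Civita connection\<close>

context smooth_mfd
begin

text \<open>Extending \<open>u\<close> by constant components in the preferred chart turns a
  tensorial operator on fields into a linear map of the tangent space; in that chart no Jacobian
  appears at \<open>p\<close>.\<close>

lemma tensorial1:
  fixes F :: "('a \<Rightarrow> 'e) \<Rightarrow> 'f::real_vector"
  assumes local: "\<And>U X Y. vf U X \<Longrightarrow> p \<in> U \<Longrightarrow> U \<subseteq> W \<Longrightarrow> (\<And>q. q \<in> U \<Longrightarrow> Y q = X q) \<Longrightarrow> F Y = F X"
    and add: "\<And>U X Y. vf U X \<Longrightarrow> vf U Y \<Longrightarrow> p \<in> U \<Longrightarrow> U \<subseteq> W \<Longrightarrow> F (\<lambda>q. X q + Y q) = F X + F Y"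
    and scale: "\<And>U X f. vf U X \<Longrightarrow> sf U f \<Longrightarrow> p \<in> U \<Longrightarrow> U \<subseteq> W \<Longrightarrow> F (\<lambda>q. f q *\<^sub>R X q) = f p *\<^sub>R F X"
    and W: "openin M W" "p \<in> W"
  shows "linear (\<lambda>u. F (E (chart_at A p) u))"
    and "vf W X \<Longrightarrow> F X = F (E (chart_at A p) (X p))"
proof -
  have pM: "p \<in> topspace M" using W openin_subset by blast
  define c where "c = chart_at A p"
  have c: "c \<in> A" "p \<in> chart_dom c" using chart_at_in[OF pM] by (auto simp: c_def)
  let ?V = "W \<inter> chart_dom c"
  have V: "openin M ?V" "p \<in> ?V" using openin_Int_chart[OF c(1) W(1)] W c by auto
  have E: "vf ?V (E c z)" for z using vf_subset[OF vf_E[OF c(1)] V(1)] by blast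
  have tens: "F Z = (\<Sum>b\<in>Basis. (Z p \<bullet> b) *\<^sub>R F (E c b))" if "vf V Z" "p \<in> V" "V \<subseteq> W" for V Z
    using tensorial[of p V F, OF local add scale that(1,2) c] that(3) pM by (auto simp: c_def)
  have expand: "F (E c z) = (\<Sum>b\<in>Basis. (z \<bullet> b) *\<^sub>R F (E c b))" for z
  proof -
    have "F (E c z) = (\<Sum>b\<in>Basis. (E c z p \<bullet> b) *\<^sub>R F (E c b))"
      by (rule tens[OF E V(2)]) simp
    moreover have "E c z p = z" using pM by (simp add: c_def)
    ultimately show ?thesis by (simp only:)
  qed
  have "linear (\<lambda>z. \<Sum>b\<in>Basis. (z \<bullet> b) *\<^sub>R F (E c b))"
    by (intro linear_compose_sum ballI linearI) (simp_all add: inner_add_left algebra_simps)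
  moreover have "(\<lambda>z. \<Sum>b\<in>Basis. (z \<bullet> b) *\<^sub>R F (E c b)) = (\<lambda>z. F (E c z))"
    by (rule ext) (rule expand[symmetric])
  ultimately show "linear (\<lambda>u. F (E (chart_at A p) u))" unfolding c_def by simp
  show "F X = F (E (chart_at A p) (X p))" if "vf W X"
    unfolding c_def[symmetric] by (rule trans[OF tens[OF that W(2) order_refl] expand[symmetric]])
qed

lemma tensorial2:
  fixes F :: "('a \<Rightarrow> 'e) \<Rightarrow> ('a \<Rightarrow> 'e) \<Rightarrow> 'f::real_vector"
  assumes p: "p \<in> topspace M"
    and local: "\<And>U X Y X' Y'. vf U X \<Longrightarrow> vf U Y \<Longrightarrow> p \<in> U \<Longrightarrow>
      (\<And>q. q \<in> U \<Longrightarrow> X' q = X q) \<Longrightarrow> (\<And>q. q \<in> U \<Longrightarrow> Y' q = Y q) \<Longrightarrow> F X' Y' = F X Y"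
    and add: "\<And>U X Y Z. vf U X \<Longrightarrow> vf U Y \<Longrightarrow> vf U Z \<Longrightarrow> p \<in> U \<Longrightarrow> F (\<lambda>q. X q + Y q) Z = F X Z + F Y Z"
      "\<And>U X Y Z. vf U X \<Longrightarrow> vf U Y \<Longrightarrow> vf U Z \<Longrightarrow> p \<in> U \<Longrightarrow> F X (\<lambda>q. Y q + Z q) = F X Y + F X Z"
    and scale: "\<And>U X Y f. vf U X \<Longrightarrow> vf U Y \<Longrightarrow> sf U f \<Longrightarrow> p \<in> U \<Longrightarrow> F (\<lambda>q. f q *\<^sub>R X q) Y = f p *\<^sub>R F X Y"
      "\<And>U X Y f. vf U X \<Longrightarrow> vf U Y \<Longrightarrow> sf U f \<Longrightarrow> p \<in> U \<Longrightarrow> F X (\<lambda>q. f q *\<^sub>R Y q) = f p *\<^sub>R F X Y"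
  shows "bilinear (\<lambda>u v. F (E (chart_at A p) u) (E (chart_at A p) v))"
    and "vf U X \<Longrightarrow> vf U Y \<Longrightarrow> p \<in> U \<Longrightarrow> F X Y = F (E (chart_at A p) (X p)) (E (chart_at A p) (Y p))"
proof -
  define c where "c = chart_at A p"
  have c: "c \<in> A" "p \<in> chart_dom c" using chart_at_in[OF p] by (auto simp: c_def)
  have 1: "linear (\<lambda>u. F (E c u) Y)" "vf W X \<Longrightarrow> F X Y = F (E c (X p)) Y"
    if Y: "vf W Y" "p \<in> W" for W X Y
  proof -
    have sub: "vf V Y" if "vf V Z" "V \<subseteq> W" for V Z by (rule vf_subset[OF Y(1) vf_open[OF that(1)] that(2)])
    have loc: "F Z' Y = F Z Y" if "vf V Z" "p \<in> V" "V \<subseteq> W" "\<And>q. q \<in> V \<Longrightarrow> Z' q = Z q" for V Z Z'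
      by (rule local[OF that(1) sub[OF that(1,3)] that(2)]) (simp_all add: that(4))
    have ad: "F (\<lambda>q. Z q + Z' q) Y = F Z Y + F Z' Y" if "vf V Z" "vf V Z'" "p \<in> V" "V \<subseteq> W" for V Z Z'
      by (rule add(1)[OF that(1,2) sub[OF that(1,4)] that(3)])
    have sc: "F (\<lambda>q. f q *\<^sub>R Z q) Y = f p *\<^sub>R F Z Y" if "vf V Z" "sf V f" "p \<in> V" "V \<subseteq> W" for V Z f
      by (rule scale(1)[OF that(1) sub[OF that(1,4)] that(2,3)])
    show "linear (\<lambda>u. F (E c u) Y)"
      unfolding c_def by (rule tensorial1(1)[of p W "\<lambda>X. F X Y"]) (fact loc ad sc vf_open[OF Y(1)] Y(2))+
    show "F X Y = F (E c (X p)) Y" if "vf W X"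
      unfolding c_def by (rule tensorial1(2)[of p W "\<lambda>X. F X Y"]) (fact loc ad sc vf_open[OF Y(1)] Y(2) that)+
  qed
  have 2: "linear (\<lambda>u. F X (E c u))" "vf W Y \<Longrightarrow> F X Y = F X (E c (Y p))"
    if X: "vf W X" "p \<in> W" for W X Y
  proof -
    have sub: "vf V X" if "vf V Z" "V \<subseteq> W" for V Z by (rule vf_subset[OF X(1) vf_open[OF that(1)] that(2)])
    have loc: "F X Z' = F X Z" if "vf V Z" "p \<in> V" "V \<subseteq> W" "\<And>q. q \<in> V \<Longrightarrow> Z' q = Z q" for V Z Z'
      by (rule local[OF sub[OF that(1,3)] that(1) that(2)]) (simp_all add: that(4))
    have ad: "F X (\<lambda>q. Z q + Z' q) = F X Z + F X Z'" if "vf V Z" "vf V Z'" "p \<in> V" "V \<subseteq> W" for V Z Z'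
      by (rule add(2)[OF sub[OF that(1,4)] that(1,2) that(3)])
    have sc: "F X (\<lambda>q. f q *\<^sub>R Z q) = f p *\<^sub>R F X Z" if "vf V Z" "sf V f" "p \<in> V" "V \<subseteq> W" for V Z f
      by (rule scale(2)[OF sub[OF that(1,4)] that(1) that(2,3)])
    show "linear (\<lambda>u. F X (E c u))"
      unfolding c_def by (rule tensorial1(1)[of p W "\<lambda>Y. F X Y"]) (fact loc ad sc vf_open[OF X(1)] X(2))+
    show "F X Y = F X (E c (Y p))" if "vf W Y"
      unfolding c_def by (rule tensorial1(2)[of p W "\<lambda>Y. F X Y"]) (fact loc ad sc vf_open[OF X(1)] X(2) that)+
  qed
  show "bilinear (\<lambda>u v. F (E (chart_at A p) u) (E (chart_at A p) v))"
    unfolding bilinear_def using 1(1)[OF vf_E[OF c(1)] c(2)] 2(1)[OF vf_E[OF c(1)] c(2)] by (simp add: c_def)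
  show "F X Y = F (E (chart_at A p) (X p)) (E (chart_at A p) (Y p))" if "vf U X" "vf U Y" "p \<in> U"
  proof -
    have "F X Y = F (E c (X p)) Y" using 1(2)[OF that(2,3,1)] .
    \<comment> \<open>The first argument is now a coordinate field, so the domain shrinks to the
      chart.\<close>
    also have "\<dots> = F (E c (X p)) (E c (Y p))"
    proof (rule 2(2))
      show V: "vf (U \<inter> chart_dom c) (E c (X p))" "vf (U \<inter> chart_dom c) Y"
        using openin_Int_chart[OF c(1) vf_open[OF that(1)]] vf_subset[OF vf_E[OF c(1)]] vf_subset[OF that(2)] by auto
    qed (use that c in auto)
    finally show ?thesis by (simp only: c_def)
  qed
qed

abbreviation "endo \<equiv> endomorphism_field M A"

lemma endo_linear: "endo S \<Longrightarrow> p \<in> topspace M \<Longrightarrow> linear (S p)"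
  by (simp add: endomorphism_field_def)

lemma endo_add: "endo S \<Longrightarrow> p \<in> topspace M \<Longrightarrow> S p (u + v) = S p u + S p v"
  using endo_linear linear_add by blast

lemma endo_scale: "endo S \<Longrightarrow> p \<in> topspace M \<Longrightarrow> S p (r *\<^sub>R v) = r *\<^sub>R S p v"
  using endo_linear linear_scale by blast

lemma endo_vf: "endo S \<Longrightarrow> vf U X \<Longrightarrow> vf U (\<lambda>p. S p (X p))"
  by (simp add: endomorphism_field_def)

lemma endo_compose: "endo S \<Longrightarrow> endo T \<Longrightarrow> endo (\<lambda>p v. S p (T p v))"
  using linear_compose[unfolded o_def] unfolding endomorphism_field_def by blast

lemma endo_cscale: "endo S \<Longrightarrow> endo (\<lambda>p v. k *\<^sub>R S p v)"
  unfolding endomorphism_field_def using linear_compose_scale_right vf_cscale by blast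

end

context riem_cart
begin

section \<open>Covariant derivatives as tensors at a point\<close>

abbreviation "nab \<equiv> levi_civita M A g"

lemma levi_civita: "is_levi_civita M A g nab"
  unfolding levi_civita_def by (rule someI[of "is_levi_civita M A g", OF is_levi_civita_lc])

lemma nab_vf: "vf U X \<Longrightarrow> vf U Y \<Longrightarrow> vf U (nab X Y)"
  using levi_civita unfolding is_levi_civita_def affine_connection_def by simp

lemma nab_cong:
  assumes "vf U X" "vf U Y" "p \<in> U" "\<And>q. q \<in> U \<Longrightarrow> X' q = X q" "\<And>q. q \<in> U \<Longrightarrow> Y' q = Y q"
  shows "nab X' Y' p = nab X Y p"
proof -
  have "\<forall>U X Y X' Y'. vf U X \<and> vf U Y \<and> (\<forall>p\<in>U. X' p = X p \<and> Y' p = Y p) \<longrightarrow>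
      (\<forall>p\<in>U. nab X' Y' p = nab X Y p)"
    using levi_civita unfolding is_levi_civita_def affine_connection_def by simp
  then show ?thesis using assms by blast
qed

lemma nab_add:
  assumes "vf U X" "vf U Y" "vf U Z" "p \<in> U"
  shows "nab (\<lambda>q. X q + Y q) Z p = nab X Z p + nab Y Z p"
    "nab X (\<lambda>q. Y q + Z q) p = nab X Y p + nab X Z p"
  using levi_civita assms unfolding is_levi_civita_def affine_connection_def by simp_all

lemma nab_scale:
  assumes "sf U f" "vf U X" "vf U Y" "p \<in> U"
  shows "nab (\<lambda>q. f q *\<^sub>R X q) Y p = f p *\<^sub>R nab X Y p"
    "nab X (\<lambda>q. f q *\<^sub>R Y q) p = D f p (X p) *\<^sub>R Y p + f p *\<^sub>R nab X Y p"
  using levi_civita assms unfolding is_levi_civita_def affine_connection_def by simp_all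

lemma nab_torsion: "vf U X \<Longrightarrow> vf U Y \<Longrightarrow> p \<in> U \<Longrightarrow> LB X Y p = nab X Y p - nab Y X p"
  using levi_civita unfolding is_levi_civita_def by simp

lemma nab_metric: "vf U X \<Longrightarrow> vf U Y \<Longrightarrow> vf U Z \<Longrightarrow> p \<in> U \<Longrightarrow>
    D (\<lambda>q. g q (Y q) (Z q)) p (X p) = g p (nab X Y p) (Z p) + g p (Y p) (nab X Z p)"
  using levi_civita unfolding is_levi_civita_def by simp

lemma nab_uminus: "vf U X \<Longrightarrow> vf U Y \<Longrightarrow> p \<in> U \<Longrightarrow> nab X (\<lambda>q. - Y q) p = - nab X Y p"
  using nab_scale(2)[OF sf_const[of U "-1"], of X Y p] by simp

text \<open>\<open>cd S p u v\<close> is \<open>(\<nabla>\<^sub>u S) v\<close> at the point \<open>p\<close>, a tensor in \<open>u\<close> and \<open>v\<close>.\<close>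

definition cd :: "('a \<Rightarrow> real^'n \<Rightarrow> real^'n) \<Rightarrow> 'a \<Rightarrow> real^'n \<Rightarrow> real^'n \<Rightarrow> real^'n" where
  "cd S p u v = cov_deriv_endo M A g S (E (chart_at A p) u) (E (chart_at A p) v) p"

text \<open>The connection alone is not tensorial in \<open>Y\<close>; the derivative of
  \<open>f\<close> produced by its Leibniz rule occurs in both terms of
  \<open>cov_deriv_endo\<close> and cancels, as \<open>S\<close> is linear at each point.\<close>

lemma cd_tensor:
  assumes S: "endo S" and p: "p \<in> topspace M"
  shows "bilinear (cd S p)"
    and "vf U X \<Longrightarrow> vf U Y \<Longrightarrow> p \<in> U \<Longrightarrow> cov_deriv_endo M A g S X Y p = cd S p (X p) (Y p)"
proof -
  let ?F = "\<lambda>X Y. cov_deriv_endo M A g S X Y p"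
  note lin = endo_linear[OF S p]
  have local: "?F X' Y' = ?F X Y"
    if "vf U X" "vf U Y" "p \<in> U" "\<And>q. q \<in> U \<Longrightarrow> X' q = X q" "\<And>q. q \<in> U \<Longrightarrow> Y' q = Y q" for U X Y X' Y'
    using nab_cong[OF that(1,2,3), of X' Y'] nab_cong[OF that(1) endo_vf[OF S that(2)] that(3), of X' "\<lambda>q. S q (Y' q)"] that
    by (simp add: cov_deriv_endo_def)
  have add1: "?F (\<lambda>q. X q + Y q) Z = ?F X Z + ?F Y Z"
    if "vf U X" "vf U Y" "vf U Z" "p \<in> U" for U X Y Z
    using nab_add(1)[OF that] nab_add(1)[OF that(1,2) endo_vf[OF S that(3)] that(4)] linear_add[OF lin]
    by (simp add: cov_deriv_endo_def)
  have add2: "?F X (\<lambda>q. Y q + Z q) = ?F X Y + ?F X Z"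
    if "vf U X" "vf U Y" "vf U Z" "p \<in> U" for U X Y Z
  proof -
    have "nab X (\<lambda>q. S q (Y q + Z q)) p = nab X (\<lambda>q. S q (Y q) + S q (Z q)) p"
      by (rule nab_cong[OF that(1) vf_add[OF endo_vf[OF S that(2)] endo_vf[OF S that(3)]] that(4)])
        (simp_all add: endo_add[OF S vf_in[OF that(1)]])
    then show ?thesis
      using nab_add(2)[OF that] nab_add(2)[OF that(1) endo_vf[OF S that(2)] endo_vf[OF S that(3)] that(4)] linear_add[OF lin]
      by (simp add: cov_deriv_endo_def)
  qed
  have scale1: "?F (\<lambda>q. f q *\<^sub>R X q) Y = f p *\<^sub>R ?F X Y"
    if "vf U X" "vf U Y" "sf U f" "p \<in> U" for U X Y f
    using nab_scale(1)[OF that(3,1,2,4)] nab_scale(1)[OF that(3,1) endo_vf[OF S that(2)] that(4)] linear_scale[OF lin]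
    by (simp add: cov_deriv_endo_def scaleR_diff_right)
  have scale2: "?F X (\<lambda>q. f q *\<^sub>R Y q) = f p *\<^sub>R ?F X Y"
    if "vf U X" "vf U Y" "sf U f" "p \<in> U" for U X Y f
  proof -
    have "nab X (\<lambda>q. S q (f q *\<^sub>R Y q)) p = nab X (\<lambda>q. f q *\<^sub>R S q (Y q)) p"
      by (rule nab_cong[OF that(1) vf_scale[OF that(3) endo_vf[OF S that(2)]] that(4)])
        (simp_all add: endo_scale[OF S vf_in[OF that(1)]])
    then show ?thesis
      using nab_scale(2)[OF that(3,1,2,4)] nab_scale(2)[OF that(3,1) endo_vf[OF S that(2)] that(4)] linear_scale[OF lin] linear_add[OF lin]
      by (simp add: cov_deriv_endo_def scaleR_diff_right)
  qed
  show "bilinear (cd S p)"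
    unfolding cd_def[abs_def] by (rule tensorial2(1)[of p ?F]) (fact p local add1 add2 scale1 scale2)+
  show "?F X Y = cd S p (X p) (Y p)" if "vf U X" "vf U Y" "p \<in> U"
    unfolding cd_def by (rule tensorial2(2)[of p ?F]) (fact p local add1 add2 scale1 scale2 that)+
qed

lemma nab_endo:
  assumes S: "endo S" and "vf U X" "vf U Y" "p \<in> U"
  shows "nab X (\<lambda>q. S q (Y q)) p = cd S p (X p) (Y p) + S p (nab X Y p)"
  using cd_tensor(2)[OF S vf_in[OF assms(2,4)] assms(2-4)] by (simp add: cov_deriv_endo_def diff_eq_eq)

text \<open>The endomorphism \<nabla>\<xi>, which is the h of the nearly cosymplectic part.\<close>

definition gradv :: "('a \<Rightarrow> real^'n) \<Rightarrow> 'a \<Rightarrow> real^'n \<Rightarrow> real^'n" where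
  "gradv \<xi> p u = nab (E (chart_at A p) u) \<xi> p"

lemma gradv_tensor:
  assumes \<xi>: "vf (topspace M) \<xi>" and p: "p \<in> topspace M"
  shows "linear (gradv \<xi> p)" and "vf U X \<Longrightarrow> p \<in> U \<Longrightarrow> nab X \<xi> p = gradv \<xi> p (X p)"
proof -
  have sub: "vf U \<xi>" if "vf U X" for U X
    using vf_subset[OF \<xi> vf_open[OF that]] openin_subset[OF vf_open[OF that]] by simp
  have local: "nab Y \<xi> p = nab X \<xi> p" if "vf U X" "p \<in> U" "U \<subseteq> W" "\<And>q. q \<in> U \<Longrightarrow> Y q = X q" for U X Y W
    using nab_cong[OF that(1) sub[OF that(1)] that(2,4)] by simp
  have add: "nab (\<lambda>q. X q + Y q) \<xi> p = nab X \<xi> p + nab Y \<xi> p" if "vf U X" "vf U Y" "p \<in> U" "U \<subseteq> W" for U X Y W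
    using nab_add(1)[OF that(1,2) sub[OF that(1)] that(3)] .
  have scale: "nab (\<lambda>q. f q *\<^sub>R X q) \<xi> p = f p *\<^sub>R nab X \<xi> p" if "vf U X" "sf U f" "p \<in> U" "U \<subseteq> W" for U X f W
    using nab_scale(1)[OF that(2,1) sub[OF that(1)] that(3)] .
  show "linear (gradv \<xi> p)"
    unfolding gradv_def[abs_def]
    by (rule tensorial1(1)[of p "topspace M" "\<lambda>X. nab X \<xi> p"]) (fact local add scale openin_topspace p)+
  show "nab X \<xi> p = gradv \<xi> p (X p)" if "vf U X" "p \<in> U"
    unfolding gradv_def
    by (rule tensorial1(2)[of p U "\<lambda>X. nab X \<xi> p"]) (fact local add scale vf_open[OF that(1)] that)+
qed

lemma endo_gradv:
  assumes "vf (topspace M) \<xi>"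
  shows "endo (gradv \<xi>)"
  unfolding endomorphism_field_def
proof (intro conjI ballI allI impI gradv_tensor(1)[OF assms])
  fix U X assume X: "vf U X"
  have "vf U \<xi>" using vf_subset[OF assms vf_open[OF X]] openin_subset[OF vf_open[OF X]] by simp
  then show "vf U (\<lambda>p. gradv \<xi> p (X p))"
    using vf_cong[OF nab_vf[OF X]] gradv_tensor(2)[OF assms vf_in[OF X] X] by simp
qed

text \<open>Source of test fields: an identity between tensors at \<open>p\<close> is checked on
  fields with the given values there.\<close>

lemma frame_at:
  assumes "p \<in> topspace M"
  obtains U Xu Xv Xw where "vf U Xu" "vf U Xv" "vf U Xw" "p \<in> U" "Xu p = u" "Xv p = v" "Xw p = w"
  using vf_E[OF chart_at_in(1)[OF assms]] chart_at_in(2)[OF assms] E_chart_at[OF assms] that by blast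

section \<open>Derivatives of pointwise algebraic identities\<close>

lemma cd_skew:
  assumes S: "endo S" and skew: "\<And>q u v. q \<in> topspace M \<Longrightarrow> g q (S q u) v = - g q u (S q v)" and p: "p \<in> topspace M"
  shows "g p (cd S p u v) w = - g p v (cd S p u w)"
proof -
  obtain U X Y Z where v: "vf U X" "vf U Y" "vf U Z" "p \<in> U" and eq: "X p = u" "Y p = v" "Z p = w"
    using frame_at[OF p] by metis
  note SY = endo_vf[OF S v(2)] and SZ = endo_vf[OF S v(3)]
  have "D (\<lambda>q. g q (S q (Y q)) (Z q)) p (X p) = D (\<lambda>q. - g q (Y q) (S q (Z q))) p (X p)"
    by (rule D_cong[OF vf_open[OF v(1)] sf_minus[OF vf_open[OF v(1)] sf_g[OF v(2) SZ]] v(4)])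
      (use skew vf_in[OF v(1)] in auto)
  also have "\<dots> = - D (\<lambda>q. g q (Y q) (S q (Z q))) p (X p)"
    by (rule D_minus[OF vf_open[OF v(1)] sf_g[OF v(2) SZ] v(4)])
  finally show ?thesis
    using nab_metric[OF v(1) SY v(3,4)] nab_metric[OF v(1,2) SZ v(4)] nab_endo[OF S v(1,2,4)] nab_endo[OF S v(1,3,4)]
      skew[OF p] p eq by simp
qed

lemma cd_compose:
  assumes S: "endo S" and T: "endo T" and p: "p \<in> topspace M"
  shows "cd (\<lambda>q v. S q (T q v)) p u v = cd S p u (T p v) + S p (cd T p u v)"
proof -
  obtain U X Y Z where v: "vf U X" "vf U Y" "vf U Z" "p \<in> U" and eq: "X p = u" "Y p = v" "Z p = v"
    using frame_at[OF p] by metis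
  show ?thesis
    using nab_endo[OF S v(1) endo_vf[OF T v(2)] v(4)] nab_endo[OF T v(1,2,4)]
      nab_endo[OF endo_compose[OF S T] v(1,2,4)] linear_add[OF endo_linear[OF S p]] eq
    by simp
qed

lemma cd_vector:
  assumes S: "endo S" and \<xi>: "vf (topspace M) \<xi>" and zero: "\<And>q. q \<in> topspace M \<Longrightarrow> S q (\<xi> q) = 0"
    and p: "p \<in> topspace M"
  shows "cd S p u (\<xi> p) = - S p (gradv \<xi> p u)"
proof -
  obtain U X Y Z where v: "vf U X" "vf U Y" "vf U Z" "p \<in> U" and eq: "X p = u" "Y p = u" "Z p = u"
    using frame_at[OF p] by metis
  have \<xi>U: "vf U \<xi>" using vf_subset[OF \<xi> vf_open[OF v(1)]] openin_subset[OF vf_open[OF v(1)]] by simp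
  \<comment> \<open>The zero field is written as a multiple of \<open>X\<close> so that the Leibniz
    rule evaluates its derivative.\<close>
  have "nab X (\<lambda>q. S q (\<xi> q)) p = nab X (\<lambda>q. 0 *\<^sub>R X q) p"
    by (rule nab_cong[OF v(1) vf_cscale[OF v(1)] v(4)]) (use zero vf_in[OF v(1)] in auto)
  also have "\<dots> = 0" using nab_scale(2)[OF sf_const v(1,1,4), of 0] by simp
  finally show ?thesis
    using nab_endo[OF S v(1) \<xi>U v(4)] gradv_tensor(2)[OF \<xi> p v(1,4)] eq
    by (simp add: eq_neg_iff_add_eq_0)
qed

lemma gradv_unit:
  assumes \<xi>: "vf (topspace M) \<xi>" and unit: "\<And>q. q \<in> topspace M \<Longrightarrow> g q (\<xi> q) (\<xi> q) = 1" and p: "p \<in> topspace M"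
  shows "g p (\<xi> p) (gradv \<xi> p u) = 0"
proof -
  obtain U X Y Z where v: "vf U X" "vf U Y" "vf U Z" "p \<in> U" and eq: "X p = u" "Y p = u" "Z p = u"
    using frame_at[OF p] by metis
  have \<xi>U: "vf U \<xi>" using vf_subset[OF \<xi> vf_open[OF v(1)]] openin_subset[OF vf_open[OF v(1)]] by simp
  have "D (\<lambda>q. g q (\<xi> q) (\<xi> q)) p (X p) = D (\<lambda>q. 1) p (X p)"
    by (rule D_cong[OF vf_open[OF v(1)] sf_const v(4)]) (use unit vf_in[OF v(1)] in auto)
  then show ?thesis
    using nab_metric[OF v(1) \<xi>U \<xi>U v(4)] gradv_tensor(2)[OF \<xi> p v(1,4)] eq g_sym[OF p, of "\<xi> p"]
    by simp
qed

text \<open>The Leibniz rule applied to both sides of \<open>sq\<close>; the last two terms come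
  from differentiating \<eta> \<otimes> \<xi>, with \<eta> written as the metric dual of
  \<xi>.\<close>

lemma cd_square:
  assumes S: "endo S" and \<xi>: "vf (topspace M) \<xi>" and p: "p \<in> topspace M"
    and sq: "\<And>q v. q \<in> topspace M \<Longrightarrow> S q (S q v) = - v + g q (\<xi> q) v *\<^sub>R \<xi> q"
  shows "cd S p u (S p v) + S p (cd S p u v) = g p (gradv \<xi> p u) v *\<^sub>R \<xi> p + g p (\<xi> p) v *\<^sub>R gradv \<xi> p u"
proof -
  obtain U X Y Z where v: "vf U X" "vf U Y" "vf U Z" "p \<in> U" and eq: "X p = u" "Y p = v" "Z p = v"
    using frame_at[OF p] by metis
  have \<xi>U: "vf U \<xi>" using vf_subset[OF \<xi> vf_open[OF v(1)]] openin_subset[OF vf_open[OF v(1)]] by simp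
  note SS = endo_compose[OF S S]
  have "nab X (\<lambda>q. S q (S q (Y q))) p = nab X (\<lambda>q. - Y q + g q (\<xi> q) (Y q) *\<^sub>R \<xi> q) p"
    by (rule nab_cong[OF v(1) vf_add[OF vf_minus[OF v(2)] vf_scale[OF sf_g[OF \<xi>U v(2)] \<xi>U]] v(4)])
      (use sq vf_in[OF v(1)] in auto)
  also have "\<dots> = - nab X Y p + (D (\<lambda>q. g q (\<xi> q) (Y q)) p (X p) *\<^sub>R \<xi> p + g p (\<xi> p) v *\<^sub>R nab X \<xi> p)"
    using nab_add(2)[OF v(1) vf_minus[OF v(2)] vf_scale[OF sf_g[OF \<xi>U v(2)] \<xi>U] v(4)]
      nab_uminus[OF v(1,2,4)] nab_scale(2)[OF sf_g[OF \<xi>U v(2)] v(1) \<xi>U v(4)] eq by simp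
  finally show ?thesis
    using nab_endo[OF SS v(1,2,4)] nab_metric[OF v(1) \<xi>U v(2,4)] gradv_tensor(2)[OF \<xi> p v(1,4)]
      cd_compose[OF S S p, of u v] sq[OF p] eq by (simp add: scaleR_add_left)
qed

section \<open>Exterior derivatives in terms of the connection\<close>

lemma d1_eq:
  assumes \<xi>: "vf (topspace M) \<xi>" and \<eta>: "\<And>q v. q \<in> topspace M \<Longrightarrow> \<eta> q v = g q (\<xi> q) v"
    and v: "vf U X" "vf U Y" "p \<in> U"
  shows "d1 A \<eta> X Y p = g p (gradv \<xi> p (X p)) (Y p) - g p (gradv \<xi> p (Y p)) (X p)"
proof -
  note p = vf_in[OF v(1,3)]
  have \<xi>U: "vf U \<xi>" using vf_subset[OF \<xi> vf_open[OF v(1)]] openin_subset[OF vf_open[OF v(1)]] by simp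
  have "D (\<lambda>q. \<eta> q (Z q)) p w = D (\<lambda>q. g q (\<xi> q) (Z q)) p w" if "vf U Z" for Z w
    by (rule D_cong[OF vf_open[OF v(1)] sf_g[OF \<xi>U that] v(3)]) (use \<eta> vf_in[OF v(1)] in auto)
  then show ?thesis
    unfolding d1_def
    using v \<eta>[OF p] nab_metric[OF v(1) \<xi>U v(2,3)] nab_metric[OF v(2) \<xi>U v(1,3)] nab_torsion[OF v]
      gradv_tensor(2)[OF \<xi> p v(1,3)] gradv_tensor(2)[OF \<xi> p v(2,3)] p
    by simp
qed

text \<open>Without torsion, brackets are differences of covariant derivatives, and all terms in
  which the connection acts on an argument cancel. Only the derivatives of \<open>S\<close> survive,
  one for each cyclic order.\<close>

lemma d2_eq:
  assumes S: "endo S" and skew: "\<And>q u v. q \<in> topspace M \<Longrightarrow> g q (S q u) v = - g q u (S q v)"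
    and v: "vf U X" "vf U Y" "vf U Z" "p \<in> U"
  shows "d2 A (fundamental_form g S) X Y Z p =
    g p (cd S p (X p) (Y p)) (Z p) + g p (cd S p (Y p) (Z p)) (X p) + g p (cd S p (Z p) (X p)) (Y p)"
proof -
  note p = vf_in[OF v(1,4)]
  have D: "D (\<lambda>q. g q (S q (Q q)) (R q)) p (P p) =
      g p (cd S p (P p) (Q p)) (R p) + g p (S p (nab P Q p)) (R p) + g p (S p (Q p)) (nab P R p)"
    if "vf U P" "vf U Q" "vf U R" for P Q R
    using nab_metric[OF that(1) endo_vf[OF S that(2)] that(3) v(4)] nab_endo[OF S that(1,2) v(4)] p
    by simp
  note lin = linear_diff[OF endo_linear[OF S p]]
  have "g p (cd S p (Y p) (X p)) (Z p) = - g p (X p) (cd S p (Y p) (Z p))"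
    by (rule cd_skew[OF S _ p]) (rule skew)
  then show ?thesis
    unfolding d2_def fundamental_form_def D[OF v(1,2,3)] D[OF v(2,1,3)] D[OF v(3,1,2)] nab_torsion[OF v(1,2,4)] nab_torsion[OF v(1,3,4)] nab_torsion[OF v(2,3,4)]
      lin g_diff[OF p]
    using skew[OF p, of "nab X Z p" "Y p"] skew[OF p, of "nab Y Z p" "X p"] skew[OF p, of "nab Z Y p" "X p"]
      g_sym[OF p, of "X p" "cd S p (Y p) (Z p)"] g_sym[OF p, of "nab X Z p" "S p (Y p)"] g_sym[OF p, of "nab Y Z p" "S p (X p)"] g_sym[OF p, of "nab Z Y p" "S p (X p)"] 
    by linarith
qed

text \<open>\<open>d \<circ> d = 0\<close> on coordinate fields, where it is the symmetry of second derivatives: for the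
  1-form \<open>\<eta>\<close>, and for a 2-form with differential \<open>k \<eta> \<and> \<Theta>\<close>, in the form \<open>d\<eta> \<and> \<Theta> = \<eta> \<and> d\<Theta>\<close>.\<close>

lemma dd1_zero:
  assumes \<eta>: "one_form M A \<eta>" and S: "endo S" and k: "k \<noteq> 0"
    and d: "\<And>U X Y p. vf U X \<Longrightarrow> vf U Y \<Longrightarrow> p \<in> U \<Longrightarrow> d1 A \<eta> X Y p = k * fundamental_form g S p (X p) (Y p)"
    and c: "c \<in> A" "p \<in> chart_dom c"
  shows "d2 A (fundamental_form g S) (E c u) (E c v) (E c w) p = 0"
proof -
  let ?\<omega> = "fundamental_form g S"
  note U = chart_open[OF c(1)] and E = vf_E[OF c(1)]
  have a: "sf (chart_dom c) (\<lambda>q. \<eta> q (E c z q))" for z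
    using \<eta> E unfolding one_form_def by blast
  have \<omega>: "sf (chart_dom c) (\<lambda>q. ?\<omega> q (E c y q) (E c z q))" for y z
    unfolding fundamental_form_def by (rule sf_g[OF endo_vf[OF S E] E])
  have lin: "\<eta> q 0 = 0" if "q \<in> chart_dom c" for q
    using \<eta> chart_subset[OF c(1)] that linear_0 unfolding one_form_def by blast
  have "k * ?\<omega> q (E c y q) (E c z q) = D (\<lambda>q. \<eta> q (E c z q)) q (E c y q) - D (\<lambda>q. \<eta> q (E c y q)) q (E c z q)"
    if "q \<in> chart_dom c" for q y z
    using d[OF E E that, of y z] LB_E[OF c(1) that] lin[OF that] by (simp add: d1_def)
  then have "D (\<lambda>q. k * ?\<omega> q (E c y q) (E c z q)) p t =
      D (\<lambda>q. D (\<lambda>q. \<eta> q (E c z q)) q (E c y q) - D (\<lambda>q. \<eta> q (E c y q)) q (E c z q)) p t" for y z t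
    by (intro D_cong[OF U sf_diff[OF U sf_D[OF E a] sf_D[OF E a]] c(2)]) auto
  then have "k * D (\<lambda>q. ?\<omega> q (E c y q) (E c z q)) p t =
      D (\<lambda>q. D (\<lambda>q. \<eta> q (E c z q)) q (E c y q)) p t - D (\<lambda>q. D (\<lambda>q. \<eta> q (E c y q)) q (E c z q)) p t" for y z t
    using D_cmult[OF U \<omega> c(2)] D_diff[OF U sf_D[OF E a] sf_D[OF E a] c(2)] by simp
  note D\<omega> = this
  have pM: "p \<in> topspace M" using c chart_subset by blast
  have \<omega>0: "?\<omega> p 0 z = 0" for z
    using linear_0[OF endo_linear[OF S pM]] pM by (simp add: fundamental_form_def)
  note sym = D_E_sym[OF c(1) order_refl U a c(2)]
  have "k * d2 A ?\<omega> (E c u) (E c v) (E c w) p = 0"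
    using sym[of w u v] sym[of v u w] sym[of u v w] 
    by (simp add: d2_def LB_E[OF c] \<omega>0 algebra_simps D\<omega>)
  then show ?thesis using k by simp
qed

lemma dd2_zero:
  assumes \<eta>: "one_form M A \<eta>" and S: "endo S" and T: "endo T" and k: "k \<noteq> 0"
    and d: "\<And>U X Y Z p. vf U X \<Longrightarrow> vf U Y \<Longrightarrow> vf U Z \<Longrightarrow> p \<in> U \<Longrightarrow>
      d2 A (fundamental_form g S) X Y Z p = k * wedge12 (\<eta> p) (fundamental_form g T p) (X p) (Y p) (Z p)"
    and skew: "\<And>q u v. q \<in> topspace M \<Longrightarrow> g q (T q u) v = - g q u (T q v)"
    and p: "p \<in> topspace M"
  defines "F \<equiv> \<lambda>u. E (chart_at A p) u"
  defines "d\<eta> \<equiv> \<lambda>u v. d1 A \<eta> (F u) (F v) p" and "d\<Theta> \<equiv> \<lambda>u v w. d2 A (fundamental_form g T) (F u) (F v) (F w) p"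
    and "\<Theta> \<equiv> fundamental_form g T p"
  shows "d\<eta> a b * \<Theta> x y - d\<eta> a x * \<Theta> b y + d\<eta> a y * \<Theta> b x + d\<eta> b x * \<Theta> a y - d\<eta> b y * \<Theta> a x + d\<eta> x y * \<Theta> a b
    = \<eta> p a * d\<Theta> b x y - \<eta> p b * d\<Theta> a x y + \<eta> p x * d\<Theta> a b y - \<eta> p y * d\<Theta> a b x"
proof -
  define c where "c = chart_at A p"
  have c: "c \<in> A" "p \<in> chart_dom c" using chart_at_in[OF p] by (auto simp: c_def)
  let ?\<omega> = "fundamental_form g S" and ?\<theta> = "fundamental_form g T"
  note U = chart_open[OF c(1)] and E = vf_E[OF c(1)]
  have n: "sf (chart_dom c) (\<lambda>q. \<eta> q (E c z q))" for z
    using \<eta> E unfolding one_form_def by blast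
  have \<omega>: "sf (chart_dom c) (\<lambda>q. ?\<omega> q (E c y q) (E c z q))" for y z
    unfolding fundamental_form_def by (rule sf_g[OF endo_vf[OF S E] E])
  have \<theta>: "sf (chart_dom c) (\<lambda>q. ?\<theta> q (E c y q) (E c z q))" for y z
    unfolding fundamental_form_def by (rule sf_g[OF endo_vf[OF T E] E])
  have lin: "\<eta> q 0 = 0" if "q \<in> chart_dom c" for q
    using \<eta> chart_subset[OF c(1)] that linear_0 unfolding one_form_def by blast
  have \<omega>0: "?\<omega> q 0 z = 0" "?\<theta> q 0 z = 0" if "q \<in> chart_dom c" for q z
    using linear_0[OF endo_linear[OF S]] linear_0[OF endo_linear[OF T]] chart_subset[OF c(1)] that
    by (auto simp: fundamental_form_def)
  have \<theta>skew: "?\<theta> q y z = - ?\<theta> q z y" if "q \<in> chart_dom c" for q y z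
    using skew[of q y z] g_sym[of q y] chart_subset[OF c(1)] that by (auto simp: fundamental_form_def)
  let ?n = "\<lambda>z q. \<eta> q (E c z q)" and ?t = "\<lambda>y z q. ?\<theta> q (E c y q) (E c z q)"
    and ?o = "\<lambda>y z q. ?\<omega> q (E c y q) (E c z q)"
  let ?w = "\<lambda>y z t q. k * (?n y q * ?t z t q + ?n z q * ?t t y q + ?n t q * ?t y z q)"
  let ?dd = "\<lambda>y z t. \<lambda>q. D (?o z t) q (E c y q) - D (?o y t) q (E c z q) + D (?o y z) q (E c t q)"
  have eq: "?dd y z t q = ?w y z t q" if "q \<in> chart_dom c" for y z t q
    using d[OF E E E that, of y z t] LB_E[OF c(1) that] \<omega>0(1)[OF that] by (simp add: d2_def wedge12_def)
  have sdd: "sf (chart_dom c) (?dd y z t)" for y z t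
    by (intro sf_add sf_diff U sf_D E \<omega>)
  have sw: "sf (chart_dom c) (\<lambda>q. ?n y q * ?t z t q)" for y z t
    by (intro sf_mult U n \<theta>)
  have Dw: "D (\<lambda>q. ?n y q * ?t z t q) p s = ?n y p * D (?t z t) p s + D (?n y) p s * ?t z t p" for y z t s
    by (rule D_mult[OF U n \<theta> c(2)])
  have Ddd: "D (?dd y z t) p s = k * (D (\<lambda>q. ?n y q * ?t z t q) p s + D (\<lambda>q. ?n z q * ?t t y q) p s + D (\<lambda>q. ?n t q * ?t y z q) p s)" for y z t s
  proof -
    have "D (?dd y z t) p s = D (?w y z t) p s"
    proof (rule D_cong[OF U _ c(2)])
      show "sf (chart_dom c) (?w y z t)"
        by (intro sf_mult[OF U sf_const] sf_add U sw)
    qed (rule eq[symmetric])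
    also have "\<dots> = k * D (\<lambda>q. ?n y q * ?t z t q + ?n z q * ?t t y q + ?n t q * ?t y z q) p s"
      by (rule D_cmult[OF U _ c(2)]) (intro sf_add U sw)
    also have "D (\<lambda>q. ?n y q * ?t z t q + ?n z q * ?t t y q + ?n t q * ?t y z q) p s
        = D (\<lambda>q. ?n y q * ?t z t q) p s + D (\<lambda>q. ?n z q * ?t t y q) p s + D (\<lambda>q. ?n t q * ?t y z q) p s"
      using D_add[OF U sf_add[OF U sw sw] sw c(2)] D_add[OF U sw sw c(2)] by simp
    finally show ?thesis .
  qed
  have Ddd': "D (?dd y z t) p s = D (\<lambda>q. D (?o z t) q (E c y q)) p s - D (\<lambda>q. D (?o y t) q (E c z q)) p s + D (\<lambda>q. D (?o y z) q (E c t q)) p s" for y z t s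
    using D_add[OF U sf_diff[OF U sf_D[OF E \<omega>] sf_D[OF E \<omega>]] sf_D[OF E \<omega>] c(2)]
      D_diff[OF U sf_D[OF E \<omega>] sf_D[OF E \<omega>] c(2)] by simp
  have sym: "D (\<lambda>q. D (?o y z) q (E c s q)) p (E c t p) = D (\<lambda>q. D (?o y z) q (E c t q)) p (E c s p)" for y z s t
    by (rule D_E_sym[OF c(1) order_refl U \<omega> c(2)])
  \<comment> \<open>The twelve second derivatives of the 2-form cancel in six pairs.\<close>
  have "D (?dd b x y) p (E c a p) - D (?dd a x y) p (E c b p) + D (?dd a b y) p (E c x p) - D (?dd a b x) p (E c y p) = 0"
    unfolding Ddd'
    using sym[of x y a b] sym[of b y a x] sym[of b x a y] sym[of a y b x] sym[of a x b y] sym[of a b x y]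
    by simp
  then have key: "(D (\<lambda>q. ?n b q * ?t x y q) p (E c a p) + D (\<lambda>q. ?n x q * ?t y b q) p (E c a p) + D (\<lambda>q. ?n y q * ?t b x q) p (E c a p))
     - (D (\<lambda>q. ?n a q * ?t x y q) p (E c b p) + D (\<lambda>q. ?n x q * ?t y a q) p (E c b p) + D (\<lambda>q. ?n y q * ?t a x q) p (E c b p))
     + (D (\<lambda>q. ?n a q * ?t b y q) p (E c x p) + D (\<lambda>q. ?n b q * ?t y a q) p (E c x p) + D (\<lambda>q. ?n y q * ?t a b q) p (E c x p))
     - (D (\<lambda>q. ?n a q * ?t b x q) p (E c y p) + D (\<lambda>q. ?n b q * ?t x a q) p (E c y p) + D (\<lambda>q. ?n x q * ?t a b q) p (E c y p)) = 0"
    unfolding Ddd using k by (simp flip: right_diff_distrib distrib_left)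
  have Dt: "D (?t y z) p s = - D (?t z y) p s" for y z s
  proof -
    have "D (?t y z) p s = D (\<lambda>q. - ?t z y q) p s"
      by (rule D_cong[OF U sf_minus[OF U \<theta>] c(2)]) (rule \<theta>skew[symmetric])
    then show ?thesis using D_minus[OF U \<theta> c(2)] by simp
  qed
  have Ep: "E c z p = z" for z using p by (simp add: c_def)
  have d\<eta>: "d\<eta> y z = D (?n z) p y - D (?n y) p z" for y z
    unfolding d\<eta>_def F_def c_def[symmetric] by (simp add: d1_def LB_E[OF c] lin[OF c(2)] Ep)
  have d\<Theta>: "d\<Theta> y z t = D (?t z t) p y - D (?t y t) p z + D (?t y z) p t" for y z t
    unfolding d\<Theta>_def F_def c_def[symmetric] by (simp add: d2_def LB_E[OF c] \<omega>0[OF c(2)] Ep)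
  \<comment> \<open>In \<open>key\<close>, the terms with the derivative on \<eta> assemble to
    d\<eta> \<and> \<Theta>, those with the derivative on \<Theta> to \<eta> \<and> d\<Theta>, up to
    sign.\<close>
  show ?thesis
    unfolding d\<eta> d\<Theta> \<Theta>_def
    using key unfolding Dw Ep Dt[of y b] Dt[of y a] Dt[of x a] \<theta>skew[OF c(2), of y b] \<theta>skew[OF c(2), of y a] \<theta>skew[OF c(2), of x a]
    by (simp add: algebra_simps)
qed

end

section \<open>Linear algebra of almost contact metric structures in dimension five\<close>

locale inner_form =
  fixes g :: "'e::euclidean_space \<Rightarrow> 'e \<Rightarrow> real"
  assumes bil: "bilinear g" and sym: "g u v = g v u" and pos: "v \<noteq> 0 \<Longrightarrow> g v v > 0"
begin

lemma form_simps [simp]: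
  "g (u + v) w = g u w + g v w" "g u (v + w) = g u v + g u w"
  "g (u - v) w = g u w - g v w" "g u (v - w) = g u v - g u w"
  "g (r *\<^sub>R v) w = r * g v w" "g u (r *\<^sub>R w) = r * g u w"
  "g (- v) w = - g v w" "g u (- w) = - g u w" "g 0 w = 0" "g u 0 = 0"
  using bil by (auto simp: bilinear_ladd bilinear_radd bilinear_lsub bilinear_rsub bilinear_lmul bilinear_rmul
      bilinear_lneg bilinear_rneg bilinear_lzero bilinear_rzero)

lemma form_eq_0 [simp]: "g v v = 0 \<longleftrightarrow> v = 0"
  using pos[of v] by force

lemma form_eqI: "(\<And>z. g u z = g v z) \<Longrightarrow> u = v"
  using pos[of "u - v"] by force

lemma linear_form: "linear (g u)" "linear (\<lambda>v. g v u)"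
  using bil by (auto simp: bilinear_def)

lemma form_sum: "g (\<Sum>i\<in>I. f i) v = (\<Sum>i\<in>I. g (f i) v)" "g u (\<Sum>i\<in>I. f i) = (\<Sum>i\<in>I. g u (f i))"
  using linear_sum[OF linear_form(1)[of u], of f I] linear_sum[OF linear_form(2)[of v], of f I] by auto

lemma orth_independent:
  assumes "finite B" "\<And>b. b \<in> B \<Longrightarrow> b \<noteq> 0" "\<And>a b. a \<in> B \<Longrightarrow> b \<in> B \<Longrightarrow> a \<noteq> b \<Longrightarrow> g a b = 0"
  shows "independent B"
  unfolding independent_explicit
proof (intro conjI assms(1) allI impI ballI)
  fix c b assume c: "(\<Sum>a\<in>B. c a *\<^sub>R a) = 0" and b: "b \<in> B"
  have "0 = g (\<Sum>a\<in>B. c a *\<^sub>R a) b" using c by simp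
  also have "\<dots> = (\<Sum>a\<in>B. c a * g a b)" by (simp add: form_sum)
  also have "\<dots> = (\<Sum>a\<in>B. if a = b then c b * g b b else 0)"
    using assms(3) b by (intro sum.cong) auto
  also have "\<dots> = c b * g b b" using assms(1) b by simp
  finally show "c b = 0" using assms(2)[OF b] by simp
qed

lemma orth_span:
  assumes "finite B" "\<And>b. b \<in> B \<Longrightarrow> b \<noteq> 0" "\<And>a b. a \<in> B \<Longrightarrow> b \<in> B \<Longrightarrow> a \<noteq> b \<Longrightarrow> g a b = 0"
    and "card B = DIM('e)"
  shows "span B = UNIV"
  using card_ge_dim_independent[of B UNIV] orth_independent[OF assms(1-3)] assms(4) by auto

lemma orth_extend:
  assumes "finite B" "\<And>b. b \<in> B \<Longrightarrow> b \<noteq> 0" "\<And>a b. a \<in> B \<Longrightarrow> b \<in> B \<Longrightarrow> a \<noteq> b \<Longrightarrow> g a b = 0"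
    and "card B < DIM('e)"
  shows "\<exists>v. v \<noteq> 0 \<and> (\<forall>b\<in>B. g b v = 0)"
proof -
  have "dim (span B) \<le> card B" using assms(1) by (simp add: dim_le_card')
  then have "span B \<noteq> UNIV" using assms(4) by (metis dim_UNIV not_le)
  then obtain v where v: "v \<notin> span B" by auto
  let ?w = "v - (\<Sum>b\<in>B. (g b v / g b b) *\<^sub>R b)"
  have "(\<Sum>b\<in>B. (g b v / g b b) *\<^sub>R b) \<in> span B"
    by (intro span_sum span_scale span_base)
  then have "?w \<noteq> 0" using v by auto
  moreover have "g b ?w = 0" if b: "b \<in> B" for b
  proof -
    have "g b (\<Sum>a\<in>B. (g a v / g a a) *\<^sub>R a) = (\<Sum>a\<in>B. (g a v / g a a) * g b a)"
      by (simp add: form_sum)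
    also have "\<dots> = (\<Sum>a\<in>B. if a = b then g b v else 0)"
      using assms(2,3) b by (intro sum.cong) auto
    also have "\<dots> = g b v" using assms(1) b by simp
    finally show ?thesis by simp
  qed
  ultimately show ?thesis by blast
qed

end

text \<open>The structure on one tangent space. The 1-form is eliminated in favour of
  \<open>g \<xi>\<close>, which \<open>acm_eta_dual\<close> justifies.\<close>

locale acm_alg = inner_form g
  for g :: "'e::euclidean_space \<Rightarrow> 'e \<Rightarrow> real" +
  fixes \<phi> :: "'e \<Rightarrow> 'e" and \<xi> :: 'e
  assumes dim5: "DIM('e) = 5" and lin: "linear \<phi>"
    and sq: "\<phi> (\<phi> v) = - v + g \<xi> v *\<^sub>R \<xi>" and unit: "g \<xi> \<xi> = 1"
    and compat: "g (\<phi> u) (\<phi> v) = g u v - g \<xi> u * g \<xi> v"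
begin

lemma phi_simps [simp]:
  "\<phi> (u + v) = \<phi> u + \<phi> v" "\<phi> (u - v) = \<phi> u - \<phi> v" "\<phi> (r *\<^sub>R v) = r *\<^sub>R \<phi> v" "\<phi> (- v) = - \<phi> v" "\<phi> 0 = 0"
  using lin by (auto simp: linear_add linear_diff linear_scale linear_neg linear_0)

lemma phi_xi [simp]: "\<phi> \<xi> = 0"
  using compat[of \<xi> \<xi>] unit by simp

text \<open>The third power of \<open>\<phi>\<close> at \<open>v\<close> can be read as
  \<open>\<phi>\<close> of a square or as a square at \<open>\<phi> v\<close>; the two readings
  differ by this multiple of \<open>\<xi>\<close>.\<close>

lemma eta_phi [simp]: "g \<xi> (\<phi> v) = 0"
proof -
  have "\<phi> (\<phi> (\<phi> v)) = - \<phi> v" using sq[of v] by simp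
  then have "g \<xi> (\<phi> v) *\<^sub>R \<xi> = 0" using sq[of "\<phi> v"] by simp
  then show ?thesis using unit by auto
qed

lemma eta_phi' [simp]: "g (\<phi> v) \<xi> = 0"
  using sym[of "\<phi> v" \<xi>] by simp

lemma phi_skew: "g (\<phi> u) v = - g u (\<phi> v)"
proof -
  have "g (\<phi> u) (\<phi> (\<phi> v)) = g u (\<phi> v)" using compat[of u "\<phi> v"] by simp
  then show ?thesis by (simp add: sq)
qed

lemma phi_skew_self [simp]: "g v (\<phi> v) = 0" "g (\<phi> v) v = 0"
  using phi_skew[of v v] sym[of v "\<phi> v"] by auto

lemma unit' [simp]: "g \<xi> \<xi> = 1" "\<xi> \<noteq> 0"
  using unit by auto

text \<open>The five vectors are nonzero and mutually orthogonal, and the dimension is five.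
  Distinctness has to be checked because the count is that of a set.\<close>

lemma frame_span:
  assumes e: "e \<noteq> 0" "g \<xi> e = 0" and f: "f \<noteq> 0" "g \<xi> f = 0" "g e f = 0" "g (\<phi> e) f = 0"
  shows "span {\<xi>, e, \<phi> e, f, \<phi> f} = UNIV"
proof -
  let ?B = "[\<xi>, e, \<phi> e, f, \<phi> f]"
  have n: "g (\<phi> v) (\<phi> v) = g v v" if "g \<xi> v = 0" for v using compat[of v v] that by simp
  have ne: "\<phi> e \<noteq> 0" "\<phi> f \<noteq> 0" using n[OF e(2)] n[OF f(2)] e f by auto
  have z: "g e (\<phi> f) = 0" "g (\<phi> e) (\<phi> f) = 0" using phi_skew[of e f] compat[of e f] e f by auto
  have z': "g f e = 0" "g f (\<phi> e) = 0" "g (\<phi> f) e = 0" "g (\<phi> f) (\<phi> e) = 0" "g e \<xi> = 0" "g f \<xi> = 0"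
    using z e f sym by metis+
  have nz: "b \<noteq> 0" if "b \<in> set ?B" for b using that e f ne by auto
  have neq: "a \<noteq> b" if "g a b = 0" "a \<noteq> 0" for a b using that by auto
  have d: "distinct ?B"
    using neq[of \<xi> e] neq[of \<xi> "\<phi> e"] neq[of \<xi> f] neq[of \<xi> "\<phi> f"] neq[of e "\<phi> e"] neq[of e f]
      neq[of e "\<phi> f"] neq[of "\<phi> e" f] neq[of "\<phi> e" "\<phi> f"] neq[of f "\<phi> f"] e f ne z by simp
  have "card (set ?B) = DIM('e)" using distinct_card[OF d] dim5 by simp
  then have "span (set ?B) = UNIV"
    by (intro orth_span nz) (use e f z z' in auto)
  then show ?thesis by simp
qed

lemma zero_on_frame:
  assumes e: "e \<noteq> 0" "g \<xi> e = 0" and f: "f \<noteq> 0" "g \<xi> f = 0" "g e f = 0" "g (\<phi> e) f = 0"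
    and F: "linear F" "F \<xi> = 0" "F e = 0" "F (\<phi> e) = 0" "F f = 0" "F (\<phi> f) = 0"
  shows "F v = 0"
  by (rule linear_eq_0_on_span[OF F(1), of "{\<xi>, e, \<phi> e, f, \<phi> f}"])
    (use F frame_span[OF e f] in auto)

lemma exists_horizontal:
  obtains e where "g \<xi> e = 0" "g e e = 1" "e \<noteq> 0"
proof -
  obtain v where v: "v \<noteq> 0" "g \<xi> v = 0"
    using orth_extend[of "{\<xi>}"] dim5 by auto
  let ?e = "(1 / sqrt (g v v)) *\<^sub>R v"
  have "g ?e ?e = 1" using pos[OF v(1)] v(1) by (simp flip: real_sqrt_mult)
  moreover have "?e \<noteq> 0" using pos[OF v(1)] v(1) by simp
  ultimately show ?thesis using that[of ?e] v(2) by simp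
qed

lemma exists_second:
  assumes e: "e \<noteq> 0" "g \<xi> e = 0"
  obtains f where "f \<noteq> 0" "g \<xi> f = 0" "g e f = 0" "g (\<phi> e) f = 0"
proof -
  have ne: "\<phi> e \<noteq> 0" using compat[of e e] e by auto
  have "\<exists>v. v \<noteq> 0 \<and> (\<forall>b\<in>{\<xi>, e, \<phi> e}. g b v = 0)"
  proof (rule orth_extend)
    show "card {\<xi>, e, \<phi> e} < DIM('e)"
      using dim5 card_insert_le_m1[of 3 "{e, \<phi> e}" \<xi>] card_insert_le_m1[of 2 "{\<phi> e}" e] by simp
    show "g a b = 0" if "a \<in> {\<xi>, e, \<phi> e}" "b \<in> {\<xi>, e, \<phi> e}" "a \<noteq> b" for a b
      using that e sym[of e \<xi>] by auto
  qed (use e ne in auto)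
  then show ?thesis using that by blast
qed

definition hor :: "'e \<Rightarrow> 'e" where "hor v = v - g \<xi> v *\<^sub>R \<xi>"

lemma hor_simps [simp]: "g \<xi> (hor v) = 0" "g (hor v) \<xi> = 0" "\<phi> (hor v) = \<phi> v" "hor (hor v) = hor v" "hor \<xi> = 0" "hor (\<phi> v) = \<phi> v"
  using sym[of v \<xi>] by (auto simp: hor_def)

lemma hor_id: "g \<xi> v = 0 \<Longrightarrow> hor v = v"
  by (simp add: hor_def)

lemma hor_decomp: "v = hor v + g \<xi> v *\<^sub>R \<xi>"
  by (simp add: hor_def)

lemma linear_hor: "linear hor"
  unfolding hor_def by (intro linearI) (simp_all add: algebra_simps)

lemma phi_phi_hor [simp]: "g \<xi> v = 0 \<Longrightarrow> \<phi> (\<phi> v) = - v"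
  by (simp add: sq)

text \<open>Three vectors of a basis \<open>u, \<phi> u, f, \<phi> f\<close> of the horizontal 4-space always contain a pair
  \<open>u, \<phi> u\<close> or \<open>f, \<phi> f\<close>.\<close>

lemma alternating_zero:
  assumes T: "\<And>u v. linear (T u v)" "\<And>u w. linear (\<lambda>v. T u v w)" "\<And>v w. linear (\<lambda>u. T u v w)"
    and alt: "\<And>u v w. g \<xi> u = 0 \<Longrightarrow> g \<xi> v = 0 \<Longrightarrow> g \<xi> w = 0 \<Longrightarrow> T u v w = - T v u w"
      "\<And>u v w. g \<xi> u = 0 \<Longrightarrow> g \<xi> v = 0 \<Longrightarrow> g \<xi> w = 0 \<Longrightarrow> T u v w = - T u w v"
    and zero: "\<And>u w. g \<xi> u = 0 \<Longrightarrow> g \<xi> w = 0 \<Longrightarrow> T u (\<phi> u) w = (0::real)"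
    and h: "g \<xi> u = 0" "g \<xi> v = 0" "g \<xi> w = 0"
  shows "T u v w = 0"
proof (cases "u = 0")
  case True
  then show ?thesis using linear_0[OF T(3), of v w] by simp
next
  case False
  obtain f where f: "f \<noteq> 0" "g \<xi> f = 0" "g u f = 0" "g (\<phi> u) f = 0"
    using exists_second[OF False h(1)] by blast
  note frame0 = zero_on_frame[OF False h(1) f]
  have uu: "T u u x = 0" if "g \<xi> x = 0" for x using alt(1)[of u u x] h that by simp
  have xx: "T u x x = 0" if "g \<xi> x = 0" for x using alt(2)[of u x x] h that by simp
  have ff: "T u f (\<phi> f) = 0" "T u (\<phi> f) f = 0"
    using alt(1)[of u f "\<phi> f"] alt(2)[of f u "\<phi> f"] zero[of f u] alt(2)[of u "\<phi> f" f] h f by auto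
  have last: "T u x u = 0" "T u x (\<phi> u) = 0" if "g \<xi> x = 0" for x
    using alt(2)[of u x u] alt(2)[of u x "\<phi> u"] uu zero[of u x] h that by auto
  \<comment> \<open>The hypotheses on \<open>T\<close> concern horizontal vectors, while vanishing
    on a frame is tested also at \<open>\<xi>\<close>; composing with the projection makes that
    value zero.\<close>
  have linh: "linear (\<lambda>y. T u x (hor y))" "linear (\<lambda>y. T u (hor y) x)" for x
    using linear_compose[OF linear_hor T(1)] linear_compose[OF linear_hor T(2)] by (auto simp: o_def)
  have T0: "T u x 0 = 0" "T u 0 x = 0" for x using linear_0[OF T(1)] linear_0[OF T(2)] by auto
  have 1: "T u x (hor y) = 0" if "g \<xi> x = 0" "T u x f = 0" "T u x (\<phi> f) = 0" for x y
    by (rule frame0[OF linh(1)]) (use that last h f in \<open>auto simp: hor_id T0\<close>)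
  have 2: "T u x w = 0" if "x \<in> {u, \<phi> u, f, \<phi> f}" for x
    using that 1[of f w] 1[of "\<phi> f" w] uu zero[of u w] xx ff h f by (auto simp: hor_id)
  have "T u (hor v) w = 0"
    by (rule frame0[OF linh(2)]) (use 2 h f in \<open>auto simp: hor_id T0\<close>)
  then show ?thesis using h by (simp add: hor_id)
qed

end

subsection \<open>Nearly cosymplectic structures\<close>

text \<open>\<open>P\<close> and \<open>B\<close> stand for the values of \<nabla>\<phi> and
  \<nabla>\<xi> at a point. \<open>P_alt\<close> is the nearly cosymplectic condition; the other
  laws are the derivatives of skewness of \<phi>, of \<phi>\<xi> = 0, of the formula for
  \<phi>\<phi>, and of the unit length of \<xi>.\<close>

locale nc_alg = acm_alg g \<phi> \<xi>
  for g :: "'e::euclidean_space \<Rightarrow> 'e \<Rightarrow> real" and \<phi> \<xi> +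
  fixes P :: "'e \<Rightarrow> 'e \<Rightarrow> 'e" and B :: "'e \<Rightarrow> 'e"
  assumes P_bil: "bilinear P" and P_skew: "g (P u v) w = - g v (P u w)" and P_alt: "P u v = - P v u"
    and P_xi: "P u \<xi> = - \<phi> (B u)"
    and P_phi: "P u (\<phi> v) + \<phi> (P u v) = g (B u) v *\<^sub>R \<xi> + g \<xi> v *\<^sub>R B u"
    and B_lin: "linear B" and eta_B [simp]: "g \<xi> (B u) = 0"
begin

lemma PB_simps [simp]:
  "P (u + v) w = P u w + P v w" "P u (v + w) = P u v + P u w"
  "P (u - v) w = P u w - P v w" "P u (v - w) = P u v - P u w"
  "P (r *\<^sub>R v) w = r *\<^sub>R P v w" "P u (r *\<^sub>R w) = r *\<^sub>R P u w"
  "P (- v) w = - P v w" "P u (- w) = - P u w" "P 0 w = 0" "P u 0 = 0"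
  "B (u + v) = B u + B v" "B (u - v) = B u - B v" "B (r *\<^sub>R v) = r *\<^sub>R B v" "B (- v) = - B v" "B 0 = 0"
  using P_bil B_lin by (auto simp: bilinear_ladd bilinear_radd bilinear_lsub bilinear_rsub bilinear_lmul bilinear_rmul
      bilinear_lneg bilinear_rneg bilinear_lzero bilinear_rzero linear_add linear_diff linear_scale linear_neg linear_0)

lemma eta_B' [simp]: "g (B u) \<xi> = 0"
  using sym[of "B u" \<xi>] by simp

lemma B_xi [simp]: "B \<xi> = 0"
proof -
  have "P \<xi> \<xi> = 0"
  proof (rule form_eqI)
    fix z
    have "g (P \<xi> \<xi>) z = - g (P \<xi> \<xi>) z"
      using arg_cong[OF P_alt[of \<xi> \<xi>], of "\<lambda>x. g x z"] by simp
    then show "g (P \<xi> \<xi>) z = g 0 z" by simp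
  qed
  then have "\<phi> (\<phi> (B \<xi>)) = 0" using P_xi[of \<xi>] by simp
  then show ?thesis by simp
qed

lemma P_xi': "P \<xi> v = \<phi> (B v)"
  using P_alt[of \<xi> v] P_xi[of v] by simp

text \<open>This is the derivative of the formula for \<phi>\<phi> in the direction \<xi>, where
  \<nabla>\<phi> equals \<phi>B and the right-hand side vanishes.\<close>

lemma B_phi: "B (\<phi> v) = - \<phi> (B v)"
proof -
  have "\<phi> (B (\<phi> v)) + \<phi> (\<phi> (B v)) = 0" using P_phi[of \<xi> v] by (simp add: P_xi')
  then have "\<phi> (\<phi> (B (\<phi> v)) + \<phi> (\<phi> (B v))) = 0" by simp
  then have "- B (\<phi> v) = \<phi> (B v)" by simp
  then show ?thesis by (metis minus_minus)
qed

text \<open>Skewness of \<open>P \<xi>\<close> says that \<phi>B is skew; since \<phi> is skew and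
  anticommutes with \<open>B\<close>, so is \<open>B\<close>. Geometrically, \<xi> is a Killing
  field.\<close>

lemma B_skew: "g (B u) v = - g u (B v)"
proof -
  have *: "g (B u) (\<phi> w) = - g (\<phi> u) (B w)" for w
    using P_skew[of \<xi> u w] phi_skew[of u "B w"] phi_skew[of "B u" w] by (simp add: P_xi')
  have "g (B u) (\<phi> (\<phi> v)) = g (\<phi> u) (\<phi> (B v))"
    using *[of "\<phi> v"] by (simp add: B_phi)
  then show ?thesis using compat[of u "B v"] by (simp add: sq)
qed

lemma B_self [simp]: "g v (B v) = 0" "g (B v) v = 0"
  using B_skew[of v v] sym[of v "B v"] by auto

lemma phiB_self [simp]: "g (\<phi> (B v)) v = 0" "g (B v) (\<phi> v) = 0" "g v (\<phi> (B v)) = 0" "g (\<phi> v) (B v) = 0"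
proof -
  have "g (B v) (\<phi> v) = - g v (B (\<phi> v))" by (rule B_skew)
  also have "\<dots> = g v (\<phi> (B v))" by (simp add: B_phi)
  also have "\<dots> = - g (\<phi> v) (B v)" using phi_skew[of v "B v"] by simp
  finally show 1: "g (B v) (\<phi> v) = 0" using sym[of "B v" "\<phi> v"] by simp
  then show "g (\<phi> v) (B v) = 0" using sym[of "B v" "\<phi> v"] by simp
  then show "g v (\<phi> (B v)) = 0" using phi_skew[of v "B v"] by simp
  then show "g (\<phi> (B v)) v = 0" using sym[of v "\<phi> (B v)"] by simp
qed

text \<open>Skewness and \<open>P_alt\<close> make this a 3-form, and horizontally each
  \<open>P u\<close> is skew and anticommutes with \<phi>, which forces the values on triples
  \<open>e\<close>, \<open>\<phi> e\<close>, \<open>z\<close> to vanish. On a 4-space such a form is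
  zero.\<close>

lemma P_horizontal:
  assumes h: "g \<xi> u = 0" "g \<xi> v = 0" "g \<xi> w = 0"
  shows "g (P u v) w = 0"
proof (rule alternating_zero[of "\<lambda>u v w. g (P u v) w", OF _ _ _ _ _ _ h])
  have alt: "g (P u v) w = - g (P u w) v" for u v w
    using P_skew[of u v w] sym[of v "P u w"] by simp
  show "g (P u v) w = - g (P v u) w" for u v w
    by (subst P_alt) simp
  show "g (P u v) w = - g (P u w) v" for u v w
    by (rule alt)
  have move: "g (P u (\<phi> v)) w = g (P u v) (\<phi> w)" if "g \<xi> v = 0" "g \<xi> w = 0" for u v w
  proof -
    have "g (P u (\<phi> v) + \<phi> (P u v)) w = 0"
      unfolding P_phi using that by simp
    then show ?thesis using phi_skew[of "P u v" w] by simp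
  qed
  have "g (P z e) (\<phi> e) = 0" if "g \<xi> e = 0" for z e
    using move[OF that that, of z] alt[of z "\<phi> e" e] by simp
  then show "g (P e (\<phi> e)) z = 0" if "g \<xi> e = 0" "g \<xi> z = 0" for e z
    using that alt[of e "\<phi> e" z] P_alt[of e z] alt[of z e "\<phi> e"] by simp
qed (auto intro!: linearI)

text \<open>With the purely horizontal part gone, only components with a slot equal to \<xi> remain,
  and these are known from \<open>P_xi\<close>.\<close>

lemma P_formula:
  "P u v = g \<xi> u *\<^sub>R \<phi> (B v) - g \<xi> v *\<^sub>R \<phi> (B u) + g (\<phi> (B u)) v *\<^sub>R \<xi>"
proof -
  have Bh: "B (hor v) = B v" for v by (simp add: hor_def)
  have "P (hor u) (hor v) = g (\<phi> (B u)) v *\<^sub>R \<xi>"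
  proof (rule form_eqI)
    fix z
    have "g (P (hor u) (hor v)) (hor z) = 0" by (rule P_horizontal) simp_all
    moreover have "g (P (hor u) (hor v)) \<xi> = g (hor v) (\<phi> (B u))"
      using P_skew[of "hor u" "hor v" \<xi>] P_xi[of "hor u"] by (simp add: Bh)
    moreover have "g (hor v) (\<phi> (B u)) = g (\<phi> (B u)) v"
      using sym[of v "\<phi> (B u)"] by (simp add: hor_def)
    ultimately show "g (P (hor u) (hor v)) z = g (g (\<phi> (B u)) v *\<^sub>R \<xi>) z"
      using arg_cong[OF hor_decomp[of z], of "g (P (hor u) (hor v))"] by simp
  qed
  moreover have "P u v = P (hor u + g \<xi> u *\<^sub>R \<xi>) (hor v + g \<xi> v *\<^sub>R \<xi>)"
    by (simp flip: hor_decomp)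
  moreover have "P (hor u) \<xi> = - \<phi> (B u)" "P \<xi> (hor v) = \<phi> (B v)" "P \<xi> \<xi> = 0"
    using P_xi[of "hor u"] P_xi'[of "hor v"] P_xi[of \<xi>] by (simp_all add: Bh)
  ultimately show ?thesis by simp
qed

text \<open>If \<open>B e \<noteq> 0\<close>, then \<open>e, \<phi> e, B e, \<phi> (B e)\<close> is an orthogonal basis of eigenvectors of \<open>B\<^sup>2\<close>.\<close>

lemma B_square: "\<exists>\<mu>. \<forall>v. B (B v) = - \<mu> *\<^sub>R (v - g \<xi> v *\<^sub>R \<xi>)"
proof (cases "\<forall>v. B v = 0")
  case True
  then show ?thesis by (intro exI[of _ 0]) simp
next
  case False
  then obtain v where "B v \<noteq> 0" by blast
  moreover define e where "e = hor v"
  ultimately have "B e \<noteq> 0" by (simp add: hor_def)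
  moreover from this have "e \<noteq> 0" by auto
  moreover have "g \<xi> e = 0" by (simp add: e_def)
  ultimately have e: "B e \<noteq> 0" "g \<xi> e = 0" "e \<noteq> 0" by auto
  let ?f = "B e"
  have f: "?f \<noteq> 0" "g \<xi> ?f = 0" "g e ?f = 0" "g (\<phi> e) ?f = 0"
    using e by auto
  note frame0 = zero_on_frame[OF e(3,2) f]
  \<comment> \<open>Forced by pairing \<open>B (B e) = - \<mu> *\<^sub>R e\<close> with
    \<open>e\<close>, as \<open>B\<close> is skew.\<close>
  define \<mu> where "\<mu> = g ?f ?f / g e e"
  have ge: "g e e \<noteq> 0" using e by simp
  have "g (B (B e) + \<mu> *\<^sub>R e) z = 0" for z
  proof (rule frame0[OF linear_form(1)])
    show "g (B (B e) + \<mu> *\<^sub>R e) \<xi> = 0" using e(2) sym[of e \<xi>] by simp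
    show "g (B (B e) + \<mu> *\<^sub>R e) e = 0" using B_skew[of "B e" e] ge by (simp add: \<mu>_def)
    show "g (B (B e) + \<mu> *\<^sub>R e) (\<phi> e) = 0" using B_skew[of "B e" "\<phi> e"] by (simp add: B_phi)
  qed simp_all
  then have Be: "B (B e) = - \<mu> *\<^sub>R e" using form_eqI[of "B (B e) + \<mu> *\<^sub>R e" 0] by (simp add: eq_neg_iff_add_eq_0)
  have "B (B v) + \<mu> *\<^sub>R (v - g \<xi> v *\<^sub>R \<xi>) = 0" for v
  proof (rule frame0[of "\<lambda>v. B (B v) + \<mu> *\<^sub>R (v - g \<xi> v *\<^sub>R \<xi>)"])
    show "linear (\<lambda>v. B (B v) + \<mu> *\<^sub>R (v - g \<xi> v *\<^sub>R \<xi>))"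
      by (intro linearI) (simp_all add: algebra_simps)
  qed (use e Be in \<open>simp_all add: B_phi\<close>)
  then show ?thesis by (intro exI[of _ \<mu>]) (simp add: eq_neg_iff_add_eq_0)
qed

lemma B_zero_P_zero: "(\<And>v. B v = 0) \<Longrightarrow> P u v = 0"
  using P_formula[of u v] by simp

lemma phiB_skew: "g (\<phi> (B u)) v = - g (\<phi> (B v)) u"
  using phi_skew[of "B u" v] B_skew[of u "\<phi> v"] sym[of u "\<phi> (B v)"] by (simp add: B_phi)

text \<open>By \<open>P_formula\<close>, \<nabla>\<phi> lowered by the metric already is the 3-form
  \<eta> \<and> \<Omega>, so the cyclic sum that computes d\<Phi> is three times it.\<close>

lemma cyc_P:
  "g (P u v) w + g (P v w) u + g (P w u) v = 3 * wedge12 (g \<xi>) (\<lambda>u v. g (\<phi> (B u)) v) u v w"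
  unfolding P_formula[of u v] P_formula[of v w] P_formula[of w u]
  using phiB_skew[of u w] phiB_skew[of v u] phiB_skew[of w v] by (simp add: wedge12_def algebra_simps)

end

text \<open>\<open>Q\<close> stands for \<nabla>h, with h = \<nabla>\<xi>. \<open>Q_anti\<close> is
  the derivative of the anticommutation of \<phi> and h, and \<open>Q_closed\<close> is d(d\<eta>) =
  0.\<close>

locale nc_alg2 = nc_alg g \<phi> \<xi> P B
  for g :: "'e::euclidean_space \<Rightarrow> 'e \<Rightarrow> real" and \<phi> \<xi> P B +
  fixes Q :: "'e \<Rightarrow> 'e \<Rightarrow> 'e"
  assumes Q_bil: "bilinear Q" and Q_skew: "g (Q u v) w = - g v (Q u w)" and Q_xi: "Q u \<xi> = - B (B u)"
    and Q_anti: "P u (B v) + \<phi> (Q u v) + (Q u (\<phi> v) + B (P u v)) = 0"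
    and Q_closed: "g (Q u v) w + g (Q v w) u + g (Q w u) v = 0"
begin

lemma Q_simps [simp]:
  "Q (u + v) w = Q u w + Q v w" "Q u (v + w) = Q u v + Q u w"
  "Q (u - v) w = Q u w - Q v w" "Q u (v - w) = Q u v - Q u w"
  "Q (r *\<^sub>R v) w = r *\<^sub>R Q v w" "Q u (r *\<^sub>R w) = r *\<^sub>R Q u w"
  "Q (- v) w = - Q v w" "Q u (- w) = - Q u w" "Q 0 w = 0" "Q u 0 = 0"
  using Q_bil by (auto simp: bilinear_ladd bilinear_radd bilinear_lsub bilinear_rsub bilinear_lmul bilinear_rmul
      bilinear_lneg bilinear_rneg bilinear_lzero bilinear_rzero)

lemma Q_alt: "g (Q u v) w = - g (Q u w) v"
  using Q_skew[of u v w] sym[of v "Q u w"] by simp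

lemma BB_sym: "g (B (B u)) v = g (B (B v)) u"
  using B_skew[of "B u" v] B_skew[of "B v" u] sym[of "B u" "B v"] by simp

text \<open>In \<open>Q_closed\<close> with first argument \<xi>, the other two terms are values of
  the symmetric form of \<open>B B\<close> with opposite signs. This is what later makes \<mu>
  constant along \<xi>.\<close>

lemma Q_from_xi [simp]: "Q \<xi> v = 0"
proof (rule form_eqI)
  fix w
  show "g (Q \<xi> v) w = g 0 w"
    using Q_closed[of \<xi> v w] Q_alt[of v w \<xi>] BB_sym[of v w] by (simp add: Q_xi)
qed

text \<open>In \<open>Q_anti\<close> the two terms with \<open>P\<close> cancel on horizontal
  vectors, so there \<nabla>h anticommutes with \<phi>.\<close>

lemma Q_move:
  assumes "g \<xi> v = 0" "g \<xi> w = 0"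
  shows "g (Q u (\<phi> v)) w = g (Q u v) (\<phi> w)"
proof -
  have "g (P u (B v) + \<phi> (Q u v) + (Q u (\<phi> v) + B (P u v))) w = 0"
    unfolding Q_anti by simp
  then show ?thesis
    unfolding P_formula[of u "B v"] P_formula[of u v]
    using phi_skew[of "Q u v" w] assms by (simp add: B_phi)
qed

text \<open>A single summand is not alternating in all arguments, but the cyclic sum is. Its
  vanishing on triples \<open>e\<close>, \<open>\<phi> e\<close>, \<open>z\<close> is where
  closedness of d\<eta> is spent; the 4-space argument then applies again.\<close>

lemma Q_phi_cyc_horizontal:
  assumes h: "g \<xi> u = 0" "g \<xi> v = 0" "g \<xi> w = 0"
  shows "g (Q u v) (\<phi> w) + g (Q v w) (\<phi> u) + g (Q w u) (\<phi> v) = 0"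
proof (rule alternating_zero[of "\<lambda>u v w. g (Q u v) (\<phi> w) + g (Q v w) (\<phi> u) + g (Q w u) (\<phi> v)", OF _ _ _ _ _ _ h])
  have sw: "g (Q u v) (\<phi> w) = - g (Q u w) (\<phi> v)" if "g \<xi> v = 0" "g \<xi> w = 0" for u v w
    using Q_move[OF that(2,1), of u] Q_alt[of u v "\<phi> w"] by simp
  fix u v w assume h: "g \<xi> u = 0" "g \<xi> v = 0" "g \<xi> w = 0"
  show "g (Q u v) (\<phi> w) + g (Q v w) (\<phi> u) + g (Q w u) (\<phi> v) =
      - (g (Q v u) (\<phi> w) + g (Q u w) (\<phi> v) + g (Q w v) (\<phi> u))"
    using sw[OF h(2,3), of u] sw[OF h(3,1), of v] sw[OF h(1,2), of w] by simp
  show "g (Q u v) (\<phi> w) + g (Q v w) (\<phi> u) + g (Q w u) (\<phi> v) =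
      - (g (Q u w) (\<phi> v) + g (Q w v) (\<phi> u) + g (Q v u) (\<phi> w))"
    using sw[OF h(2,3), of u] sw[OF h(3,1), of v] sw[OF h(1,2), of w] by simp
next
  fix e z assume h: "g \<xi> e = 0" "g \<xi> z = 0"
  have "g (Q (\<phi> z) e) (\<phi> e) = 0"
    using Q_move[OF h(1) h(1), of "\<phi> z"] Q_alt[of "\<phi> z" "\<phi> e" e] by simp
  \<comment> \<open>Closedness is evaluated with \<open>\<phi> z\<close> in the third slot, which
    turns the cyclic sum for \<open>Q\<close> into the one twisted by \<phi>.\<close>
  then show "g (Q e (\<phi> e)) (\<phi> z) + g (Q (\<phi> e) z) (\<phi> e) + g (Q z e) (\<phi> (\<phi> e)) = 0"
    using Q_closed[of e "\<phi> e" "\<phi> z"] Q_move[OF h(2,1), of "\<phi> e"] Q_alt[of z e e] h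
    by simp
qed (auto intro!: linearI simp: algebra_simps)

lemma Q_phi_decomp:
  "g (Q u v) (\<phi> w) = g (Q (hor u) (hor v)) (\<phi> (hor w)) + g \<xi> v * g (\<phi> (B (B u))) w"
proof -
  have "g (Q u v) (\<phi> w) = g (Q (hor u + g \<xi> u *\<^sub>R \<xi>) (hor v + g \<xi> v *\<^sub>R \<xi>)) (\<phi> w)"
    by (simp flip: hor_decomp)
  also have "\<dots> = g (Q (hor u) (hor v)) (\<phi> w) - g \<xi> v * g (B (B u)) (\<phi> w)"
    by (simp add: Q_xi hor_def)
  finally show ?thesis using phi_skew[of "B (B u)" w] by simp
qed

text \<open>The left-hand side is the cyclic sum for \<nabla>(\<phi>h) by the Leibniz rule, so this
  is the pointwise form of d\<Omega> = 3 \<eta> \<and> \<Theta>, where \<Theta> is the 2-form of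
  \<phi>hh.\<close>

lemma cyc_PQ:
  "g (P u (B v) + \<phi> (Q u v)) w + g (P v (B w) + \<phi> (Q v w)) u + g (P w (B u) + \<phi> (Q w u)) v =
    3 * wedge12 (g \<xi>) (\<lambda>u v. g (\<phi> (B (B u))) v) u v w"
proof -
  have th: "g (\<phi> (B (B u))) v = - g (\<phi> (B (B v))) u" for u v
  proof -
    have "g (\<phi> (B (B u))) v = - g (B (B u)) (\<phi> v)" by (rule phi_skew)
    also have "\<dots> = - g (\<phi> (B (B v))) u" using BB_sym[of u "\<phi> v"] by (simp add: B_phi)
    finally show ?thesis .
  qed
  have ph: "g (\<phi> (B u)) (B v) = g (\<phi> (B (B u))) v" for u v
    using B_skew[of "\<phi> (B u)" v] by (simp add: B_phi)
  have 1: "g (P u (B v) + \<phi> (Q u v)) w = g \<xi> u * g (\<phi> (B (B v))) w + g (\<phi> (B (B u))) v * g \<xi> w - g (Q u v) (\<phi> w)"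
    for u v w
    unfolding P_formula[of u "B v"] using phi_skew[of "Q u v" w] ph[of u v] by simp
  have "g (Q (hor u) (hor v)) (\<phi> (hor w)) + g (Q (hor v) (hor w)) (\<phi> (hor u)) + g (Q (hor w) (hor u)) (\<phi> (hor v)) = 0"
    by (rule Q_phi_cyc_horizontal) auto
  then show ?thesis
    unfolding 1 Q_phi_decomp[of u v w] Q_phi_decomp[of v w u] Q_phi_decomp[of w u v]
    using th[of u w] th[of v u] th[of w v] by (simp add: wedge12_def algebra_simps)
qed

end

subsection \<open>The intrinsic torsion of Sasaki-Einstein structures\<close>

locale su2_alg = p1: acm_alg g \<phi>\<^sub>1 \<xi> + p2: acm_alg g \<phi>\<^sub>2 \<xi> + p3: acm_alg g \<phi>\<^sub>3 \<xi>
  for g :: "'e::euclidean_space \<Rightarrow> 'e \<Rightarrow> real" and \<phi>\<^sub>1 \<phi>\<^sub>2 \<phi>\<^sub>3 \<xi> +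
  assumes quat [simp]: "\<phi>\<^sub>1 (\<phi>\<^sub>2 v) = \<phi>\<^sub>3 v" "\<phi>\<^sub>2 (\<phi>\<^sub>1 v) = - \<phi>\<^sub>3 v" "\<phi>\<^sub>2 (\<phi>\<^sub>3 v) = \<phi>\<^sub>1 v"
    "\<phi>\<^sub>3 (\<phi>\<^sub>2 v) = - \<phi>\<^sub>1 v" "\<phi>\<^sub>3 (\<phi>\<^sub>1 v) = \<phi>\<^sub>2 v" "\<phi>\<^sub>1 (\<phi>\<^sub>3 v) = - \<phi>\<^sub>2 v"
begin

text \<open>Makes statements that single out the first structure available for the second
  one.\<close>

lemma cyclic: "su2_alg g \<phi>\<^sub>2 \<phi>\<^sub>3 \<phi>\<^sub>1 \<xi>"
  by unfold_locales simp_all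

lemma quat_orth [simp]:
  "g (\<phi>\<^sub>1 v) (\<phi>\<^sub>2 v) = 0" "g (\<phi>\<^sub>2 v) (\<phi>\<^sub>1 v) = 0" "g (\<phi>\<^sub>1 v) (\<phi>\<^sub>3 v) = 0"
  "g (\<phi>\<^sub>3 v) (\<phi>\<^sub>1 v) = 0" "g (\<phi>\<^sub>2 v) (\<phi>\<^sub>3 v) = 0" "g (\<phi>\<^sub>3 v) (\<phi>\<^sub>2 v) = 0"
  using p1.phi_skew[of v "\<phi>\<^sub>2 v"] p1.phi_skew[of v "\<phi>\<^sub>3 v"] p2.phi_skew[of v "\<phi>\<^sub>1 v"]
    p2.phi_skew[of v "\<phi>\<^sub>3 v"] p3.phi_skew[of v "\<phi>\<^sub>1 v"] p3.phi_skew[of v "\<phi>\<^sub>2 v"] by auto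

lemma quat_norm [simp]:
  "g \<xi> v = 0 \<Longrightarrow> g (\<phi>\<^sub>1 v) (\<phi>\<^sub>1 v) = g v v" "g \<xi> v = 0 \<Longrightarrow> g (\<phi>\<^sub>2 v) (\<phi>\<^sub>2 v) = g v v"
  "g \<xi> v = 0 \<Longrightarrow> g (\<phi>\<^sub>3 v) (\<phi>\<^sub>3 v) = g v v"
  using p1.compat[of v v] p2.compat[of v v] p3.compat[of v v] by auto

lemma frame_zero:
  assumes e: "g \<xi> e = 0" "e \<noteq> 0"
    and F: "linear F" "F \<xi> = 0" "F e = 0" "F (\<phi>\<^sub>1 e) = 0" "F (\<phi>\<^sub>2 e) = 0" "F (\<phi>\<^sub>3 e) = 0"
  shows "F v = 0"
proof (rule p1.zero_on_frame[OF e(2,1), of "\<phi>\<^sub>2 e"])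
  have "g (\<phi>\<^sub>2 e) (\<phi>\<^sub>2 e) \<noteq> 0" using e by simp
  then show "\<phi>\<^sub>2 e \<noteq> 0" by auto
qed (use F in simp_all)

text \<open>On the horizontal 4-space, the skew endomorphisms anticommuting with \<open>\<phi>\<^sub>1\<close> are spanned by
  \<open>\<phi>\<^sub>2\<close> and \<open>\<phi>\<^sub>3\<close>.\<close>

lemma anticommuting_skew_zero:
  assumes S: "linear S" and skew: "\<And>v w. g (S v) w = - g v (S w)"
    and move: "\<And>v w. g \<xi> v = 0 \<Longrightarrow> g \<xi> w = 0 \<Longrightarrow> g (S (\<phi>\<^sub>1 v)) w = g (S v) (\<phi>\<^sub>1 w)"
    and e: "g \<xi> e = 0" "e \<noteq> 0" and zero: "g (S e) (\<phi>\<^sub>2 e) = 0" "g (S e) (\<phi>\<^sub>3 e) = 0"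
    and h: "g \<xi> v = 0" "g \<xi> w = 0"
  shows "g (S v) w = 0"
proof -
  have alt: "g (S v) w = - g (S w) v" for v w
    using skew[of v w] p1.sym[of v "S w"] by simp
  have alt0: "g (S v) v = 0" for v using alt[of v v] by simp
  have phi1: "g (S v) (\<phi>\<^sub>1 v) = 0" if "g \<xi> v = 0" for v
    using move[OF that that] alt[of "\<phi>\<^sub>1 v" v] by simp
  have lin: "linear (\<lambda>w. g (S x) (p1.hor w))" "linear (\<lambda>w. g (S (p1.hor w)) x)" for x
    using linear_compose[OF p1.linear_hor p1.linear_form(1)[of "S x"]]
      linear_compose[OF linear_compose[OF p1.linear_hor S] p1.linear_form(2)[of x]]
    by (simp_all add: o_def)
  have S0: "S 0 = 0" using linear_0[OF S] .
  have fr: "g (S x) w = 0"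
    if "g (S x) e = 0" "g (S x) (\<phi>\<^sub>1 e) = 0" "g (S x) (\<phi>\<^sub>2 e) = 0" "g (S x) (\<phi>\<^sub>3 e) = 0" "g \<xi> w = 0" for x w
    using frame_zero[OF e lin(1)[of x], of w] that e by (simp add: p1.hor_id)
  have 0: "g (S e) w = 0" if "g \<xi> w = 0" for w
    by (rule fr) (use alt0 phi1[OF e(1)] zero that in auto)
  have 1: "g (S (\<phi>\<^sub>1 e)) w = 0" if "g \<xi> w = 0" for w
    using move[OF e(1) that] 0[of "\<phi>\<^sub>1 w"] by simp
  have 2: "g (S (\<phi>\<^sub>2 e)) w = 0" if "g \<xi> w = 0" for w
  proof (rule fr[OF _ _ _ _ that])
    show "g (S (\<phi>\<^sub>2 e)) e = 0" using alt[of "\<phi>\<^sub>2 e" e] zero by simp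
    show "g (S (\<phi>\<^sub>2 e)) (\<phi>\<^sub>1 e) = 0" using alt[of "\<phi>\<^sub>2 e" "\<phi>\<^sub>1 e"] 1[of "\<phi>\<^sub>2 e"] by simp
    show "g (S (\<phi>\<^sub>2 e)) (\<phi>\<^sub>3 e) = 0" using phi1[of "\<phi>\<^sub>2 e"] by simp
  qed (rule alt0)
  have 3: "g (S (\<phi>\<^sub>3 e)) w = 0" if "g \<xi> w = 0" for w
    using move[of "\<phi>\<^sub>2 e" w] 2[of "\<phi>\<^sub>1 w"] that by simp
  have "g (S (p1.hor v)) w = 0"
    by (rule frame_zero[OF e lin(2)]) (use 0 1 2 3 h e S0 in \<open>simp_all add: p1.hor_id\<close>)
  then show ?thesis using h by (simp add: p1.hor_id)
qed

text \<open>The two coefficients are read off at one unit vector; after subtracting the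
  corresponding multiples, \<open>anticommuting_skew_zero\<close> applies.\<close>

lemma anticommuting_skew:
  assumes S: "linear S" and skew: "\<And>v w. g (S v) w = - g v (S w)"
    and move: "\<And>v w. g \<xi> v = 0 \<Longrightarrow> g \<xi> w = 0 \<Longrightarrow> g (S (\<phi>\<^sub>1 v)) w = g (S v) (\<phi>\<^sub>1 w)"
    and e: "g \<xi> e = 0" "g e e = 1"
    and h: "g \<xi> v = 0" "g \<xi> w = 0"
  shows "g (S v) w = g (S e) (\<phi>\<^sub>2 e) * g (\<phi>\<^sub>2 v) w + g (S e) (\<phi>\<^sub>3 e) * g (\<phi>\<^sub>3 v) w"
proof -
  define a b where "a = g (S e) (\<phi>\<^sub>2 e)" and "b = g (S e) (\<phi>\<^sub>3 e)"
  let ?S = "\<lambda>v. S v - a *\<^sub>R \<phi>\<^sub>2 v - b *\<^sub>R \<phi>\<^sub>3 v"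
  have "g (?S v) w = 0"
  proof (rule anticommuting_skew_zero[of ?S e])
    show "linear ?S"
      by (intro linearI) (simp_all add: linear_add[OF S] linear_scale[OF S] algebra_simps)
    show "g (?S v) w = - g v (?S w)" for v w
      using skew[of v w] p2.phi_skew[of v w] p3.phi_skew[of v w] by (simp add: algebra_simps)
    show "g (?S (\<phi>\<^sub>1 v)) w = g (?S v) (\<phi>\<^sub>1 w)" if "g \<xi> v = 0" "g \<xi> w = 0" for v w
      using move[OF that] p1.phi_skew[of "\<phi>\<^sub>2 v" w] p1.phi_skew[of "\<phi>\<^sub>3 v" w] by (simp add: algebra_simps)
    show "e \<noteq> 0" using e by auto
  qed (use e h in \<open>simp_all add: a_def b_def\<close>)
  then show ?thesis by (simp add: a_def b_def)
qed

end

text \<open>\<open>P\<^sub>i\<close> and \<open>B\<close> stand for the values of the derivatives of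
  \<open>\<phi>\<^sub>i\<close> and of \<xi> at a point. \<open>P_comp\<close> is the Leibniz rule
  for \<open>\<phi>\<^sub>3 = \<phi>\<^sub>1 \<phi>\<^sub>2\<close>, and the last four laws are the
  equations for d\<eta> and the three d\<omega>.\<close>

locale su2_torsion = su2_alg g \<phi>\<^sub>1 \<phi>\<^sub>2 \<phi>\<^sub>3 \<xi>
  for g :: "'e::euclidean_space \<Rightarrow> 'e \<Rightarrow> real" and \<phi>\<^sub>1 \<phi>\<^sub>2 \<phi>\<^sub>3 \<xi> +
  fixes P\<^sub>1 P\<^sub>2 P\<^sub>3 :: "'e \<Rightarrow> 'e \<Rightarrow> 'e" and B :: "'e \<Rightarrow> 'e"
  assumes bil: "bilinear P\<^sub>1" "bilinear P\<^sub>2" "bilinear P\<^sub>3" and B_lin: "linear B"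
    and skew: "g (P\<^sub>1 u v) w = - g v (P\<^sub>1 u w)" "g (P\<^sub>2 u v) w = - g v (P\<^sub>2 u w)" "g (P\<^sub>3 u v) w = - g v (P\<^sub>3 u w)"
    and P_phi: "P\<^sub>1 u (\<phi>\<^sub>1 v) + \<phi>\<^sub>1 (P\<^sub>1 u v) = g (B u) v *\<^sub>R \<xi> + g \<xi> v *\<^sub>R B u"
      "P\<^sub>2 u (\<phi>\<^sub>2 v) + \<phi>\<^sub>2 (P\<^sub>2 u v) = g (B u) v *\<^sub>R \<xi> + g \<xi> v *\<^sub>R B u"
    and P_xi: "P\<^sub>1 u \<xi> = - \<phi>\<^sub>1 (B u)" "P\<^sub>2 u \<xi> = - \<phi>\<^sub>2 (B u)" "P\<^sub>3 u \<xi> = - \<phi>\<^sub>3 (B u)"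
    and P_comp: "P\<^sub>3 u v = P\<^sub>1 u (\<phi>\<^sub>2 v) + \<phi>\<^sub>1 (P\<^sub>2 u v)"
    and eta_B [simp]: "g \<xi> (B u) = 0"
    and d_eta: "g (B u) v - g (B v) u = - 2 * g (\<phi>\<^sub>3 u) v"
    and d_omega1: "g (P\<^sub>1 u v) w + g (P\<^sub>1 v w) u + g (P\<^sub>1 w u) v = 3 * wedge12 (g \<xi>) (\<lambda>u v. g (\<phi>\<^sub>2 u) v) u v w"
    and d_omega2: "g (P\<^sub>2 u v) w + g (P\<^sub>2 v w) u + g (P\<^sub>2 w u) v = - 3 * wedge12 (g \<xi>) (\<lambda>u v. g (\<phi>\<^sub>1 u) v) u v w"
    and d_omega3: "g (P\<^sub>3 u v) w + g (P\<^sub>3 v w) u + g (P\<^sub>3 w u) v = 0"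
begin

lemma PB_simps [simp]:
  "P\<^sub>1 (u + v) w = P\<^sub>1 u w + P\<^sub>1 v w" "P\<^sub>1 (r *\<^sub>R v) w = r *\<^sub>R P\<^sub>1 v w" "P\<^sub>1 (- v) w = - P\<^sub>1 v w"
  "P\<^sub>2 (u + v) w = P\<^sub>2 u w + P\<^sub>2 v w" "P\<^sub>2 (r *\<^sub>R v) w = r *\<^sub>R P\<^sub>2 v w" "P\<^sub>2 (- v) w = - P\<^sub>2 v w"
  "P\<^sub>1 u (v + w) = P\<^sub>1 u v + P\<^sub>1 u w" "P\<^sub>1 u (r *\<^sub>R w) = r *\<^sub>R P\<^sub>1 u w"
  "P\<^sub>2 u (v + w) = P\<^sub>2 u v + P\<^sub>2 u w" "P\<^sub>2 u (r *\<^sub>R w) = r *\<^sub>R P\<^sub>2 u w"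
  "B (u + v) = B u + B v" "B (u - v) = B u - B v" "B (r *\<^sub>R v) = r *\<^sub>R B v" "B (- v) = - B v" "B 0 = 0"
  using bil B_lin by (auto simp: bilinear_ladd bilinear_radd bilinear_lmul bilinear_rmul
      bilinear_lneg linear_add linear_diff linear_scale linear_neg linear_0)

lemma alt:
  "g (P\<^sub>1 u v) w = - g (P\<^sub>1 u w) v" "g (P\<^sub>2 u v) w = - g (P\<^sub>2 u w) v" "g (P\<^sub>3 u v) w = - g (P\<^sub>3 u w) v"
  using skew[of u v w] p1.sym[of v] by simp_all

lemma B_xi [simp]: "B \<xi> = 0"
proof (rule p1.form_eqI)
  fix z show "g (B \<xi>) z = g 0 z"
    using d_eta[of \<xi> z] p1.sym[of "B z" \<xi>] by simp
qed

text \<open>The horizontal parts of \<open>\<nabla>\<phi>\<^sub>1\<close>, \<open>\<nabla>\<phi>\<^sub>2\<close>, \<open>\<nabla>\<phi>\<^sub>3\<close> are given by three connection 1-forms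
  \<open>a\<close>, \<open>b\<close>, \<open>c\<close>, which the equations for \<open>d\<omega>\<^sub>i\<close> force to be multiples of \<open>\<eta>\<close>.\<close>

lemma connection_forms:
  obtains a b c where "linear a" "linear b" "linear c"
    "\<And>u v w. g \<xi> v = 0 \<Longrightarrow> g \<xi> w = 0 \<Longrightarrow> g (P\<^sub>1 u v) w = a u * g (\<phi>\<^sub>2 v) w + b u * g (\<phi>\<^sub>3 v) w"
    "\<And>u v w. g \<xi> v = 0 \<Longrightarrow> g \<xi> w = 0 \<Longrightarrow> g (P\<^sub>2 u v) w = c u * g (\<phi>\<^sub>3 v) w - a u * g (\<phi>\<^sub>1 v) w"
    "\<And>u v w. g \<xi> v = 0 \<Longrightarrow> g \<xi> w = 0 \<Longrightarrow> g (P\<^sub>3 u v) w = - b u * g (\<phi>\<^sub>1 v) w - c u * g (\<phi>\<^sub>2 v) w"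
proof -
  interpret cyc: su2_alg g \<phi>\<^sub>2 \<phi>\<^sub>3 \<phi>\<^sub>1 \<xi> by (rule cyclic)
  obtain e where e: "g \<xi> e = 0" "g e e = 1" using p1.exists_horizontal by blast
  define a b c d where "a u = g (P\<^sub>1 u e) (\<phi>\<^sub>2 e)" and "b u = g (P\<^sub>1 u e) (\<phi>\<^sub>3 e)"
    and "c u = g (P\<^sub>2 u e) (\<phi>\<^sub>3 e)" and "d u = g (P\<^sub>2 u e) (\<phi>\<^sub>1 e)" for u
  have lin: "linear a" "linear b" "linear c"
    unfolding a_def b_def c_def by (auto intro!: linearI)
  have move1: "g (P\<^sub>1 u (\<phi>\<^sub>1 v)) w = g (P\<^sub>1 u v) (\<phi>\<^sub>1 w)" if "g \<xi> v = 0" "g \<xi> w = 0" for u v w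
  proof -
    have "g (P\<^sub>1 u (\<phi>\<^sub>1 v) + \<phi>\<^sub>1 (P\<^sub>1 u v)) w = 0" unfolding P_phi using that by simp
    then show ?thesis using p1.phi_skew[of "P\<^sub>1 u v" w] by simp
  qed
  have move2: "g (P\<^sub>2 u (\<phi>\<^sub>2 v)) w = g (P\<^sub>2 u v) (\<phi>\<^sub>2 w)" if "g \<xi> v = 0" "g \<xi> w = 0" for u v w
  proof -
    have "g (P\<^sub>2 u (\<phi>\<^sub>2 v) + \<phi>\<^sub>2 (P\<^sub>2 u v)) w = 0" unfolding P_phi using that by simp
    then show ?thesis using p2.phi_skew[of "P\<^sub>2 u v" w] by simp
  qed
  have linP: "linear (P\<^sub>1 u)" "linear (P\<^sub>2 u)" for u using bil by (auto simp: bilinear_def)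
  have 1: "g (P\<^sub>1 u v) w = a u * g (\<phi>\<^sub>2 v) w + b u * g (\<phi>\<^sub>3 v) w" if "g \<xi> v = 0" "g \<xi> w = 0" for u v w
    unfolding a_def b_def by (rule anticommuting_skew[OF linP(1) skew(1) move1 e that])
  have 2: "g (P\<^sub>2 u v) w = c u * g (\<phi>\<^sub>3 v) w + d u * g (\<phi>\<^sub>1 v) w" if "g \<xi> v = 0" "g \<xi> w = 0" for u v w
    unfolding c_def d_def by (rule cyc.anticommuting_skew[OF linP(2) skew(2) move2 e that])
  have 3: "g (P\<^sub>3 u v) w = - (a u + d u) * g v w - b u * g (\<phi>\<^sub>1 v) w - c u * g (\<phi>\<^sub>2 v) w"
    if "g \<xi> v = 0" "g \<xi> w = 0" for u v w
  proof -
    have "g (P\<^sub>3 u v) w = g (P\<^sub>1 u (\<phi>\<^sub>2 v)) w - g (P\<^sub>2 u v) (\<phi>\<^sub>1 w)"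
      unfolding P_comp using p1.phi_skew[of "P\<^sub>2 u v" w] by simp
    also have "\<dots> = - (a u + d u) * g v w - b u * g (\<phi>\<^sub>1 v) w - c u * g (\<phi>\<^sub>2 v) w"
      using 1[of "\<phi>\<^sub>2 v" w u] 2[of v "\<phi>\<^sub>1 w" u] that p1.compat[of v w] p1.phi_skew[of "\<phi>\<^sub>3 v" w]
      by (simp add: algebra_simps)
    finally show ?thesis .
  qed
  \<comment> \<open>The derivative of \<open>\<phi>\<^sub>3\<close> is skew, so it has no multiple
    of the metric as a component.\<close>
  have d: "d u = - a u" for u using 3[OF e(1) e(1), of u] alt(3)[of u e e] e by simp
  have 2: "g (P\<^sub>2 u v) w = c u * g (\<phi>\<^sub>3 v) w - a u * g (\<phi>\<^sub>1 v) w" if "g \<xi> v = 0" "g \<xi> w = 0" for u v w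
    using 2[OF that, of u] d by simp
  have 3: "g (P\<^sub>3 u v) w = - b u * g (\<phi>\<^sub>1 v) w - c u * g (\<phi>\<^sub>2 v) w" if "g \<xi> v = 0" "g \<xi> w = 0" for u v w
    using 3[OF that, of u] d by simp
  show ?thesis by (rule that[of a b c]) (fact lin 1 2 3)+
qed

text \<open>By \<open>d_eta\<close>, the sum C of \<open>B\<close> and \<open>\<phi>\<^sub>3\<close>
  is symmetric, and the goal is C = 0. The equations for d\<omega> with \<xi> inserted give the
  anticommutator of C with each \<open>\<phi>\<^sub>i\<close> in terms of the three numbers
  \<open>a \<xi>\<close>, \<open>b \<xi>\<close>, \<open>c \<xi>\<close>. Compatibility with the
  squares of the \<open>\<phi>\<^sub>i\<close> determines these numbers and leaves C anticommuting
  with all three, which is impossible unless C = 0.\<close>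

lemma B_eq: "B v = - \<phi>\<^sub>3 v"
  and P2_horizontal: "g \<xi> v = 0 \<Longrightarrow> g \<xi> w = 0 \<Longrightarrow> g (P\<^sub>2 u v) w = - g \<xi> u * g (\<phi>\<^sub>1 v) w"
proof -
  obtain a b c where lin: "linear a" "linear b" "linear c"
    and P1: "\<And>u v w. g \<xi> v = 0 \<Longrightarrow> g \<xi> w = 0 \<Longrightarrow> g (P\<^sub>1 u v) w = a u * g (\<phi>\<^sub>2 v) w + b u * g (\<phi>\<^sub>3 v) w"
    and P2: "\<And>u v w. g \<xi> v = 0 \<Longrightarrow> g \<xi> w = 0 \<Longrightarrow> g (P\<^sub>2 u v) w = c u * g (\<phi>\<^sub>3 v) w - a u * g (\<phi>\<^sub>1 v) w"
    and P3: "\<And>u v w. g \<xi> v = 0 \<Longrightarrow> g \<xi> w = 0 \<Longrightarrow> g (P\<^sub>3 u v) w = - b u * g (\<phi>\<^sub>1 v) w - c u * g (\<phi>\<^sub>2 v) w"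
    by (rule connection_forms) blast
  have hor: "a u = 0" "c u = 0" "b u = 0" if u: "g \<xi> u = 0" for u
  proof -
    have *: "a (\<phi>\<^sub>3 v) = 0 \<and> b (\<phi>\<^sub>2 v) = 0 \<and> c (\<phi>\<^sub>1 v) = 0" if v: "g \<xi> v = 0" "v \<noteq> 0" for v
    proof -
      \<comment> \<open>On each of these three triples all other terms pair orthogonal vectors. The
        resulting relations close up with a sign: the value of \<open>a\<close> at
        \<open>\<phi>\<^sub>3 v\<close> equals its own negative.\<close>
      have "a (\<phi>\<^sub>3 v) * g v v = b (\<phi>\<^sub>2 v) * g v v"
        using d_omega1[of "\<phi>\<^sub>3 v" v "\<phi>\<^sub>2 v"] v by (simp add: P1 wedge12_def)
      moreover have "c (\<phi>\<^sub>1 v) * g v v = - a (\<phi>\<^sub>3 v) * g v v"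
        using d_omega2[of "\<phi>\<^sub>1 v" v "\<phi>\<^sub>3 v"] v by (simp add: P2 wedge12_def)
      moreover have "b (\<phi>\<^sub>2 v) * g v v = c (\<phi>\<^sub>1 v) * g v v"
        using d_omega3[of "\<phi>\<^sub>2 v" v "\<phi>\<^sub>1 v"] v by (simp add: P3)
      ultimately have "a (\<phi>\<^sub>3 v) = b (\<phi>\<^sub>2 v)" "c (\<phi>\<^sub>1 v) = - a (\<phi>\<^sub>3 v)" "b (\<phi>\<^sub>2 v) = c (\<phi>\<^sub>1 v)"
        using v(2) by auto
      then show ?thesis by auto
    qed
    have "u = \<phi>\<^sub>3 (- \<phi>\<^sub>3 u)" "u = \<phi>\<^sub>2 (- \<phi>\<^sub>2 u)" "u = \<phi>\<^sub>1 (- \<phi>\<^sub>1 u)" using u by simp_all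
    then show "a u = 0" "c u = 0" "b u = 0"
      using *[of "- \<phi>\<^sub>3 u"] *[of "- \<phi>\<^sub>2 u"] *[of "- \<phi>\<^sub>1 u"] linear_0[OF lin(1)] linear_0[OF lin(2)] linear_0[OF lin(3)]
      by (metis p1.eta_phi p2.eta_phi p3.eta_phi p1.form_simps(8) neg_0_equal_iff_equal p1.phi_simps(5) p2.phi_simps(5) p3.phi_simps(5))+
  qed
  define C where "C v = B v + \<phi>\<^sub>3 v" for v
  have C_simps: "C (u + v) = C u + C v" "C (u - v) = C u - C v" "C (r *\<^sub>R v) = r *\<^sub>R C v" "C (- v) = - C v" "g \<xi> (C v) = 0" "C \<xi> = 0" for u v r
    by (simp_all add: C_def algebra_simps)
  have C_sym: "g (C v) w = g (C w) v" for v w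
    using d_eta[of v w] p3.phi_skew[of w v] p1.sym[of w "\<phi>\<^sub>3 v"] by (simp add: C_def)
  have C_hor: "C (p1.hor v) = C v" for v by (simp add: p1.hor_def C_simps)
  \<comment> \<open>Maps with horizontal values that depend on the horizontal part only are compared
    on horizontal vectors.\<close>
  have ext: "X v = Y v"
    if "\<And>v w. g \<xi> v = 0 \<Longrightarrow> g \<xi> w = 0 \<Longrightarrow> g (X v) w = g (Y v) w"
      and "\<And>v. X (p1.hor v) = X v" "\<And>v. Y (p1.hor v) = Y v" "\<And>v. g \<xi> (X v) = 0" "\<And>v. g \<xi> (Y v) = 0"
    for X Y :: "'e \<Rightarrow> 'e" and v
  proof (rule p1.form_eqI)
    fix z
    have "g (X (p1.hor v)) (p1.hor z) = g (Y (p1.hor v)) (p1.hor z)" by (rule that(1)) simp_all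
    moreover have "g (X v) \<xi> = 0" "g (Y v) \<xi> = 0" using that(4,5) p1.sym by metis+
    ultimately show "g (X v) z = g (Y v) z" using that(2,3) by (simp add: p1.hor_def)
  qed
  have hp: "\<phi>\<^sub>2 (p1.hor v) = \<phi>\<^sub>2 v" "\<phi>\<^sub>3 (p1.hor v) = \<phi>\<^sub>3 v" for v by (simp_all add: p1.hor_def)
  have E1: "\<phi>\<^sub>1 (C v) + C (\<phi>\<^sub>1 v) = (1 - a \<xi>) *\<^sub>R \<phi>\<^sub>2 v - b \<xi> *\<^sub>R \<phi>\<^sub>3 v" for v
  proof (rule ext[of "\<lambda>v. \<phi>\<^sub>1 (C v) + C (\<phi>\<^sub>1 v)" "\<lambda>v. (1 - a \<xi>) *\<^sub>R \<phi>\<^sub>2 v - b \<xi> *\<^sub>R \<phi>\<^sub>3 v"])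
    fix v w assume h: "g \<xi> v = 0" "g \<xi> w = 0"
    have "g (\<phi>\<^sub>1 (B v)) w - g (\<phi>\<^sub>1 (B w)) v = 3 * g (\<phi>\<^sub>2 v) w - (a \<xi> * g (\<phi>\<^sub>2 v) w + b \<xi> * g (\<phi>\<^sub>3 v) w)"
      using d_omega1[of \<xi> v w] alt(1)[of v w \<xi>] P1[OF h, of \<xi>] h by (simp add: P_xi wedge12_def)
    moreover have "g (\<phi>\<^sub>1 (B w)) v = - g (C (\<phi>\<^sub>1 v)) w - g (\<phi>\<^sub>2 v) w" "g (\<phi>\<^sub>1 (B v)) w = g (\<phi>\<^sub>1 (C v)) w + g (\<phi>\<^sub>2 v) w"
      using p1.phi_skew[of "C w" v] C_sym[of w "\<phi>\<^sub>1 v"] p2.phi_skew[of w v] p1.sym[of w "\<phi>\<^sub>2 v"]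
      by (simp_all add: C_def)
    ultimately show "g (\<phi>\<^sub>1 (C v) + C (\<phi>\<^sub>1 v)) w = g ((1 - a \<xi>) *\<^sub>R \<phi>\<^sub>2 v - b \<xi> *\<^sub>R \<phi>\<^sub>3 v) w"
      by (simp add: algebra_simps)
  qed (simp_all add: C_hor hp C_simps)
  have E2: "\<phi>\<^sub>2 (C v) + C (\<phi>\<^sub>2 v) = (a \<xi> - 1) *\<^sub>R \<phi>\<^sub>1 v - c \<xi> *\<^sub>R \<phi>\<^sub>3 v" for v
  proof (rule ext[of "\<lambda>v. \<phi>\<^sub>2 (C v) + C (\<phi>\<^sub>2 v)" "\<lambda>v. (a \<xi> - 1) *\<^sub>R \<phi>\<^sub>1 v - c \<xi> *\<^sub>R \<phi>\<^sub>3 v"])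
    fix v w assume h: "g \<xi> v = 0" "g \<xi> w = 0"
    have "g (\<phi>\<^sub>2 (B v)) w - g (\<phi>\<^sub>2 (B w)) v = - 3 * g (\<phi>\<^sub>1 v) w - (c \<xi> * g (\<phi>\<^sub>3 v) w - a \<xi> * g (\<phi>\<^sub>1 v) w)"
      using d_omega2[of \<xi> v w] alt(2)[of v w \<xi>] P2[OF h, of \<xi>] h by (simp add: P_xi wedge12_def)
    moreover have "g (\<phi>\<^sub>2 (B w)) v = - g (C (\<phi>\<^sub>2 v)) w + g (\<phi>\<^sub>1 v) w" "g (\<phi>\<^sub>2 (B v)) w = g (\<phi>\<^sub>2 (C v)) w - g (\<phi>\<^sub>1 v) w"
      using p2.phi_skew[of "C w" v] C_sym[of w "\<phi>\<^sub>2 v"] p1.phi_skew[of w v] p1.sym[of w "\<phi>\<^sub>1 v"]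
      by (simp_all add: C_def)
    ultimately show "g (\<phi>\<^sub>2 (C v) + C (\<phi>\<^sub>2 v)) w = g ((a \<xi> - 1) *\<^sub>R \<phi>\<^sub>1 v - c \<xi> *\<^sub>R \<phi>\<^sub>3 v) w"
      by (simp add: algebra_simps)
  qed (simp_all add: C_hor hp C_simps)
  have E3: "\<phi>\<^sub>3 (C v) + C (\<phi>\<^sub>3 v) = b \<xi> *\<^sub>R \<phi>\<^sub>1 v + c \<xi> *\<^sub>R \<phi>\<^sub>2 v" for v
  proof (rule ext[of "\<lambda>v. \<phi>\<^sub>3 (C v) + C (\<phi>\<^sub>3 v)" "\<lambda>v. b \<xi> *\<^sub>R \<phi>\<^sub>1 v + c \<xi> *\<^sub>R \<phi>\<^sub>2 v"])
    fix v w assume h: "g \<xi> v = 0" "g \<xi> w = 0"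
    have "g (\<phi>\<^sub>3 (B v)) w - g (\<phi>\<^sub>3 (B w)) v = b \<xi> * g (\<phi>\<^sub>1 v) w + c \<xi> * g (\<phi>\<^sub>2 v) w"
      using d_omega3[of \<xi> v w] alt(3)[of v w \<xi>] P3[OF h, of \<xi>] h by (simp add: P_xi)
    moreover have "g (\<phi>\<^sub>3 (B w)) v = - g (C (\<phi>\<^sub>3 v)) w + g v w" "g (\<phi>\<^sub>3 (B v)) w = g (\<phi>\<^sub>3 (C v)) w + g v w"
      using p3.phi_skew[of "C w" v] C_sym[of w "\<phi>\<^sub>3 v"] p1.sym[of w v] h
      by (simp_all add: C_def)
    ultimately show "g (\<phi>\<^sub>3 (C v) + C (\<phi>\<^sub>3 v)) w = g (b \<xi> *\<^sub>R \<phi>\<^sub>1 v + c \<xi> *\<^sub>R \<phi>\<^sub>2 v) w"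
      by (simp add: algebra_simps)
  qed (simp_all add: C_hor hp C_simps)
  obtain e where e: "g \<xi> e = 0" "g e e = 1" using p1.exists_horizontal by blast
  have sq: "\<phi>\<^sub>1 (\<phi>\<^sub>1 (C e)) = C (\<phi>\<^sub>1 (\<phi>\<^sub>1 e))" "\<phi>\<^sub>2 (\<phi>\<^sub>2 (C e)) = C (\<phi>\<^sub>2 (\<phi>\<^sub>2 e))"
    using e by (simp_all add: C_simps)
  \<comment> \<open>The anticommutator of \<open>C\<close> and \<open>\<phi>\<^sub>1\<close>
    commutes with \<open>\<phi>\<^sub>1\<close> at \<open>e\<close>, as the square of
    \<open>\<phi>\<^sub>1\<close> is -1 on horizontal vectors. The right-hand side of
    \<open>E1\<close>, built from \<open>\<phi>\<^sub>2\<close> and \<open>\<phi>\<^sub>3\<close>,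
    anticommutes with it.\<close>
  have "\<phi>\<^sub>1 (\<phi>\<^sub>1 (C e) + C (\<phi>\<^sub>1 e)) = \<phi>\<^sub>1 (C (\<phi>\<^sub>1 e)) + C (\<phi>\<^sub>1 (\<phi>\<^sub>1 e))"
    by (simp only: sq p1.phi_simps add.commute)
  then have "(1 - a \<xi>) *\<^sub>R \<phi>\<^sub>3 e + b \<xi> *\<^sub>R \<phi>\<^sub>2 e = - ((1 - a \<xi>) *\<^sub>R \<phi>\<^sub>3 e + b \<xi> *\<^sub>R \<phi>\<^sub>2 e)"
    unfolding E1 by (simp add: add.commute)
  from arg_cong[OF this, of "\<lambda>x. g x (\<phi>\<^sub>3 e)"] arg_cong[OF this, of "\<lambda>x. g x (\<phi>\<^sub>2 e)"]
  have ab: "a \<xi> = 1" "b \<xi> = 0" using e by simp_all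
  have "\<phi>\<^sub>2 (\<phi>\<^sub>2 (C e) + C (\<phi>\<^sub>2 e)) = \<phi>\<^sub>2 (C (\<phi>\<^sub>2 e)) + C (\<phi>\<^sub>2 (\<phi>\<^sub>2 e))"
    by (simp only: sq p2.phi_simps add.commute)
  then have "- c \<xi> *\<^sub>R \<phi>\<^sub>1 e = c \<xi> *\<^sub>R \<phi>\<^sub>1 e"
    unfolding E2 using ab by simp
  from arg_cong[OF this, of "\<lambda>x. g x (\<phi>\<^sub>1 e)"] have c: "c \<xi> = 0" using e by simp
  have anti: "C (\<phi>\<^sub>1 v) = - \<phi>\<^sub>1 (C v)" "C (\<phi>\<^sub>2 v) = - \<phi>\<^sub>2 (C v)" "C (\<phi>\<^sub>3 v) = - \<phi>\<^sub>3 (C v)" for v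
    using E1[of v] E2[of v] E3[of v] ab c by (simp_all add: eq_neg_iff_add_eq_0 add.commute)
  have "C v = 0" for v
  proof -
    \<comment> \<open>Anticommuting with two of the structures means commuting with their product
      \<open>\<phi>\<^sub>3\<close>, with which \<open>C\<close> also anticommutes.\<close>
    have "C (\<phi>\<^sub>1 (\<phi>\<^sub>2 v)) = \<phi>\<^sub>1 (\<phi>\<^sub>2 (C v))" by (simp only: anti p1.phi_simps minus_minus)
    then have "\<phi>\<^sub>3 (C v) = - \<phi>\<^sub>3 (C v)" using anti(3)[of v] by simp
    then have "\<phi>\<^sub>3 (\<phi>\<^sub>3 (C v)) = \<phi>\<^sub>3 (- \<phi>\<^sub>3 (C v))" by (rule arg_cong)
    then have eq: "C v = - C v" by (simp add: C_simps)
    from arg_cong[OF this, of "g (C v)"] show "C v = 0" by simp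
  qed
  then show "B v = - \<phi>\<^sub>3 v" by (simp add: C_def eq_neg_iff_add_eq_0)
  show "g (P\<^sub>2 u v) w = - g \<xi> u * g (\<phi>\<^sub>1 v) w" if h: "g \<xi> v = 0" "g \<xi> w = 0"
  proof -
    have split: "u = p1.hor u + g \<xi> u *\<^sub>R \<xi>" by (rule p1.hor_decomp)
    have "a u = g \<xi> u" "c u = 0"
      using arg_cong[OF split, of a] arg_cong[OF split, of c] linear_add[OF lin(1)] linear_scale[OF lin(1)]
        linear_add[OF lin(3)] linear_scale[OF lin(3)] hor[of "p1.hor u"] ab c by simp_all
    then show ?thesis using P2[OF h, of u] by simp
  qed
qed

lemma P2_formula: "P\<^sub>2 u v = g \<xi> v *\<^sub>R \<phi>\<^sub>1 u - g \<xi> u *\<^sub>R \<phi>\<^sub>1 v - g (\<phi>\<^sub>1 u) v *\<^sub>R \<xi>"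
proof (rule p1.form_eqI)
  fix z
  have "g (P\<^sub>2 u v) z = g (P\<^sub>2 u (p1.hor v + g \<xi> v *\<^sub>R \<xi>)) (p1.hor z + g \<xi> z *\<^sub>R \<xi>)"
    by (simp flip: p1.hor_decomp)
  also have "\<dots> = g (P\<^sub>2 u (p1.hor v)) (p1.hor z) + g \<xi> z * g (P\<^sub>2 u (p1.hor v)) \<xi> + g \<xi> v * g (\<phi>\<^sub>1 u) (p1.hor z)"
    by (simp add: P_xi B_eq)
  also have "g (P\<^sub>2 u (p1.hor v)) (p1.hor z) = - g \<xi> u * g (\<phi>\<^sub>1 v) z"
    using P2_horizontal[of "p1.hor v" "p1.hor z" u] by (simp add: p1.hor_def)
  also have "g (P\<^sub>2 u (p1.hor v)) \<xi> = - g (\<phi>\<^sub>1 u) v"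
    using alt(2)[of u "p1.hor v" \<xi>] by (simp add: P_xi B_eq p1.hor_def)
  also have "g (\<phi>\<^sub>1 u) (p1.hor z) = g (\<phi>\<^sub>1 u) z" by (simp add: p1.hor_def)
  finally show "g (P\<^sub>2 u v) z = g (g \<xi> v *\<^sub>R \<phi>\<^sub>1 u - g \<xi> u *\<^sub>R \<phi>\<^sub>1 v - g (\<phi>\<^sub>1 u) v *\<^sub>R \<xi>) z"
    by (simp add: algebra_simps)
qed

end

section \<open>Almost contact metric manifolds of dimension five\<close>

text \<open>The axioms do not state the duality. Since \<phi>\<phi>\<xi> = 0, the vector \<phi>\<xi>
  is a multiple of \<xi> whose factor squares to zero; hence \<phi>\<xi> = 0, and compatibility with
  \<open>u = \<xi>\<close> gives the claim.\<close>

lemma acm_eta_dual: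
  fixes g :: "'e::euclidean_space \<Rightarrow> 'e \<Rightarrow> real"
  assumes g: "bilinear g" and \<phi>: "linear \<phi>" and \<eta>: "linear \<eta>"
    and sq: "\<And>v. \<phi> (\<phi> v) = - v + \<eta> v *\<^sub>R \<xi>" and unit: "\<eta> \<xi> = 1"
    and compat: "\<And>u v. g (\<phi> u) (\<phi> v) = g u v - \<eta> u * \<eta> v"
  shows "\<eta> v = g \<xi> v"
proof -
  have "\<phi> (\<phi> \<xi>) = 0" using sq[of \<xi>] unit by simp
  then have 1: "\<phi> \<xi> = \<eta> (\<phi> \<xi>) *\<^sub>R \<xi>"
    using sq[of "\<phi> \<xi>"] linear_0[OF \<phi>] by simp
  then have "\<phi> (\<phi> \<xi>) = (\<eta> (\<phi> \<xi>) * \<eta> (\<phi> \<xi>)) *\<^sub>R \<xi>"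
    by (metis linear_scale[OF \<phi>] scaleR_scaleR)
  moreover have "\<xi> \<noteq> 0" using unit linear_0[OF \<eta>] by auto
  ultimately have "\<eta> (\<phi> \<xi>) = 0" using \<open>\<phi> (\<phi> \<xi>) = 0\<close> by simp
  then have "\<phi> \<xi> = 0" using 1 by simp
  then show ?thesis
    using compat[of \<xi> v] unit bilinear_lzero[OF g] by simp
qed

context smooth_mfd
begin

section \<open>Functions with vanishing differential on a connected manifold\<close>

lemma open_nonzero:
  fixes f :: "'a \<Rightarrow> real"
  assumes c: "c \<in> A" and f: "sf (chart_dom c) f"
  shows "openin M {q \<in> chart_dom c. f q \<noteq> 0}"
proof -
  let ?V = "chart_map c ` chart_dom c"
  have "smooth_on ?V (f \<circ> chart_inv c)" using sf_chart[OF f c] by simp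
  then have "continuous_on ?V (f \<circ> chart_inv c)"
    unfolding smooth_on_def using Ck_on.simps(1) by blast
  then have "open (?V \<inter> (f \<circ> chart_inv c) -` (- {0}))"
    using continuous_open_preimage[OF _ chart_range_open[OF c]] by blast
  moreover have "?V \<inter> (f \<circ> chart_inv c) -` (- {0}) = chart_map c ` {q \<in> chart_dom c. f q \<noteq> 0}"
    using c by auto
  ultimately show ?thesis
    using open_chart_image_iff[OF c, of "{q \<in> chart_dom c. f q \<noteq> 0}"] by auto
qed

lemma locally_constant:
  fixes f :: "'a \<Rightarrow> real"
  assumes f: "sf (topspace M) f" and zero: "\<And>p v. p \<in> topspace M \<Longrightarrow> D f p v = 0" and p: "p \<in> topspace M"
  shows "\<exists>W. openin M W \<and> p \<in> W \<and> (\<forall>q\<in>W. f q = f p)"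
proof -
  obtain c where c: "c \<in> A" "p \<in> chart_dom c" using chart_at_in[OF p] by blast
  let ?V = "chart_map c ` chart_dom c" and ?f = "f \<circ> chart_inv c"
  obtain r where r: "r > 0" "ball (chart_map c p) r \<subseteq> ?V"
    using chart_range_open[OF c(1)] c(2) openE by blast
  have "(?f has_derivative (\<lambda>h. 0)) (at y within ball (chart_map c p) r)" if y: "y \<in> ball (chart_map c p) r" for y
  proof -
    obtain q where q: "q \<in> chart_dom c" "y = chart_map c q" using y r by blast
    then have "q \<in> topspace M" using chart_subset[OF c(1)] by blast
    then have "frechet_derivative ?f (at y) = (\<lambda>h. 0)"
      using D_E[OF c(1) q(1) f] zero q(2) by (auto simp: fun_eq_iff)
    then show ?thesis
      using sf_differentiable[OF f \<open>q \<in> topspace M\<close> c(1) q(1)] q(2) has_derivative_at_withinI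
      by (metis frechet_derivative_works)
  qed
  then obtain k where k: "\<forall>y\<in>ball (chart_map c p) r. ?f y = k"
    using has_derivative_zero_constant[of "ball (chart_map c p) r" ?f] by auto
  let ?W = "{q \<in> chart_dom c. chart_map c q \<in> ball (chart_map c p) r}"
  have "chart_map c ` ?W = ball (chart_map c p) r" using r by auto
  then have "openin M ?W" using open_chart_image_iff[OF c(1), of ?W] by auto
  moreover have "f q = k" if "q \<in> ?W" for q using k that c by force
  ultimately show ?thesis using c r by (intro exI[of _ ?W]) auto
qed

text \<open>A level set and its complement are both open, since the function is locally
  constant.\<close>

lemma constant_function:
  fixes f :: "'a \<Rightarrow> real"
  assumes f: "sf (topspace M) f" and zero: "\<And>p v. p \<in> topspace M \<Longrightarrow> D f p v = 0"
    and "p \<in> topspace M" "q \<in> topspace M"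
  shows "f p = f q"
proof -
  let ?S = "{x \<in> topspace M. f x = f q}"
  note lc = locally_constant[OF f zero]
  have "openin M ?S"
  proof (subst openin_subopen, intro ballI)
    fix x assume x: "x \<in> ?S"
    then obtain W where W: "openin M W" "x \<in> W" "\<forall>y\<in>W. f y = f x" using lc[of x] by blast
    have "W \<subseteq> ?S"
    proof
      fix y assume "y \<in> W"
      then have "f y = f x" "y \<in> topspace M" using W openin_subset by blast+
      then show "y \<in> ?S" using x by simp
    qed
    then show "\<exists>T. openin M T \<and> x \<in> T \<and> T \<subseteq> ?S" using W by blast
  qed
  moreover have "openin M (topspace M - ?S)"
  proof (subst openin_subopen, intro ballI)
    fix x assume x: "x \<in> topspace M - ?S"
    then obtain W where W: "openin M W" "x \<in> W" "\<forall>y\<in>W. f y = f x" using lc[of x] by blast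
    have "W \<subseteq> topspace M - ?S"
    proof
      fix y assume "y \<in> W"
      then have "f y = f x" "y \<in> topspace M" using W openin_subset by blast+
      then show "y \<in> topspace M - ?S" using x by simp
    qed
    then show "\<exists>T. openin M T \<and> x \<in> T \<and> T \<subseteq> topspace M - ?S" using W by blast
  qed
  then have "closedin M ?S" by (auto simp: closedin_def)
  moreover have "connected_space M" using mfd by (simp add: smooth_manifold_def)
  ultimately have "?S = {} \<or> ?S = topspace M"
    by (meson connected_space_clopen_in)
  then show ?thesis using assms(3,4) by blast
qed

end

context riem_cart
begin

section \<open>Sign changes and constant rescalings\<close>

lemma cd_uminus:
  assumes S: "endo S" and T: "endo T" and p: "p \<in> topspace M"
    and eq: "\<And>q v. q \<in> topspace M \<Longrightarrow> S q v = - T q v"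
  shows "cd S p u v = - cd T p u v"
proof -
  obtain U X Y Z where v: "vf U X" "vf U Y" "vf U Z" "p \<in> U" and at: "X p = u" "Y p = v" "Z p = v"
    using frame_at[OF p] by metis
  have "nab X (\<lambda>q. S q (Y q)) p = nab X (\<lambda>q. - T q (Y q)) p"
    by (rule nab_cong[OF v(1) vf_minus[OF endo_vf[OF T v(2)]] v(4)]) (simp_all add: eq vf_in[OF v(1)])
  also have "\<dots> = - nab X (\<lambda>q. T q (Y q)) p"
    by (rule nab_uminus[OF v(1) endo_vf[OF T v(2)] v(4)])
  finally show ?thesis
    using nab_endo[OF S v(1,2,4)] nab_endo[OF T v(1,2,4)] at eq[OF p]
    by (simp add: add_eq_0_iff)
qed

lemma d2_scale:
  assumes S: "endo S" and v: "vf U X" "vf U Y" "vf U Z" "p \<in> U"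
    and eq: "\<And>q u v. q \<in> topspace M \<Longrightarrow> \<omega> q u v = r * fundamental_form g S q u v"
  shows "d2 A \<omega> X Y Z p = r * d2 A (fundamental_form g S) X Y Z p"
proof -
  note U = vf_open[OF v(1)]
  have s: "sf U (\<lambda>q. fundamental_form g S q (P q) (Q q))" if "vf U P" "vf U Q" for P Q
    unfolding fundamental_form_def by (rule sf_g[OF endo_vf[OF S that(1)] that(2)])
  have "D (\<lambda>q. \<omega> q (P q) (Q q)) p w = r * D (\<lambda>q. fundamental_form g S q (P q) (Q q)) p w"
    if "vf U P" "vf U Q" for P Q w
  proof -
    have "D (\<lambda>q. \<omega> q (P q) (Q q)) p w = D (\<lambda>q. r * fundamental_form g S q (P q) (Q q)) p w"
      by (rule D_cong[OF U sf_mult[OF U sf_const s[OF that]] v(4)]) (simp add: eq vf_in[OF v(1)])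
    also have "\<dots> = r * D (\<lambda>q. fundamental_form g S q (P q) (Q q)) p w"
      by (rule D_cmult[OF U s[OF that] v(4)])
    finally show ?thesis .
  qed
  then show ?thesis
    using v eq[OF vf_in[OF v(1,4)]] by (simp add: d2_def algebra_simps)
qed

lemma d1_scale:
  assumes \<eta>: "one_form M A \<eta>" and v: "vf U X" "vf U Y" "p \<in> U"
  shows "d1 A (\<lambda>q u. r * \<eta> q u) X Y p = r * d1 A \<eta> X Y p"
proof -
  have "sf U (\<lambda>q. \<eta> q (Z q))" if "vf U Z" for Z using \<eta> that unfolding one_form_def by blast
  then show ?thesis
    using v D_cmult[OF vf_open[OF v(1)] _ v(3)] by (simp add: d1_def algebra_simps)
qed

lemma riemannian_metric_scale: "k > 0 \<Longrightarrow> riemannian_metric M A (\<lambda>p u v. k * g p u v)"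
  unfolding riemannian_metric_def
proof (intro conjI ballI allI impI; (elim conjE)?)
  fix p assume k: "k > 0" and p: "p \<in> topspace M"
  show "bilinear (\<lambda>u v. k * g p u v)"
    using p by (auto simp: bilinear_def algebra_simps intro!: linearI)
  show "k * g p u v = k * g p v u" for u v using g_sym[OF p] by simp
  show "k * g p v v > 0" if "v \<noteq> 0" for v using g_pos[OF p that] k by simp
next
  fix U X Y assume "vf U X" "vf U Y"
  then show "sf U (\<lambda>p. k * g p (X p) (Y p))"
    by (intro sf_mult[OF _ sf_const] sf_g vf_open)
qed

text \<open>The defining predicates of the two connections are equivalent, so the two
  \<open>SOME\<close> choices are the same function, also on arguments that are not vector
  fields.\<close>

lemma levi_civita_scale:
  assumes "k > 0"
  shows "levi_civita M A (\<lambda>p u v. k * g p u v) = levi_civita M A g"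
proof -
  have "is_levi_civita M A (\<lambda>p u v. k * g p u v) N \<longleftrightarrow> is_levi_civita M A g N" for N
  proof -
    have "D (\<lambda>q. k * g q (Y q) (Z q)) p w = k * a + k * b \<longleftrightarrow> D (\<lambda>q. g q (Y q) (Z q)) p w = a + b"
      if "vf U X \<and> vf U Y \<and> vf U Z" "p \<in> U" for U X Y Z p w a b
    proof -
      have "D (\<lambda>q. k * g q (Y q) (Z q)) p w = k * D (\<lambda>q. g q (Y q) (Z q)) p w"
        using that by (intro D_cmult[OF vf_open _ that(2)] sf_g) auto
      then show ?thesis using assms by (simp flip: distrib_left)
    qed
    then show ?thesis unfolding is_levi_civita_def by (simp cong: conj_cong imp_cong ball_cong)
  qed
  then show ?thesis by (simp add: levi_civita_def)
qed

end

locale acm_mfd = smooth_mfd M A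
  for M :: "'a topology" and A :: "('a, real ^ 5) chart set" +
  fixes \<phi> \<xi> \<eta> g
  assumes acm: "almost_contact_metric M A \<phi> \<xi> \<eta> g"
begin

sublocale riem_cart M A g
  using acm by unfold_locales (simp add: almost_contact_metric_def)

lemma endo_phi: "endo \<phi>" and vf_xi: "vf (topspace M) \<xi>" and one_form_eta: "one_form M A \<eta>"
  using acm by (auto simp: almost_contact_metric_def)

lemma eta_eq: "p \<in> topspace M \<Longrightarrow> \<eta> p v = g p (\<xi> p) v"
  using acm endo_linear[OF endo_phi] one_form_eta g_bilinear
  by (intro acm_eta_dual[of "g p" "\<phi> p" "\<eta> p" "\<xi> p"]) (auto simp: almost_contact_metric_def one_form_def)

lemma acm_point:
  assumes p: "p \<in> topspace M"
  shows "acm_alg (g p) (\<phi> p) (\<xi> p)"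
proof unfold_locales
  have *: "(\<forall>v. \<phi> p (\<phi> p v) = - v + \<eta> p v *\<^sub>R \<xi> p) \<and> \<eta> p (\<xi> p) = 1 \<and>
      (\<forall>u v. g p (\<phi> p u) (\<phi> p v) = g p u v - \<eta> p u * \<eta> p v)"
    using acm p unfolding almost_contact_metric_def by blast
  show "\<phi> p (\<phi> p v) = - v + g p (\<xi> p) v *\<^sub>R \<xi> p" "g p (\<xi> p) (\<xi> p) = 1"
    "g p (\<phi> p u) (\<phi> p v) = g p u v - g p (\<xi> p) u * g p (\<xi> p) v" for u v
    using * unfolding eta_eq[OF p] by blast+
  show "g p u v = g p v u" for u v by (rule g_sym[OF p])
qed (simp_all add: p g_bilinear g_pos endo_add[OF endo_phi] endo_scale[OF endo_phi])

lemma phi_skew_at: "p \<in> topspace M \<Longrightarrow> g p (\<phi> p u) v = - g p u (\<phi> p v)"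
  using acm_alg.phi_skew[OF acm_point] .

lemma vf_xi_sub: "vf U X \<Longrightarrow> vf U \<xi>"
  using vf_subset[OF vf_xi vf_open] openin_subset[OF vf_open] by blast

lemma acm_rescale:
  assumes "r > 0"
  shows "almost_contact_metric M A \<phi> (\<lambda>p. (1 / r) *\<^sub>R \<xi> p) (\<lambda>p v. r * \<eta> p v) (\<lambda>p u v. r\<^sup>2 * g p u v)"
proof -
  have "one_form M A (\<lambda>p v. r * \<eta> p v)"
    unfolding one_form_def
  proof (intro conjI ballI allI impI)
    show "linear (\<lambda>v. r * \<eta> p v)" if "p \<in> topspace M" for p
      using one_form_eta that unfolding one_form_def
      by (intro linearI) (simp_all add: linear_add linear_scale algebra_simps)
    show "sf U (\<lambda>p. r * \<eta> p (X p))" if "vf U X" for U X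
      using one_form_eta that sf_mult[OF vf_open[OF that] sf_const] unfolding one_form_def by blast
  qed
  moreover have "\<phi> p (\<phi> p v) = - v + (r * \<eta> p v) *\<^sub>R (1 / r) *\<^sub>R \<xi> p" "r * \<eta> p ((1 / r) *\<^sub>R \<xi> p) = 1"
    "r\<^sup>2 * g p (\<phi> p u) (\<phi> p v) = r\<^sup>2 * g p u v - (r * \<eta> p u) * (r * \<eta> p v)"
    if p: "p \<in> topspace M" for p u v
  proof -
    show "\<phi> p (\<phi> p v) = - v + (r * \<eta> p v) *\<^sub>R (1 / r) *\<^sub>R \<xi> p"
      using acm_alg.sq[OF acm_point[OF p]] eta_eq[OF p] assms by simp
    show "r * \<eta> p ((1 / r) *\<^sub>R \<xi> p) = 1"
      using acm_alg.unit[OF acm_point[OF p]] eta_eq[OF p] p assms by simp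
    show "r\<^sup>2 * g p (\<phi> p u) (\<phi> p v) = r\<^sup>2 * g p u v - (r * \<eta> p u) * (r * \<eta> p v)"
      unfolding eta_eq[OF p] acm_alg.compat[OF acm_point[OF p]] by (simp add: algebra_simps power2_eq_square)
  qed
  ultimately show ?thesis
    using endo_phi riemannian_metric_scale[of "r\<^sup>2"] assms vf_cscale[OF vf_xi]
    by (auto simp: almost_contact_metric_def)
qed

text \<open>The consequences of the almost contact metric axioms alone that both pointwise models
  share.\<close>

lemma cd_phi_facts:
  assumes p: "p \<in> topspace M"
  shows "bilinear (cd \<phi> p)" "g p (cd \<phi> p u v) w = - g p v (cd \<phi> p u w)"
    "cd \<phi> p u (\<xi> p) = - \<phi> p (gradv \<xi> p u)"
    "cd \<phi> p u (\<phi> p v) + \<phi> p (cd \<phi> p u v) = g p (gradv \<xi> p u) v *\<^sub>R \<xi> p + g p (\<xi> p) v *\<^sub>R gradv \<xi> p u"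
    "linear (gradv \<xi> p)" "g p (\<xi> p) (gradv \<xi> p u) = 0"
proof -
  show "bilinear (cd \<phi> p)" by (rule cd_tensor(1)[OF endo_phi p])
  show "g p (cd \<phi> p u v) w = - g p v (cd \<phi> p u w)"
    by (rule cd_skew[OF endo_phi _ p]) (rule phi_skew_at)
  show "cd \<phi> p u (\<xi> p) = - \<phi> p (gradv \<xi> p u)"
    by (rule cd_vector[OF endo_phi vf_xi _ p]) (rule acm_alg.phi_xi[OF acm_point])
  show "cd \<phi> p u (\<phi> p v) + \<phi> p (cd \<phi> p u v) = g p (gradv \<xi> p u) v *\<^sub>R \<xi> p + g p (\<xi> p) v *\<^sub>R gradv \<xi> p u"
    by (rule cd_square[OF endo_phi vf_xi p]) (rule acm_alg.sq[OF acm_point])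
  show "linear (gradv \<xi> p)" by (rule gradv_tensor(1)[OF vf_xi p])
  show "g p (\<xi> p) (gradv \<xi> p u) = 0"
    by (rule gradv_unit[OF vf_xi _ p]) (rule acm_alg.unit[OF acm_point])
qed

lemma d1_eta: "vf U X \<Longrightarrow> vf U Y \<Longrightarrow> p \<in> U \<Longrightarrow>
    d1 A \<eta> X Y p = g p (gradv \<xi> p (X p)) (Y p) - g p (gradv \<xi> p (Y p)) (X p)"
  by (rule d1_eq[OF vf_xi eta_eq])

end

section \<open>From nearly cosymplectic to Sasaki-Einstein\<close>

locale nc_mfd = acm_mfd M A \<phi> \<xi> \<eta> g
  for M :: "'a topology" and A :: "('a, real ^ 5) chart set" and \<phi> \<xi> \<eta> g +
  assumes nc: "nearly_cosymplectic M A \<phi> \<xi> \<eta> g"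
begin

abbreviation "h \<equiv> gradv \<xi>"

lemma nc_point:
  assumes p: "p \<in> topspace M"
  shows "nc_alg (g p) (\<phi> p) (\<xi> p) (cd \<phi> p) (h p)"
proof -
  interpret acm_alg "g p" "\<phi> p" "\<xi> p" by (rule acm_point[OF p])
  have "cd \<phi> p u v + cd \<phi> p v u = 0" for u v
  proof -
    obtain U X Y Z where v: "vf U X" "vf U Y" "vf U Z" "p \<in> U" and at: "X p = u" "Y p = v" "Z p = v"
      using frame_at[OF p] by metis
    have "cov_deriv_endo M A g \<phi> X Y p + cov_deriv_endo M A g \<phi> Y X p = 0"
      using nc v unfolding nearly_cosymplectic_def by blast
    then show ?thesis
      using cd_tensor(2)[OF endo_phi p] v at by simp
  qed
  then have alt: "cd \<phi> p u v = - cd \<phi> p v u" for u v by (simp add: eq_neg_iff_add_eq_0)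
  show ?thesis
    by (intro nc_alg.intro nc_alg_axioms.intro acm_point[OF p]) (fact alt cd_phi_facts[OF p])+
qed

lemma endo_h: "endo h"
  by (rule endo_gradv[OF vf_xi])

lemma h_skew: "p \<in> topspace M \<Longrightarrow> g p (h p u) v = - g p u (h p v)"
  by (rule nc_alg.B_skew[OF nc_point])

lemma d1_eta_h: "vf U X \<Longrightarrow> vf U Y \<Longrightarrow> p \<in> U \<Longrightarrow> d1 A \<eta> X Y p = 2 * fundamental_form g h p (X p) (Y p)"
  using d1_eta[of U X Y p] h_skew[OF vf_in[of U X p], of "Y p" "X p"] g_sym[OF vf_in[of U X p], of "Y p" "h p (X p)"]
  by (simp add: fundamental_form_def)

text \<open>The closedness law is d(d\<eta>) = 0 on coordinate fields, and the anticommutation law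
  compares the derivatives of \<phi>h and -h\<phi>.\<close>

lemma nc2_point:
  assumes p: "p \<in> topspace M"
  shows "nc_alg2 (g p) (\<phi> p) (\<xi> p) (cd \<phi> p) (h p) (cd h p)"
proof -
  interpret nc_alg "g p" "\<phi> p" "\<xi> p" "cd \<phi> p" "h p" by (rule nc_point[OF p])
  note c = chart_at_in[OF p]
  have closed: "g p (cd h p u v) w + g p (cd h p v w) u + g p (cd h p w u) v = 0" for u v w
  proof -
    let ?E = "E (chart_at A p)"
    note v = vf_E[OF c(1), of u] vf_E[OF c(1), of v] vf_E[OF c(1), of w]
    have "d2 A (fundamental_form g h) (?E u) (?E v) (?E w) p = 0"
      by (rule dd1_zero[OF one_form_eta endo_h _ d1_eta_h c]) auto
    moreover have "d2 A (fundamental_form g h) (?E u) (?E v) (?E w) p =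
        g p (cd h p (?E u p) (?E v p)) (?E w p) + g p (cd h p (?E v p) (?E w p)) (?E u p) + g p (cd h p (?E w p) (?E u p)) (?E v p)"
      by (rule d2_eq[OF endo_h _ v c(2)]) (rule h_skew)
    ultimately show ?thesis using p by simp
  qed
  have "cd (\<lambda>q v. \<phi> q (h q v)) p u v = - cd (\<lambda>q v. h q (\<phi> q v)) p u v" for u v
    by (rule cd_uminus[OF endo_compose[OF endo_phi endo_h] endo_compose[OF endo_h endo_phi] p])
      (simp add: nc_alg.B_phi[OF nc_point])
  then have anti: "cd \<phi> p u (h p v) + \<phi> p (cd h p u v) + (cd h p u (\<phi> p v) + h p (cd \<phi> p u v)) = 0" for u v
    unfolding cd_compose[OF endo_phi endo_h p] cd_compose[OF endo_h endo_phi p] by simp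
  show ?thesis
  proof (intro nc_alg2.intro nc_alg2_axioms.intro nc_point[OF p])
    show "bilinear (cd h p)" by (rule cd_tensor(1)[OF endo_h p])
    show "g p (cd h p u v) w = - g p v (cd h p u w)" for u v w
      by (rule cd_skew[OF endo_h _ p]) (rule h_skew)
    show "cd h p u (\<xi> p) = - h p (h p u)" for u
      by (rule cd_vector[OF endo_h vf_xi _ p]) (rule nc_alg.B_xi[OF nc_point])
  qed (fact anti closed)+
qed

lemma d2_Phi:
  assumes "vf U X" "vf U Y" "vf U Z" "p \<in> U"
  shows "d2 A (fundamental_form g \<phi>) X Y Z p =
    3 * wedge12 (\<eta> p) (fundamental_form g (\<lambda>q v. \<phi> q (h q v)) p) (X p) (Y p) (Z p)"
  using d2_eq[OF endo_phi phi_skew_at assms] nc_alg.cyc_P[OF nc_point[OF vf_in[OF assms(1,4)]]]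
    eta_eq[OF vf_in[OF assms(1,4)]]
  by (simp add: fundamental_form_def[abs_def] wedge12_def)

lemma d2_Omega:
  assumes "vf U X" "vf U Y" "vf U Z" "p \<in> U"
  shows "d2 A (fundamental_form g (\<lambda>q v. \<phi> q (h q v))) X Y Z p =
    3 * wedge12 (\<eta> p) (fundamental_form g (\<lambda>q v. \<phi> q (h q (h q v))) p) (X p) (Y p) (Z p)"
proof -
  note p = vf_in[OF assms(1,4)]
  have skew: "g q (\<phi> q (h q u)) v = - g q u (\<phi> q (h q v))" if "q \<in> topspace M" for q u v
    using nc_alg.phiB_skew[OF nc_point[OF that], of u v] g_sym[OF that] by simp
  show ?thesis
    using d2_eq[OF endo_compose[OF endo_phi endo_h] skew assms] nc_alg2.cyc_PQ[OF nc2_point[OF p]] eta_eq[OF p]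
    by (simp add: cd_compose[OF endo_phi endo_h p] fundamental_form_def[abs_def] wedge12_def)
qed

section \<open>Smoothness and constancy of \<mu>\<close>

definition \<mu> :: "'a \<Rightarrow> real" where
  "\<mu> p = (SOME m. \<forall>v. h p (h p v) = - m *\<^sub>R (v - g p (\<xi> p) v *\<^sub>R \<xi> p))"

lemma h_square: "p \<in> topspace M \<Longrightarrow> h p (h p v) = - \<mu> p *\<^sub>R (v - g p (\<xi> p) v *\<^sub>R \<xi> p)"
  using someI_ex[OF nc_alg.B_square[OF nc_point]] unfolding \<mu>_def by blast

lemma h_norm:
  assumes p: "p \<in> topspace M"
  shows "g p (h p u) (h p v) = \<mu> p * (g p u v - g p (\<xi> p) u * g p (\<xi> p) v)"
  using h_skew[OF p, of u "h p v"] h_square[OF p, of v] g_sym[OF p, of u "\<xi> p"] p by simp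

lemma Theta_eq: "p \<in> topspace M \<Longrightarrow>
    fundamental_form g (\<lambda>q v. \<phi> q (h q (h q v))) p u v = - \<mu> p * fundamental_form g \<phi> p u v"
  using acm_alg.phi_simps[OF acm_point] acm_alg.phi_xi[OF acm_point] h_square
  by (simp add: fundamental_form_def)

text \<open>\<open>\<mu>\<close> is chosen point by point, so smoothness needs a formula: near
  \<open>p\<close> it is the squared length of hX divided by that of the horizontal part of X, for a
  coordinate field X that equals \<open>e\<close> at \<open>p\<close>. \<open>U\<close> is where the
  denominator is nonzero.\<close>

lemma mu_smooth_at:
  assumes p: "p \<in> topspace M" and c: "c \<in> A" "p \<in> chart_dom c" and e: "g p (\<xi> p) e = 0" "e \<noteq> 0"
  defines "U \<equiv> {q \<in> chart_dom c. g q (E c (D (chart_map c) p e) q) (E c (D (chart_map c) p e) q)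
      - g q (\<xi> q) (E c (D (chart_map c) p e) q) * g q (\<xi> q) (E c (D (chart_map c) p e) q) \<noteq> 0}"
  shows "openin M U" "p \<in> U" "U \<subseteq> chart_dom c" "sf U \<mu>"
proof -
  let ?X = "E c (D (chart_map c) p e)"
  let ?N = "\<lambda>q. g q (?X q) (?X q) - g q (\<xi> q) (?X q) * g q (\<xi> q) (?X q)"
  note V = chart_open[OF c(1)]
  have X: "vf (chart_dom c) ?X" by (rule vf_E[OF c(1)])
  have N: "sf (chart_dom c) ?N"
    by (intro sf_diff sf_mult V sf_g X vf_xi_sub[OF X])
  have Xp: "?X p = e" by (rule E_D_chart[OF c])
  have "?N p \<noteq> 0" using g_pos[OF p e(2)] e(1) Xp by simp
  then show "p \<in> U" using c by (simp add: U_def)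
  show U: "openin M U" unfolding U_def by (rule open_nonzero[OF c(1) N])
  show sub: "U \<subseteq> chart_dom c" by (auto simp: U_def)
  have "sf U (\<lambda>q. g q (h q (?X q)) (h q (?X q)) / ?N q)"
    by (rule sf_divide[OF U]) (use N sub U X in \<open>auto simp: U_def intro!: sf_g endo_vf[OF endo_h] vf_subset[OF X] intro: sf_subset\<close>)
  then show "sf U \<mu>"
  proof (rule sf_cong[OF U, rotated])
    fix q assume "q \<in> U"
    then have "q \<in> topspace M" "?N q \<noteq> 0" using chart_subset[OF c(1)] by (auto simp: U_def)
    then show "g q (h q (?X q)) (h q (?X q)) / ?N q = \<mu> q"
      using h_norm[of q "?X q" "?X q"] by simp
  qed
qed

lemma mu_smooth: "sf (topspace M) \<mu>"
proof (rule sf_local)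
  fix p assume p: "p \<in> topspace M"
  obtain e where e: "g p (\<xi> p) e = 0" "e \<noteq> 0" using acm_alg.exists_horizontal[OF acm_point[OF p]] by blast
  show "\<exists>V. openin M V \<and> p \<in> V \<and> sf V \<mu>"
    by (intro exI conjI) (rule mu_smooth_at(1,2,4)[OF p chart_at_in[OF p] e])+
qed

text \<open>Differentiates \<open>h_norm\<close> along \<xi>. As h is parallel in that direction,
  both sides change in the same way and nothing is left for \<mu>.\<close>

lemma D_mu_xi:
  assumes p: "p \<in> topspace M"
  shows "D \<mu> p (\<xi> p) = 0"
proof -
  interpret nc_alg2 "g p" "\<phi> p" "\<xi> p" "cd \<phi> p" "h p" "cd h p" by (rule nc2_point[OF p])
  obtain e where e: "g p (\<xi> p) e = 0" "g p e e = 1" using exists_horizontal by blast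
  obtain U X Y Z where v: "vf U X" "vf U Y" "vf U Z" "p \<in> U" and at: "X p = e" "Y p = e" "Z p = e"
    using frame_at[OF p] by metis
  note U = vf_open[OF v(1)] and \<xi> = vf_xi_sub[OF v(1)]
  have mu: "sf U \<mu>" using sf_subset[OF mu_smooth] openin_subset[OF U] by blast
  have sN: "sf U (\<lambda>q. g q (X q) (X q))" "sf U (\<lambda>q. g q (\<xi> q) (X q))" by (intro sf_g v \<xi>)+
  let ?N = "\<lambda>q. g q (X q) (X q) - g q (\<xi> q) (X q) * g q (\<xi> q) (X q)"
  have N: "sf U ?N" by (intro sf_diff sf_mult U sN)
  note hX = endo_vf[OF endo_h v(1)]
  let ?Y = "nab \<xi> X p"
  have dN: "D (\<lambda>q. g q (X q) (X q)) p (\<xi> p) = 2 * g p ?Y e"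
    using nab_metric[OF \<xi> v(1,1,4)] at sym[of e ?Y] by simp
  have "D (\<lambda>q. g q (h q (X q)) (h q (X q))) p (\<xi> p) = 2 * g p (nab \<xi> (\<lambda>q. h q (X q)) p) (h p e)"
    using nab_metric[OF \<xi> hX hX v(4)] at sym[of "h p e" "nab \<xi> (\<lambda>q. h q (X q)) p"] by simp
  \<comment> \<open>The derivative of h itself drops out by \<open>Q_from_xi\<close>.\<close>
  also have "nab \<xi> (\<lambda>q. h q (X q)) p = h p ?Y"
    using nab_endo[OF endo_h \<xi> v(1,4)] by simp
  also have "2 * g p (h p ?Y) (h p e) = \<mu> p * (2 * g p ?Y e)"
    using h_norm[OF p, of ?Y e] e by simp
  finally have 1: "D (\<lambda>q. g q (h q (X q)) (h q (X q))) p (\<xi> p) = \<mu> p * (2 * g p ?Y e)" .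
  have "D (\<lambda>q. g q (h q (X q)) (h q (X q))) p (\<xi> p) = D (\<lambda>q. \<mu> q * ?N q) p (\<xi> p)"
    by (rule D_cong[OF U sf_mult[OF U mu N] v(4)]) (simp add: h_norm vf_in[OF v(1)])
  also have "\<dots> = \<mu> p * D ?N p (\<xi> p) + D \<mu> p (\<xi> p) * ?N p"
    by (rule D_mult[OF U mu N v(4)])
  also have "D ?N p (\<xi> p) = D (\<lambda>q. g q (X q) (X q)) p (\<xi> p) - D (\<lambda>q. g q (\<xi> q) (X q) * g q (\<xi> q) (X q)) p (\<xi> p)"
    by (rule D_diff[OF U sN(1) sf_mult[OF U sN(2) sN(2)] v(4)])
  also have "D (\<lambda>q. g q (\<xi> q) (X q) * g q (\<xi> q) (X q)) p (\<xi> p) = 0"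
    using D_mult[OF U sN(2) sN(2) v(4)] at e by simp
  finally show ?thesis using 1 dN at e by simp
qed

text \<open>Inserting \<open>\<xi>\<close> into \<open>d(\<eta> \<and> \<Theta>) = 0\<close> with \<open>\<Theta> = -\<mu> \<Phi>\<close> leaves \<open>d\<mu> \<and> \<Phi> = 0\<close> on horizontal vectors.\<close>

lemma D_mu_horizontal:
  assumes p: "p \<in> topspace M" and b: "g p (\<xi> p) b = 0" "b \<noteq> 0"
  shows "D \<mu> p b = 0"
proof -
  interpret nc_alg2 "g p" "\<phi> p" "\<xi> p" "cd \<phi> p" "h p" "cd h p" by (rule nc2_point[OF p])
  define c where "c = chart_at A p"
  have c: "c \<in> A" "p \<in> chart_dom c" using chart_at_in[OF p] by (auto simp: c_def)
  obtain x where x: "x \<noteq> 0" "g p (\<xi> p) x = 0" "g p b x = 0" "g p (\<phi> p b) x = 0"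
    using exists_second[OF b(2,1)] by blast
  define y where "y = \<phi> p x"
  note U = chart_open[OF c(1)] and E = vf_E[OF c(1)]
  have mu: "sf (chart_dom c) \<mu>" using sf_subset[OF mu_smooth] chart_subset[OF c(1)] by blast
  let ?\<Phi> = "fundamental_form g \<phi>" and ?\<Omega> = "fundamental_form g (\<lambda>q v. \<phi> q (h q v))"
    and ?\<Theta> = "fundamental_form g (\<lambda>q v. \<phi> q (h q (h q v)))"
  have skew: "g q (\<phi> q (h q (h q u))) v = - g q u (\<phi> q (h q (h q v)))" if "q \<in> topspace M" for q u v
    using Theta_eq[OF that, of u v] Theta_eq[OF that, of v u] phi_skew_at[OF that, of u v] g_sym[OF that, of u]
    by (simp add: fundamental_form_def)
  let ?n = "\<lambda>u v. d1 A \<eta> (E (chart_at A p) u) (E (chart_at A p) v) p"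
    and ?t = "\<lambda>u v w. d2 A ?\<Theta> (E (chart_at A p) u) (E (chart_at A p) v) (E (chart_at A p) w) p"
  let ?a = "\<xi> p"
  have "?n ?a b * ?\<Theta> p x y - ?n ?a x * ?\<Theta> p b y + ?n ?a y * ?\<Theta> p b x
      + ?n b x * ?\<Theta> p ?a y - ?n b y * ?\<Theta> p ?a x + ?n x y * ?\<Theta> p ?a b
      = \<eta> p ?a * ?t b x y - \<eta> p b * ?t ?a x y + \<eta> p x * ?t ?a b y - \<eta> p y * ?t ?a b x"
  proof (rule dd2_zero[OF one_form_eta endo_compose[OF endo_phi endo_h] endo_compose[OF endo_phi endo_compose[OF endo_h endo_h]] _ _ _ p])
    show "(3::real) \<noteq> 0" by simp
  qed (fact d2_Omega skew)+
  moreover have "?n u v = 2 * g p (h p u) v" for u v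
    using d1_eta_h[OF E E c(2), of u v] p by (simp add: fundamental_form_def c_def)
  \<comment> \<open>Every product on the left contains d\<eta> or \<Theta> with \<xi> in a slot,
    which vanishes because h\<xi> = 0; on the right only the coefficient
    \<open>\<eta> p (\<xi> p) = 1\<close> survives.\<close>
  ultimately have "d2 A ?\<Theta> (E c b) (E c x) (E c y) p = 0"
    using eta_eq[OF p] b x p by (simp add: fundamental_form_def y_def c_def)
  moreover have "d2 A ?\<Phi> (E c b) (E c x) (E c y) p = 0"
    using d2_Phi[OF E E E c(2), of b x y] eta_eq[OF p] b x p by (simp add: wedge12_def y_def c_def)
  moreover have D\<Theta>: "D (\<lambda>q. ?\<Theta> q (E c s q) (E c t q)) p w =
      - (\<mu> p * D (\<lambda>q. ?\<Phi> q (E c s q) (E c t q)) p w + D \<mu> p w * ?\<Phi> p s t)" for s t w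
  proof -
    have s: "sf (chart_dom c) (\<lambda>q. ?\<Phi> q (E c s q) (E c t q))"
      unfolding fundamental_form_def by (rule sf_g[OF endo_vf[OF endo_phi E] E])
    have "D (\<lambda>q. ?\<Theta> q (E c s q) (E c t q)) p w = D (\<lambda>q. - (\<mu> q * ?\<Phi> q (E c s q) (E c t q))) p w"
      by (rule D_cong[OF U sf_minus[OF U sf_mult[OF U mu s]] c(2)])
        (use Theta_eq chart_subset[OF c(1)] in auto)
    then show ?thesis
      using D_minus[OF U sf_mult[OF U mu s] c(2)] D_mult[OF U mu s c(2)] p by (simp add: c_def)
  qed
  have zero: "?\<Theta> p 0 v = 0" "?\<Phi> p 0 v = 0" for v by (simp_all add: fundamental_form_def)
  have Ep: "E c v p = v" for v using p by (simp add: c_def)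
  \<comment> \<open>d\<Theta> and d\<Phi> both vanish on these vectors, and d\<Theta> + \<mu>
    d\<Phi> = - d\<mu> \<and> \<Phi>. The choice \<open>y = \<phi> p x\<close> with \<open>x\<close>
    orthogonal to \<open>b\<close> and \<open>\<phi> p b\<close> isolates the coefficient of the
    derivative along \<open>b\<close>.\<close>
  ultimately have "D \<mu> p b * ?\<Phi> p x y - D \<mu> p x * ?\<Phi> p b y + D \<mu> p y * ?\<Phi> p b x = 0"
    unfolding d2_def D\<Theta> LB_E[OF c] zero Ep by algebra
  moreover have "?\<Phi> p x y = g p x x" "?\<Phi> p b y = 0" "?\<Phi> p b x = 0"
    using compat[of x x] compat[of b x] x b by (simp_all add: fundamental_form_def y_def)
  ultimately show ?thesis using x by simp
qed

lemma mu_constant: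
  assumes "p \<in> topspace M" "q \<in> topspace M"
  shows "\<mu> p = \<mu> q"
proof (rule constant_function[OF mu_smooth _ assms])
  fix p v assume p: "p \<in> topspace M"
  let ?v = "v - g p (\<xi> p) v *\<^sub>R \<xi> p"
  note lin = linear_D[OF openin_topspace mu_smooth p]
  have "g p (\<xi> p) ?v = 0" using acm_alg.unit[OF acm_point[OF p]] p by simp
  then have "D \<mu> p ?v = 0" using D_mu_horizontal[OF p, of ?v] linear_0[OF lin] by (cases "?v = 0") auto
  then show "D \<mu> p v = 0" using D_mu_xi[OF p] linear_diff[OF lin] linear_scale[OF lin] by simp
qed

text \<open>Failure of the coKaehler condition is known at some point only; constancy of \<mu>
  spreads it. If \<mu> vanished at \<open>p\<close>, it would vanish everywhere, so h = 0 and then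
  \<nabla>\<phi> = 0.\<close>

lemma mu_pos:
  assumes "\<not> cokaehler M A \<phi> \<xi> \<eta> g" and p: "p \<in> topspace M"
  shows "\<mu> p > 0"
proof -
  obtain e where e: "g p (\<xi> p) e = 0" "g p e e = 1" "e \<noteq> 0" 
    using acm_alg.exists_horizontal[OF acm_point[OF p]] by blast
  have "\<mu> p = g p (h p e) (h p e)" using h_norm[OF p, of e e] e by simp
  then have "\<mu> p \<ge> 0" using g_pos[OF p, of "h p e"] g_zero[OF p] by (cases "h p e = 0") auto
  moreover have "\<mu> p \<noteq> 0"
  proof
    assume "\<mu> p = 0"
    have "cov_deriv_endo M A g \<phi> X Y q = 0" if "vf U X" "vf U Y" "q \<in> U" for U X Y q
    proof -
      note q = vf_in[OF that(1,3)]
      have "g q (h q v) (h q v) = 0" for v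
        using h_norm[OF q, of v v] mu_constant[OF p q] \<open>\<mu> p = 0\<close> by simp
      then have "h q v = 0" for v using g_pos[OF q, of "h q v"] by force
      then show ?thesis
        using cd_tensor(2)[OF endo_phi q that] nc_alg.B_zero_P_zero[OF nc_point[OF q]] by simp
    qed
    then show False using assms(1) acm unfolding cokaehler_def by blast
  qed
  ultimately show ?thesis by simp
qed

theorem sasaki_einstein_exists:
  assumes "\<not> cokaehler M A \<phi> \<xi> \<eta> g"
  shows "\<exists>\<phi> \<xi> \<eta> g. sasaki_einstein M A \<phi> \<xi> \<eta> g"
proof -
  have "topspace M \<noteq> {}" using mfd unfolding smooth_manifold_def by blast
  then obtain p0 where p0: "p0 \<in> topspace M" by blast
  \<comment> \<open>The scale for which h/l squares to -1 on horizontal vectors.\<close>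
  define l where "l = sqrt (\<mu> p0)"
  have l: "l > 0" using mu_pos[OF assms p0] by (simp add: l_def)
  have mu: "\<mu> p = l\<^sup>2" if "p \<in> topspace M" for p
    using mu_constant[OF that p0] mu_pos[OF assms p0] by (simp add: l_def)
  have hh: "h p (h p v) = - l\<^sup>2 *\<^sub>R (v - g p (\<xi> p) v *\<^sub>R \<xi> p)" if "p \<in> topspace M" for p v
    using h_square[OF that] mu[OF that] by simp
  \<comment> \<open>The sign of \<open>\<psi> 3\<close> turns the factor 2 in d\<eta> into the
    required -2, and \<open>\<psi> 1\<close> is then forced to be the product of
    \<open>\<psi> 2\<close> and \<open>\<psi> 3\<close>.\<close>
  define \<psi> where "\<psi> i = (if i = (1::nat) then \<lambda>p v. (- 1 / l) *\<^sub>R \<phi> p (h p v)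
    else if i = 2 then \<phi> else (\<lambda>p v. (- 1 / l) *\<^sub>R h p v))" for i
  have \<psi>: "\<psi> 1 = (\<lambda>p v. (- 1 / l) *\<^sub>R \<phi> p (h p v))" "\<psi> 2 = \<phi>" "\<psi> 3 = (\<lambda>p v. (- 1 / l) *\<^sub>R h p v)"
    by (simp_all add: \<psi>_def)
  let ?\<xi> = "\<lambda>p. (1 / l) *\<^sub>R \<xi> p" and ?\<eta> = "\<lambda>p v. l * \<eta> p v" and ?g = "\<lambda>p u v. l\<^sup>2 * g p u v"
  note resc = acm_rescale[OF l]
  have endo1: "endo (\<psi> 1)"
    unfolding \<psi> by (rule endo_cscale[OF endo_compose[OF endo_phi endo_h]])
  have endo3: "endo (\<psi> 3)"
    unfolding \<psi> by (rule endo_cscale[OF endo_h])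
  have sq: "\<psi> 1 p (\<psi> 1 p v) = - v + ?\<eta> p v *\<^sub>R ?\<xi> p" "\<psi> 3 p (\<psi> 3 p v) = - v + ?\<eta> p v *\<^sub>R ?\<xi> p"
    "?g p (\<psi> 1 p u) (\<psi> 1 p v) = ?g p u v - ?\<eta> p u * ?\<eta> p v"
    "?g p (\<psi> 3 p u) (\<psi> 3 p v) = ?g p u v - ?\<eta> p u * ?\<eta> p v"
    "\<psi> 1 p (\<phi> p v) = \<psi> 3 p v" "\<phi> p (\<psi> 1 p v) = - \<psi> 3 p v" "\<phi> p (\<psi> 3 p v) = \<psi> 1 p v"
    "\<psi> 3 p (\<phi> p v) = - \<psi> 1 p v" "\<psi> 3 p (\<psi> 1 p v) = \<phi> p v" "\<psi> 1 p (\<psi> 3 p v) = - \<phi> p v"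
    if p: "p \<in> topspace M" for p u v
  proof -
    interpret nc_alg "g p" "\<phi> p" "\<xi> p" "cd \<phi> p" "h p" by (rule nc_point[OF p])
    have ph: "\<phi> p (h p (h p v)) = - l\<^sup>2 *\<^sub>R \<phi> p v" for v by (simp add: hh[OF p])
    have hp: "h p (\<phi> p v) = - \<phi> p (h p v)" for v by (rule B_phi)
    show "\<psi> 1 p (\<psi> 1 p v) = - v + ?\<eta> p v *\<^sub>R ?\<xi> p" "\<psi> 3 p (\<psi> 3 p v) = - v + ?\<eta> p v *\<^sub>R ?\<xi> p"
      unfolding \<psi> using l by (simp_all add: hp hh[OF p] sq[of v] eta_eq[OF p] power2_eq_square scaleR_diff_right)
    show "?g p (\<psi> 1 p u) (\<psi> 1 p v) = ?g p u v - ?\<eta> p u * ?\<eta> p v"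
      "?g p (\<psi> 3 p u) (\<psi> 3 p v) = ?g p u v - ?\<eta> p u * ?\<eta> p v"
      unfolding \<psi> using l h_norm[OF p, of u v] mu[OF p]
      by (simp_all add: compat eta_eq[OF p] power2_eq_square algebra_simps)
    show "\<psi> 1 p (\<phi> p v) = \<psi> 3 p v" "\<phi> p (\<psi> 1 p v) = - \<psi> 3 p v" "\<phi> p (\<psi> 3 p v) = \<psi> 1 p v"
      "\<psi> 3 p (\<phi> p v) = - \<psi> 1 p v" "\<psi> 3 p (\<psi> 1 p v) = \<phi> p v" "\<psi> 1 p (\<psi> 3 p v) = - \<phi> p v"
      unfolding \<psi> using l by (simp_all add: hp ph power2_eq_square)
  qed
  have acm': "almost_contact_metric M A (\<psi> i) ?\<xi> ?\<eta> ?g" if "i \<in> {1, 2, 3}" for i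
    using that resc endo1 endo3 sq \<psi>(2) by (auto simp: almost_contact_metric_def)
  have SU2: "SU2_structure M A \<psi> ?\<xi> ?\<eta> ?g"
    unfolding SU2_structure_def using acm' sq \<psi>(2) by simp
  have \<omega>: "fundamental_form ?g (\<psi> 1) q u v = - l * fundamental_form g (\<lambda>q v. \<phi> q (h q v)) q u v"
    "fundamental_form ?g (\<psi> 2) q u v = l\<^sup>2 * fundamental_form g \<phi> q u v"
    "fundamental_form ?g (\<psi> 3) q u v = - l * fundamental_form g h q u v" if "q \<in> topspace M" for q u v
    unfolding \<psi> using that l by (simp_all add: fundamental_form_def power2_eq_square)
  have "d1 A ?\<eta> X Y p = - 2 * fundamental_form ?g (\<psi> 3) p (X p) (Y p)"
    if "vf U X" "vf U Y" "p \<in> U" for U X Y p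
    using d1_scale[OF one_form_eta that] d1_eta_h[OF that] \<omega>(3)[OF vf_in[OF that(1,3)]] by simp
  moreover have "d2 A (fundamental_form ?g (\<psi> 1)) X Y Z p = 3 * wedge12 (?\<eta> p) (fundamental_form ?g (\<psi> 2) p) (X p) (Y p) (Z p)"
    "d2 A (fundamental_form ?g (\<psi> 2)) X Y Z p = - 3 * wedge12 (?\<eta> p) (fundamental_form ?g (\<psi> 1) p) (X p) (Y p) (Z p)"
    if v: "vf U X" "vf U Y" "vf U Z" "p \<in> U" for U X Y Z p
  proof -
    note p = vf_in[OF v(1,4)]
    have 1: "d2 A (fundamental_form ?g (\<psi> 1)) X Y Z p = - l * d2 A (fundamental_form g (\<lambda>q v. \<phi> q (h q v))) X Y Z p"
      by (rule d2_scale[OF endo_compose[OF endo_phi endo_h] v]) (rule \<omega>(1))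
    have 2: "d2 A (fundamental_form ?g (\<psi> 2)) X Y Z p = l\<^sup>2 * d2 A (fundamental_form g \<phi>) X Y Z p"
      by (rule d2_scale[OF endo_phi v]) (rule \<omega>(2))
    show "d2 A (fundamental_form ?g (\<psi> 1)) X Y Z p = 3 * wedge12 (?\<eta> p) (fundamental_form ?g (\<psi> 2) p) (X p) (Y p) (Z p)"
      unfolding 1 d2_Omega[OF v] wedge12_def \<omega>(2)[OF p] Theta_eq[OF p] mu[OF p]
      by (simp add: algebra_simps)
    show "d2 A (fundamental_form ?g (\<psi> 2)) X Y Z p = - 3 * wedge12 (?\<eta> p) (fundamental_form ?g (\<psi> 1) p) (X p) (Y p) (Z p)"
      unfolding 2 d2_Phi[OF v] wedge12_def \<omega>(1)[OF p]
      by (simp add: power2_eq_square algebra_simps)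
  qed
  ultimately have "sasaki_einstein M A \<psi> ?\<xi> ?\<eta> ?g"
    unfolding sasaki_einstein_def Let_def using SU2 by blast
  then show ?thesis by blast
qed

end

section \<open>From Sasaki-Einstein to nearly cosymplectic\<close>

context smooth_mfd
begin

text \<open>Every tensor of the family depends on \<open>t\<close> only through a factor
  \<open>exp (a * t)\<close>, with \<open>a\<close> equal to 0, 1, -1 and -2 for the endomorphism,
  the vector field, the 1-form and the metric.\<close>

lemma smooth_param_exp:
  fixes F :: "'a \<Rightarrow> 'f::real_normed_vector"
  assumes "openin M U" "sf U F" "\<And>t p. p \<in> U \<Longrightarrow> G t p = exp (a * t) *\<^sub>R F p"
  shows "smooth_param_fun_on A U G"
  unfolding smooth_param_fun_on_def
proof
  fix c assume c: "c \<in> A"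
  let ?V = "chart_map c ` (U \<inter> chart_dom c)"
  have V: "open ?V" by (rule chart_image_open[OF c assms(1)])
  have S: "open (UNIV \<times> ?V :: (real \<times> 'e) set)" using V by (simp add: open_Times)
  have 1: "smooth_on (UNIV \<times> ?V :: (real \<times> 'e) set) (\<lambda>z. exp (a * fst z))"
    by (intro smooth_on_exp S smooth_on_linear linearI) (simp_all add: algebra_simps)
  have 2: "smooth_on (UNIV \<times> ?V :: (real \<times> 'e) set) (\<lambda>z. (F \<circ> chart_inv c) (snd z))"
    by (rule smooth_on_compose[OF S V _ smooth_on_linear sf_chart[OF assms(2) c]])
      (auto intro: linearI)
  show "smooth_on (UNIV \<times> ?V) (\<lambda>(t, y). G t (chart_inv c y))"
    by (rule smooth_on_cong[OF S _ smooth_on_scaleR[OF S 1 2]]) (use c assms(3) in auto)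
qed

end

lemma (in riem_cart) cd_cong:
  assumes S: "endo S" and T: "endo T" and p: "p \<in> topspace M"
    and eq: "\<And>q v. q \<in> topspace M \<Longrightarrow> S q v = T q v"
  shows "cd S p u v = cd T p u v"
proof -
  obtain U X Y Z where v: "vf U X" "vf U Y" "vf U Z" "p \<in> U" and at: "X p = u" "Y p = v" "Z p = v"
    using frame_at[OF p] by metis
  have "nab X (\<lambda>q. S q (Y q)) p = nab X (\<lambda>q. T q (Y q)) p"
    by (rule nab_cong[OF v(1) endo_vf[OF T v(2)] v(4)]) (simp_all add: eq vf_in[OF v(1)])
  then show ?thesis
    using nab_endo[OF S v(1,2,4)] nab_endo[OF T v(1,2,4)] at eq[OF p] by simp
qed

locale se_mfd = riem_cart M A g
  for M :: "'a topology" and A :: "('a, real ^ 5) chart set" and g +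
  fixes \<Phi> :: "nat \<Rightarrow> 'a \<Rightarrow> real ^ 5 \<Rightarrow> real ^ 5" and \<xi> \<eta>
  assumes se: "sasaki_einstein M A \<Phi> \<xi> \<eta> g"
begin

lemma SU2: "SU2_structure M A \<Phi> \<xi> \<eta> g"
  using se by (simp add: sasaki_einstein_def)

sublocale s1: acm_mfd M A "\<Phi> 1" \<xi> \<eta> g
  using SU2 by unfold_locales (auto simp: SU2_structure_def)

sublocale s2: acm_mfd M A "\<Phi> 2" \<xi> \<eta> g
  using SU2 by unfold_locales (auto simp: SU2_structure_def)

sublocale s3: acm_mfd M A "\<Phi> 3" \<xi> \<eta> g
  using SU2 by unfold_locales (auto simp: SU2_structure_def)

lemma quaternion:
  assumes "p \<in> topspace M"
  shows "\<Phi> 1 p (\<Phi> 2 p v) = \<Phi> 3 p v" "\<Phi> 2 p (\<Phi> 1 p v) = - \<Phi> 3 p v" "\<Phi> 2 p (\<Phi> 3 p v) = \<Phi> 1 p v"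
    "\<Phi> 3 p (\<Phi> 2 p v) = - \<Phi> 1 p v" "\<Phi> 3 p (\<Phi> 1 p v) = \<Phi> 2 p v" "\<Phi> 1 p (\<Phi> 3 p v) = - \<Phi> 2 p v"
proof -
  have "\<Phi> 1 p (\<Phi> 2 p v) = \<Phi> 3 p v \<and> \<Phi> 3 p v = - \<Phi> 2 p (\<Phi> 1 p v)"
    "\<Phi> 2 p (\<Phi> 3 p v) = \<Phi> 1 p v \<and> \<Phi> 1 p v = - \<Phi> 3 p (\<Phi> 2 p v)"
    "\<Phi> 3 p (\<Phi> 1 p v) = \<Phi> 2 p v \<and> \<Phi> 2 p v = - \<Phi> 1 p (\<Phi> 3 p v)"
    using SU2 assms unfolding SU2_structure_def by blast+
  then show "\<Phi> 1 p (\<Phi> 2 p v) = \<Phi> 3 p v" "\<Phi> 2 p (\<Phi> 1 p v) = - \<Phi> 3 p v" "\<Phi> 2 p (\<Phi> 3 p v) = \<Phi> 1 p v"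
    "\<Phi> 3 p (\<Phi> 2 p v) = - \<Phi> 1 p v" "\<Phi> 3 p (\<Phi> 1 p v) = \<Phi> 2 p v" "\<Phi> 1 p (\<Phi> 3 p v) = - \<Phi> 2 p v"
    by (metis minus_minus)+
qed

lemma d_eta: "vf U X \<Longrightarrow> vf U Y \<Longrightarrow> p \<in> U \<Longrightarrow>
    d1 A \<eta> X Y p = - 2 * fundamental_form g (\<Phi> 3) p (X p) (Y p)"
  using se unfolding sasaki_einstein_def Let_def by blast

lemma d_omega: "vf U X \<Longrightarrow> vf U Y \<Longrightarrow> vf U Z \<Longrightarrow> p \<in> U \<Longrightarrow>
    d2 A (fundamental_form g (\<Phi> 1)) X Y Z p = 3 * wedge12 (\<eta> p) (fundamental_form g (\<Phi> 2) p) (X p) (Y p) (Z p)"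
  "vf U X \<Longrightarrow> vf U Y \<Longrightarrow> vf U Z \<Longrightarrow> p \<in> U \<Longrightarrow>
    d2 A (fundamental_form g (\<Phi> 2)) X Y Z p = - 3 * wedge12 (\<eta> p) (fundamental_form g (\<Phi> 1) p) (X p) (Y p) (Z p)"
  using se unfolding sasaki_einstein_def Let_def by blast+

lemma torsion_point:
  assumes p: "p \<in> topspace M"
  shows "su2_torsion (g p) (\<Phi> 1 p) (\<Phi> 2 p) (\<Phi> 3 p) (\<xi> p) (cd (\<Phi> 1) p) (cd (\<Phi> 2) p) (cd (\<Phi> 3) p) (gradv \<xi> p)"
proof -
  define c where "c = chart_at A p"
  have c: "c \<in> A" "p \<in> chart_dom c" using chart_at_in[OF p] by (auto simp: c_def)
  note E = vf_E[OF c(1)]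
  have Ep: "E c v p = v" for v using p by (simp add: c_def)
  have comp: "cd (\<Phi> 3) p u v = cd (\<Phi> 1) p u (\<Phi> 2 p v) + \<Phi> 1 p (cd (\<Phi> 2) p u v)" for u v
  proof -
    have "cd (\<Phi> 3) p u v = cd (\<lambda>q v. \<Phi> 1 q (\<Phi> 2 q v)) p u v"
      by (rule cd_cong[OF s3.endo_phi endo_compose[OF s1.endo_phi s2.endo_phi] p]) (rule quaternion(1)[symmetric])
    then show ?thesis using cd_compose[OF s1.endo_phi s2.endo_phi p] by simp
  qed
  have deta: "g p (gradv \<xi> p u) v - g p (gradv \<xi> p v) u = - 2 * g p (\<Phi> 3 p u) v" for u v
    using s3.d1_eta[OF E E c(2), of u v] d_eta[OF E E c(2), of u v] by (simp add: fundamental_form_def Ep)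
  have d2S: "d2 A (fundamental_form g S) (E c u) (E c v) (E c w) p =
      g p (cd S p u v) w + g p (cd S p v w) u + g p (cd S p w u) v"
    if "endo S" "\<And>q u v. q \<in> topspace M \<Longrightarrow> g q (S q u) v = - g q u (S q v)" for S u v w
    using d2_eq[OF that(1) _ E E E c(2), of u v w] that(2) by (simp add: Ep)
  have 1: "g p (cd (\<Phi> 1) p u v) w + g p (cd (\<Phi> 1) p v w) u + g p (cd (\<Phi> 1) p w u) v =
      3 * wedge12 (g p (\<xi> p)) (\<lambda>u v. g p (\<Phi> 2 p u) v) u v w" for u v w
    using d2S[OF s1.endo_phi s1.phi_skew_at, of u v w] d_omega(1)[OF E E E c(2), of u v w]
    by (simp add: Ep wedge12_def fundamental_form_def s1.eta_eq[OF p])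
  have 2: "g p (cd (\<Phi> 2) p u v) w + g p (cd (\<Phi> 2) p v w) u + g p (cd (\<Phi> 2) p w u) v =
      - 3 * wedge12 (g p (\<xi> p)) (\<lambda>u v. g p (\<Phi> 1 p u) v) u v w" for u v w
    using d2S[OF s2.endo_phi s2.phi_skew_at, of u v w] d_omega(2)[OF E E E c(2), of u v w]
    by (simp add: Ep wedge12_def fundamental_form_def s1.eta_eq[OF p])
  have 3: "g p (cd (\<Phi> 3) p u v) w + g p (cd (\<Phi> 3) p v w) u + g p (cd (\<Phi> 3) p w u) v = 0" for u v w
  proof -
    \<comment> \<open>The third form has no structure equation of its own; it is closed because
      d\<eta> is -2 times it.\<close>
    have "d2 A (fundamental_form g (\<Phi> 3)) (E c u) (E c v) (E c w) p = 0"
      by (rule dd1_zero[OF s3.one_form_eta s3.endo_phi _ d_eta c]) auto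
    then show ?thesis using d2S[OF s3.endo_phi s3.phi_skew_at, of u v w] by simp
  qed
  show ?thesis
    by (intro su2_torsion.intro su2_alg.intro su2_alg_axioms.intro su2_torsion_axioms.intro
        s1.acm_point[OF p] s2.acm_point[OF p] s3.acm_point[OF p])
      (fact quaternion[OF p] comp deta 1 2 3 s1.cd_phi_facts[OF p] s2.cd_phi_facts[OF p] s3.cd_phi_facts[OF p])+
qed

lemma cd_Phi2:
  assumes "vf U X" "vf U Y" "p \<in> U"
  shows "cov_deriv_endo M A g (\<Phi> 2) X Y p = g p (\<xi> p) (Y p) *\<^sub>R \<Phi> 1 p (X p)
    - g p (\<xi> p) (X p) *\<^sub>R \<Phi> 1 p (Y p) - g p (\<Phi> 1 p (X p)) (Y p) *\<^sub>R \<xi> p"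
  using cd_tensor(2)[OF s2.endo_phi vf_in[OF assms(1,3)] assms]
    su2_torsion.P2_formula[OF torsion_point[OF vf_in[OF assms(1,3)]]] by simp

lemma cov_deriv_rescale:
  "r > 0 \<Longrightarrow> cov_deriv_endo M A (\<lambda>p u v. r * g p u v) S = cov_deriv_endo M A g S"
  by (simp add: cov_deriv_endo_def[abs_def] levi_civita_scale)

text \<open>A constant rescaling leaves the connection unchanged, so both claims are read off from
  \<open>cd_Phi2\<close>, whose right-hand side is skew in \<open>X\<close> and
  \<open>Y\<close>.\<close>

lemma nearly_cosymplectic_rescale:
  assumes "r > 0"
  shows "nearly_cosymplectic M A (\<Phi> 2) (\<lambda>p. (1 / r) *\<^sub>R \<xi> p) (\<lambda>p v. r * \<eta> p v) (\<lambda>p u v. r\<^sup>2 * g p u v)"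
    and "\<not> cokaehler M A (\<Phi> 2) (\<lambda>p. (1 / r) *\<^sub>R \<xi> p) (\<lambda>p v. r * \<eta> p v) (\<lambda>p u v. r\<^sup>2 * g p u v)"
proof -
  have r2: "r\<^sup>2 > 0" using assms by simp
  have "cov_deriv_endo M A g (\<Phi> 2) X Y p + cov_deriv_endo M A g (\<Phi> 2) Y X p = 0"
    if "vf U X" "vf U Y" "p \<in> U" for U X Y p
    using s1.phi_skew_at[OF vf_in[OF that(1,3)], of "X p" "Y p"] g_sym[OF vf_in[OF that(1,3)], of "X p"]
    unfolding cd_Phi2[OF that] cd_Phi2[OF that(2,1,3)] by simp
  then show "nearly_cosymplectic M A (\<Phi> 2) (\<lambda>p. (1 / r) *\<^sub>R \<xi> p) (\<lambda>p v. r * \<eta> p v) (\<lambda>p u v. r\<^sup>2 * g p u v)"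
    unfolding nearly_cosymplectic_def cov_deriv_rescale[OF r2] using s2.acm_rescale[OF assms] by blast
  have "topspace M \<noteq> {}" using mfd unfolding smooth_manifold_def by blast
  then obtain p where p: "p \<in> topspace M" by blast
  interpret acm_alg "g p" "\<Phi> 1 p" "\<xi> p" by (rule s1.acm_point[OF p])
  obtain e where e: "g p (\<xi> p) e = 0" "g p e e = 1" using exists_horizontal by blast
  note c = chart_at_in[OF p]
  \<comment> \<open>A pair on which only the middle term of \<open>cd_Phi2\<close> survives, with a
    nonzero value.\<close>
  let ?X = "E (chart_at A p) (\<xi> p)" and ?Y = "E (chart_at A p) e"
  have X: "vf (chart_dom (chart_at A p)) ?X" and Y: "vf (chart_dom (chart_at A p)) ?Y"
    by (rule vf_E[OF c(1)])+
  have "\<Phi> 1 p e \<noteq> 0" using compat[of e e] e by auto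
  moreover have "cov_deriv_endo M A g (\<Phi> 2) ?X ?Y p = - \<Phi> 1 p e"
    unfolding cd_Phi2[OF X Y c(2)] E_chart_at[OF p] phi_xi using e by simp
  ultimately have "cov_deriv_endo M A g (\<Phi> 2) ?X ?Y p \<noteq> 0" by simp
  then show "\<not> cokaehler M A (\<Phi> 2) (\<lambda>p. (1 / r) *\<^sub>R \<xi> p) (\<lambda>p v. r * \<eta> p v) (\<lambda>p u v. r\<^sup>2 * g p u v)"
    unfolding cokaehler_def cov_deriv_rescale[OF r2] using X Y c(2) by blast
qed

lemma rescaled_family:
  "one_parameter_family M A (\<lambda>t. \<Phi> 2) (\<lambda>t p. (1 / exp (- t)) *\<^sub>R \<xi> p) (\<lambda>t p v. exp (- t) * \<eta> p v)
    (\<lambda>t p u v. (exp (- t))\<^sup>2 * g p u v)"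
  unfolding one_parameter_family_def
proof (intro conjI allI impI ballI; (elim conjE)?)
  fix U X and c :: "('a, real ^ 5) chart" assume X: "vf U X" and c: "c \<in> A"
  show "smooth_param_fun_on A (U \<inter> chart_dom c) (\<lambda>t p. D (chart_map c) p (\<Phi> 2 p (X p)))"
    by (rule smooth_param_exp[OF openin_Int_chart[OF c vf_open[OF X]] sf_comps[OF endo_vf[OF s2.endo_phi X] c], of _ 0]) simp
next
  fix c :: "('a, real ^ 5) chart" assume c: "c \<in> A"
  have "sf (chart_dom c) (comps c \<xi>)"
    using sf_comps[OF s1.vf_xi c] chart_subset[OF c] by (simp add: Int_absorb1)
  then show "smooth_param_fun_on A (chart_dom c) (\<lambda>t p. D (chart_map c) p ((1 / exp (- t)) *\<^sub>R \<xi> p))"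
    by (rule smooth_param_exp[OF chart_open[OF c], of _ _ 1])
      (use c in \<open>simp add: D_chart_scale exp_minus divide_inverse\<close>)
next
  fix U X assume X: "vf U X"
  have "sf U (\<lambda>p. \<eta> p (X p))" using s1.one_form_eta X unfolding one_form_def by blast
  then show "smooth_param_fun_on A U (\<lambda>t p. exp (- t) * \<eta> p (X p))"
    by (rule smooth_param_exp[OF vf_open[OF X], of _ _ "-1"]) simp
next
  fix U X Y assume X: "vf U X" and Y: "vf U Y"
  show "smooth_param_fun_on A U (\<lambda>t p. (exp (- t))\<^sup>2 * g p (X p) (Y p))"
    by (rule smooth_param_exp[OF vf_open[OF X] sf_g[OF X Y], of _ "-2"])
      (simp add: power2_eq_square flip: exp_add)
next
  fix s t :: real assume st: "s \<noteq> t"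
  have "topspace M \<noteq> {}" using mfd unfolding smooth_manifold_def by blast
  then obtain p where p: "p \<in> topspace M" by blast
  \<comment> \<open>The value of the rescaled 1-form on the fixed vector \<open>\<xi> p\<close> is
    \<open>exp (- t)\<close>, which already separates parameters.\<close>
  have "\<eta> p (\<xi> p) = 1"
    using s1.eta_eq[OF p] acm_alg.unit[OF s1.acm_point[OF p]] by simp
  then have "exp (- s) * \<eta> p (\<xi> p) \<noteq> exp (- t) * \<eta> p (\<xi> p)" using st by simp
  then have "(\<lambda>v. exp (- s) * \<eta> p v) \<noteq> (\<lambda>v. exp (- t) * \<eta> p v)" by metis
  then show "\<exists>p\<in>topspace M.
      (\<Phi> 2 p, (1 / exp (- s)) *\<^sub>R \<xi> p, \<lambda>v. exp (- s) * \<eta> p v, \<lambda>u v. (exp (- s))\<^sup>2 * g p u v) \<noteq>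
      (\<Phi> 2 p, (1 / exp (- t)) *\<^sub>R \<xi> p, \<lambda>v. exp (- t) * \<eta> p v, \<lambda>u v. (exp (- t))\<^sup>2 * g p u v)"
    using p by blast
qed

end

theorem corollary5p3:
  fixes M :: "'a topology" and A :: "('a, real ^ 5) chart set"
  assumes "smooth_manifold M A"
  shows "((\<exists>\<phi> \<xi> \<eta> g. nearly_cosymplectic M A \<phi> \<xi> \<eta> g \<and> \<not> cokaehler M A \<phi> \<xi> \<eta> g) \<longrightarrow>
            (\<exists>\<phi> \<xi> \<eta> g. sasaki_einstein M A \<phi> \<xi> \<eta> g)) \<and>
         ((\<exists>\<phi> \<xi> \<eta> g. sasaki_einstein M A \<phi> \<xi> \<eta> g) \<longrightarrow>
            (\<exists>\<phi> \<xi> \<eta> g. one_parameter_family M A \<phi> \<xi> \<eta> g \<and>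
               (\<forall>t. nearly_cosymplectic M A (\<phi> t) (\<xi> t) (\<eta> t) (g t) \<and>
                    \<not> cokaehler M A (\<phi> t) (\<xi> t) (\<eta> t) (g t))))"
proof (intro conjI impI; elim exE conjE)
  fix \<phi> \<xi> \<eta> g assume nc: "nearly_cosymplectic M A \<phi> \<xi> \<eta> g" and ck: "\<not> cokaehler M A \<phi> \<xi> \<eta> g"
  interpret nc_mfd M A \<phi> \<xi> \<eta> g
    using assms nc by unfold_locales (auto simp: nearly_cosymplectic_def)
  show "\<exists>\<phi> \<xi> \<eta> g. sasaki_einstein M A \<phi> \<xi> \<eta> g"
    by (rule sasaki_einstein_exists[OF ck])
next
  fix \<phi> \<xi> \<eta> g assume se: "sasaki_einstein M A \<phi> \<xi> \<eta> g"
  then have "riemannian_metric M A g"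
    by (auto simp: sasaki_einstein_def SU2_structure_def almost_contact_metric_def)
  then interpret se_mfd M A g \<phi> \<xi> \<eta>
    using assms se by unfold_locales
  show "\<exists>\<phi> \<xi> \<eta> g. one_parameter_family M A \<phi> \<xi> \<eta> g \<and>
      (\<forall>t. nearly_cosymplectic M A (\<phi> t) (\<xi> t) (\<eta> t) (g t) \<and> \<not> cokaehler M A (\<phi> t) (\<xi> t) (\<eta> t) (g t))"
    using rescaled_family nearly_cosymplectic_rescale[OF exp_gt_zero] by blast
qed

end
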